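(* Let $n\in\{2,3,4\}$, let $\rho>0$, and let $s\in[0,\tfrac1{14}]$ if $n=2$, $s\in[0,\tfrac1{10})$ if $n=3$, and $s\in[0,\tfrac1{22})$ if $n=4$. Let $u_\epsilon\in\mathcal A$ be a sequence indexed by $\epsilon\to0$ (with $\epsilon\in(0,1)$) such that $E_\epsilon^{(n)}[u_\epsilon]\le C$ for some constant $C$ independent of $\epsilon$ and $\operatorname{spt}u_\epsilon\subset B_\rho(0)$ for all $\epsilon$. Then, after selection of a subsequence, there is $A\in\mathcal A_0^{(n)}$ such that $$\mathbb A[u_\epsilon]\rightharpoonup A\quad\text{weakly in }H^s(\mathbb R)\quad\text{as }\epsilon\to0.$$ Here $$\mathcal A_0^{(n)}:=\Big\{A\in X:\ \int_{\mathbb R}A(x)\,dx=1\Big\},$$ where $X=H^{1/2}(\mathbb R)$ if $n=2$, $X=H^1(\mathbb R)$ if $n=3$, and $X=\bigcap_{s'<7/10}H^{s'}(\mathbb R)$ if $n=4$.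
   Context: Write $x=(x_1,x')\in\mathbb R\times\mathbb R^{n-1}$ and $\nabla=(\partial_1,\nabla')$. The Fourier transform on $\mathbb R^n$ is $\widehat f(\xi)=(2\pi)^{-n/2}\int_{\mathbb R^n}f(x)e^{-ix\cdot\xi}\,dx$, with $\xi=(\xi_1,\xi')$. Admissible class: $\mathcal A=\{u\in BV(\mathbb R^n,\{0,1\}):\int_{\mathbb R^n}u\,dx=1\}$. Cross-sectional area: for $u\in\mathcal A$, $\mathbb A[u]:\mathbb R\to[0,\infty)$, $\mathbb A[u](x_1):=\int_{\mathbb R^{n-1}}u(x_1,x')\,dx'$. Energy: for $\epsilon\in(0,1)$ and $u\in\mathcal A$, $E_\epsilon^{(n)}[u]=P_\epsilon^{(n)}[u]+N_\epsilon^{(n)}[u]$ with $$P_\epsilon^{(n)}[u]=\int_{\mathbb R^n}\sqrt{|\nabla'u|^2+\epsilon^2|\partial_1u|^2}\,dx,\qquad N_\epsilon^{(n)}[u]=\gamma_n(\epsilon)\int_{\mathbb R^n}\frac{\xi_1^2}{\epsilon^2\xi_1^2+|\xi'|^2}|\widehat u(\xi)|^2\,d\xi,$$ where $P_\epsilon^{(n)}$ is understood as the (anisotropic) total variation of the $BV$ function $u$; $E_\epsilon^{(n)}[u]=\infty$ if $u\notin\mathcal A$. The prefactors are $\gamma_2(\epsilon)=\epsilon$, $\gamma_3(\epsilon)=\frac1{7|\ln\epsilon|-3\ln(\ln\mu)}$, where $\mu>1$ is determined by $\epsilon=\mu^{-1/7}(\ln\mu)^{-3/7}$, and $\gamma_n(\epsilon)=1$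 for $n\ge4$. *)

theory Defs
  imports "HOL-Analysis.Analysis"
begin

text \<open>
  \<open>\<real>\<close>-to-the-\<open>n\<close> is the type \<open>real \<times> (real^'m)\<close> with \<open>CARD('m) = n - 1\<close>, so that points are
  literally pairs \<open>(x\<^sub>1, x')\<close>; the norm and inner product of this type are the Euclidean ones.
  Elements of function spaces are represented by Lebesgue measurable functions; every notion
  below depends only on the class modulo null sets.
\<close>

section \<open>Fourier transform\<close>

definition fourier :: "('a::euclidean_space \<Rightarrow> complex) \<Rightarrow> 'a \<Rightarrow> complex" where
  "fourier f \<xi> = complex_of_real ((2 * pi) powr (- real DIM('a) / 2)) *
     (LINT x|lebesgue. f x * exp (- \<i> * complex_of_real (x \<bullet> \<xi>)))"

definition square_integrable :: "('a::euclidean_space \<Rightarrow> 'b::{banach, second_countable_topology}) \<Rightarrow> bool" where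
  "square_integrable f \<longleftrightarrow>
     f \<in> borel_measurable lebesgue \<and> integrable lebesgue (\<lambda>x. (norm (f x))\<^sup>2)"

text \<open>
  The Fourier--Plancherel transform of an \<open>L\<^sup>2\<close> function is the \<open>L\<^sup>2\<close> limit of the
  Fourier integrals of its truncations to balls. It is unique up to null sets; \<open>fourier_L2\<close>
  picks a representative.
\<close>

definition has_fourier_L2 :: "('a::euclidean_space \<Rightarrow> complex) \<Rightarrow> ('a \<Rightarrow> complex) \<Rightarrow> bool" where
  "has_fourier_L2 f g \<longleftrightarrow> square_integrable f \<and> square_integrable g \<and>
     ((\<lambda>R::real. \<integral>\<^sup>+\<xi>. ennreal ((cmod (fourier (\<lambda>x. indicat_real (ball 0 R) x *\<^sub>R f x) \<xi> - g \<xi>))\<^sup>2) \<partial>lebesgue)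
        \<longlongrightarrow> 0) at_top"

definition fourier_L2 :: "('a::euclidean_space \<Rightarrow> complex) \<Rightarrow> 'a \<Rightarrow> complex" where
  "fourier_L2 f = (SOME g. has_fourier_L2 f g)"

section \<open>Sobolev spaces on the line\<close>

text \<open>Real-valued functions in \<open>H\<^sup>s\<close> of the line, for \<open>s \<ge> 0\<close>.\<close>

definition sobolev :: "real \<Rightarrow> (real \<Rightarrow> real) set" where
  "sobolev s = {f. square_integrable f \<and>
     integrable lebesgue (\<lambda>\<xi>. (1 + \<xi>\<^sup>2) powr s * (cmod (fourier_L2 (\<lambda>x. complex_of_real (f x)) \<xi>))\<^sup>2)}"

definition sobolev_norm :: "real \<Rightarrow> (real \<Rightarrow> real) \<Rightarrow> real" where
  "sobolev_norm s f =
     sqrt (LINT \<xi>|lebesgue. (1 + \<xi>\<^sup>2) powr s * (cmod (fourier_L2 (\<lambda>x. complex_of_real (f x)) \<xi>))\<^sup>2)"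

text \<open>
  Bounded linear functionals. Boundedness forces them to respect equality almost everywhere;
  their values outside \<open>sobolev s\<close> are irrelevant.
\<close>

definition sobolev_dual :: "real \<Rightarrow> ((real \<Rightarrow> real) \<Rightarrow> real) set" where
  "sobolev_dual s = {L.
     (\<forall>f\<in>sobolev s. \<forall>g\<in>sobolev s. L (\<lambda>x. f x + g x) = L f + L g) \<and>
     (\<forall>f\<in>sobolev s. \<forall>c. L (\<lambda>x. c * f x) = c * L f) \<and>
     (\<exists>B. \<forall>f\<in>sobolev s. \<bar>L f\<bar> \<le> B * sobolev_norm s f)}"

definition sobolev_weakly_converges :: "real \<Rightarrow> (nat \<Rightarrow> real \<Rightarrow> real) \<Rightarrow> (real \<Rightarrow> real) \<Rightarrow> bool" where
  "sobolev_weakly_converges s f g \<longleftrightarrow> (\<forall>k. f k \<in> sobolev s) \<and> g \<in> sobolev s \<and>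
     (\<forall>L\<in>sobolev_dual s. (\<lambda>k. L (f k)) \<longlonglongrightarrow> L g)"

section \<open>Functions of bounded variation\<close>

definition C1_compact :: "('a::euclidean_space \<Rightarrow> 'a) set" where
  "C1_compact = {\<phi>. (\<forall>x. \<phi> differentiable at x) \<and>
     (\<forall>v. continuous_on UNIV (\<lambda>x. frechet_derivative \<phi> (at x) v)) \<and>
     compact (closure {x. \<phi> x \<noteq> 0})}"

text \<open>\<open>\<epsilon> \<partial>\<^sub>1 \<phi>\<^sub>1 + div' \<phi>'\<close>; the ordinary divergence for \<open>\<epsilon> = 1\<close>.\<close>

definition aniso_div :: "real \<Rightarrow> (real \<times> (real^'m) \<Rightarrow> real \<times> (real^'m)) \<Rightarrow> real \<times> (real^'m) \<Rightarrow> real" where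
  "aniso_div \<epsilon> \<phi> x = \<epsilon> * fst (frechet_derivative \<phi> (at x) (1, 0)) +
     (\<Sum>j\<in>UNIV. snd (frechet_derivative \<phi> (at x) (0, axis j 1)) $ j)"

text \<open>
  Total variation of the vector measure \<open>(\<epsilon> \<partial>\<^sub>1 u, \<nabla>' u)\<close>, by duality. This is the meaning of the
  integral of \<open>sqrt (|\<nabla>' u|\<^sup>2 + \<epsilon>\<^sup>2 |\<partial>\<^sub>1 u|\<^sup>2)\<close> for \<open>u\<close> of bounded variation, because
  \<open>sqrt (|p'|\<^sup>2 + \<epsilon>\<^sup>2 p\<^sub>1\<^sup>2)\<close> is the supremum of \<open>\<epsilon> p\<^sub>1 q\<^sub>1 + p' \<bullet> q'\<close> over \<open>|q| \<le> 1\<close>.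
\<close>

definition aniso_variation :: "real \<Rightarrow> (real \<times> (real^'m) \<Rightarrow> real) \<Rightarrow> ennreal" where
  "aniso_variation \<epsilon> u =
     (SUP \<phi>\<in>{\<phi>\<in>C1_compact. \<forall>x. norm (\<phi> x) \<le> 1}.
        ennreal (LINT x|lebesgue. u x * aniso_div \<epsilon> \<phi> x))"

definition BV :: "(real \<times> (real^'m) \<Rightarrow> real) set" where
  "BV = {u. integrable lebesgue u \<and> aniso_variation 1 u < \<infinity>}"

definition admissible :: "(real \<times> (real^'m) \<Rightarrow> real) set" where
  "admissible = {u\<in>BV. (AE x in lebesgue. u x \<in> {0, 1}) \<and> (LINT x|lebesgue. u x) = 1}"

definition ess_support :: "('a::euclidean_space \<Rightarrow> real) \<Rightarrow> 'a set" where
  "ess_support u = - \<Union>{U. open U \<and> (AE x in lebesgue. x \<in> U \<longrightarrow> u x = 0)}"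

definition cross_area :: "(real \<times> (real^'m) \<Rightarrow> real) \<Rightarrow> real \<Rightarrow> real" where
  "cross_area u x1 = (LINT x'|lebesgue. u (x1, x'))"

section \<open>Energy\<close>

text \<open>
  The defining equation of \<open>\<mu>\<close> has exactly one solution for every \<open>\<epsilon> > 0\<close>, since its right-hand
  side decreases strictly from \<open>\<infinity>\<close> to \<open>0\<close> on \<open>\<mu> > 1\<close>.
\<close>

definition mu :: "real \<Rightarrow> real" where
  "mu \<epsilon> = (THE \<mu>. \<mu> > 1 \<and> \<epsilon> = \<mu> powr (- 1 / 7) * (ln \<mu>) powr (- 3 / 7))"

definition prefactor :: "nat \<Rightarrow> real \<Rightarrow> real" where
  "prefactor n \<epsilon> =
     (if n = 2 then \<epsilon>
      else if n = 3 then 1 / (7 * \<bar>ln \<epsilon>\<bar> - 3 * ln (ln (mu \<epsilon>)))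
      else 1)"

definition nonlocal_energy :: "real \<Rightarrow> (real \<times> (real^'m) \<Rightarrow> real) \<Rightarrow> ennreal" where
  "nonlocal_energy \<epsilon> u = ennreal (prefactor (CARD('m) + 1) \<epsilon>) *
     (\<integral>\<^sup>+\<xi>. ennreal ((fst \<xi>)\<^sup>2 / (\<epsilon>\<^sup>2 * (fst \<xi>)\<^sup>2 + (norm (snd \<xi>))\<^sup>2) *
                (cmod (fourier (\<lambda>x. complex_of_real (u x)) \<xi>))\<^sup>2) \<partial>lebesgue)"

definition energy :: "real \<Rightarrow> (real \<times> (real^'m) \<Rightarrow> real) \<Rightarrow> ennreal" where
  "energy \<epsilon> u =
     (if u \<in> admissible then aniso_variation \<epsilon> u + nonlocal_energy \<epsilon> u else \<infinity>)"

section \<open>Limit class\<close>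

text \<open>
  For \<open>n = 4\<close> it suffices to intersect over \<open>0 \<le> s' < 7/10\<close>, because the spaces \<open>H\<close> of order
  \<open>s'\<close> decrease in \<open>s'\<close>.
\<close>

definition limit_space :: "nat \<Rightarrow> (real \<Rightarrow> real) set" where
  "limit_space n =
     (if n = 2 then sobolev (1/2)
      else if n = 3 then sobolev 1
      else (\<Inter>s'\<in>{0..<7/10}. sobolev s'))"

definition limit_class :: "nat \<Rightarrow> (real \<Rightarrow> real) set" where
  "limit_class n =
     {A\<in>limit_space n. integrable lebesgue A \<and> (LINT x|lebesgue. A x) = 1}"

end

theory Submission
  imports Defs "HOL-Probability.Characteristic_Functions" "HOL-Complex_Analysis.Great_Picard"
begin

text \<open>
  The transform of the cross-sectional area \<open>A\<close> of \<open>u\<close> is, up to a constant, the restriction of the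
  transform \<open>F\<close> of \<open>u\<close> to the axis \<open>\<xi>' = 0\<close>. The nonlocal energy bounds an integral of \<open>|F|\<^sup>2\<close> in which the
  kernel \<open>\<xi>\<^sub>1\<^sup>2 / (\<epsilon>\<^sup>2 \<xi>\<^sub>1\<^sup>2 + |\<xi>'|\<^sup>2)\<close> concentrates at this axis. The bounded support of \<open>u\<close> allows to pass from the
  integral to the values on the axis in two ways.

  First, \<open>u\<close> is unchanged by a cutoff in \<open>x'\<close>, hence \<open>F(\<xi>\<^sub>1, 0)\<close> is controlled by the integral of
  \<open>|F(\<xi>\<^sub>1, \<xi>')|\<^sup>2 / (1 + |\<xi>'|\<^sup>2)\<close> over \<open>\<xi>'\<close> (\<open>localization\<close>). This gives a bound, with the prefactor, on
  the integral of \<open>min (\<xi>\<^sup>2) (1 / \<epsilon>\<^sup>2)\<close> times the squared transform of \<open>A\<close> (\<open>high_frequency_bound\<close>).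

  Second, \<open>F(\<xi>\<^sub>1, \<xi>') - F(\<xi>\<^sub>1, 0)\<close> is of order \<open>|\<xi>'|\<close> in \<open>L\<^sup>2\<close> with respect to \<open>\<xi>\<^sub>1\<close>. For frequencies below a
  cutoff that tends to infinity as \<open>\<epsilon>\<close> tends to \<open>0\<close>, the transform may therefore be frozen at the axis, and the
  kernel can be integrated over a small ball. With the prefactor this integral is at least a multiple of \<open>|\<xi>|\<close> for
  \<open>n = 2\<close> and of \<open>\<xi>\<^sup>2\<close> for \<open>n = 3\<close>, where it diverges like \<open>|ln \<epsilon>|\<close> before multiplication by the prefactor; for
  \<open>n = 4\<close> the first bound suffices (\<open>low_frequency_weighted_bound\<close>). By Fatou's lemma every pointwise limit
  of the transforms inherits the regularity \<open>H\<^sup>1\<^sup>/\<^sup>2\<close> or \<open>H\<^sup>1\<close>.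

  Frequencies far above \<open>1 / \<epsilon>\<close> are controlled by the perimeter: testing the anisotropic variation with a plane
  wave in \<open>x\<^sub>1\<close> shows that \<open>\<epsilon> |\<xi>|\<close> times the transform of \<open>A\<close> is bounded (\<open>FT_section_area_decay\<close>). The
  three estimates together bound \<open>A\<close> in \<open>H\<^bsup>1/8\<^esup>\<close> uniformly (\<open>uniform_sobolev_bound\<close>), and \<open>1/8\<close> exceeds all
  the exponents \<open>s\<close> in question. The transforms of the areas are uniformly bounded and Lipschitz, so that a
  subsequence converges pointwise; the uniform \<open>H\<^bsup>1/8\<^esup>\<close> bound excludes a loss of mass at high frequencies, and
  the convergence is strong in \<open>H\<^sup>s\<close> (\<open>weighted_L2_convergence\<close>), in particular weak. By Plancherel's theorem the
  areas converge in \<open>L\<^sup>2\<close> as well, and since they live in a fixed interval their total mass \<open>1\<close> is preserved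
  (\<open>mass_profile_limit\<close>).

  Plancherel's theorem is proved for bounded functions with bounded support, by Gaussian summation of the transform
  of the autocorrelation. For these functions the \<open>L\<^sup>2\<close> transform in the definition of the Sobolev spaces is the
  Fourier integral almost everywhere (\<open>fourier_L2_eq\<close>).
\<close>

section \<open>Gaussian integrals\<close>

text \<open>
  A rescaling of the characteristic function of the standard normal distribution.
\<close>

lemma gaussian_integral_real:
  fixes \<delta> t :: real assumes "\<delta> > 0"
  shows "integrable lborel (\<lambda>x. complex_of_real (exp (-(\<delta> * x)\<^sup>2 / 2)) * exp (\<i> * complex_of_real (t * x)))" (is "integrable _ ?g")
    and "(LINT x|lborel. complex_of_real (exp (-(\<delta> * x)\<^sup>2 / 2)) * exp (\<i> * complex_of_real (t * x)))
       = complex_of_real (sqrt (2 * pi) / \<delta> * exp (-(t / \<delta>)\<^sup>2 / 2))"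
proof -
  let ?s = "t / \<delta>"
  define f where "f = (\<lambda>x::real. std_normal_density x *\<^sub>R iexp (?s * x))"
  interpret real_distribution std_normal_distribution by (rule real_dist_normal_dist)
  have int: "integrable std_normal_distribution (\<lambda>x. iexp (?s * x))"
    by (rule integrable_iexp) auto
  have f_int: "integrable lborel f"
    using int unfolding f_def by (subst (asm) integrable_density) auto
  have "char std_normal_distribution ?s = integral\<^sup>L lborel f"
    unfolding char_def f_def by (subst integral_density) auto
  then have f_val: "integral\<^sup>L lborel f = complex_of_real (exp (- ?s\<^sup>2 / 2))"
    by (simp add: char_std_normal_distribution)
  have g: "?g = (\<lambda>x. complex_of_real (sqrt (2 * pi)) * f (0 + \<delta> * x))"
  proof
    fix x
    have st: "?s * (0 + \<delta> * x) = t * x" "0 + \<delta> * x = \<delta> * x" using assms by auto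
    have "sqrt (2 * pi) * std_normal_density (\<delta> * x) = exp (-(\<delta> * x)\<^sup>2 / 2)"
      by (simp add: std_normal_density_def)
    then show "?g x = complex_of_real (sqrt (2 * pi)) * f (0 + \<delta> * x)"
      unfolding f_def scaleR_conv_of_real st using assms by (simp add: mult.assoc[symmetric] flip: of_real_mult)
  qed
  have "integrable lborel (\<lambda>x. f (0 + \<delta> * x))"
    using lborel_integrable_real_affine[OF f_int, of \<delta> 0] assms by simp
  then show "integrable lborel ?g" unfolding g by simp
  have "integral\<^sup>L lborel f = \<bar>\<delta>\<bar> *\<^sub>R (LINT x|lborel. f (0 + \<delta> * x))"
    by (rule lborel_integral_real_affine) (use assms in auto)
  then have "(LINT x|lborel. f (0 + \<delta> * x)) = complex_of_real (exp (- ?s\<^sup>2 / 2) / \<delta>)"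
    using assms f_val by (simp add: scaleR_conv_of_real field_simps)
  then have "(LINT x|lborel. complex_of_real (sqrt (2 * pi)) * f (0 + \<delta> * x)) =
      complex_of_real (sqrt (2 * pi)) * complex_of_real (exp (- ?s\<^sup>2 / 2) / \<delta>)"
    by (simp only: integral_mult_right_zero)
  then show "integral\<^sup>L lborel ?g = complex_of_real (sqrt (2 * pi) / \<delta> * exp (-(t / \<delta>)\<^sup>2 / 2))"
    unfolding g by (simp add: field_simps)
qed

text \<open>
  Lebesgue measure is a product over the basis, and the integrand factors in the same way.
\<close>

lemma gaussian_integral:
  fixes z :: "'a::euclidean_space" and \<delta> :: real assumes "\<delta> > 0"
  shows "integrable lborel (\<lambda>\<xi>::'a. complex_of_real (exp (-(\<delta> * norm \<xi>)\<^sup>2 / 2)) * exp (\<i> * complex_of_real (z \<bullet> \<xi>)))" (is "integrable _ ?g")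
    and "(LINT \<xi>|lborel. complex_of_real (exp (-(\<delta> * norm \<xi>)\<^sup>2 / 2)) * exp (\<i> * complex_of_real (z \<bullet> \<xi>)))
       = complex_of_real ((sqrt (2 * pi) / \<delta>) ^ DIM('a) * exp (-(norm z / \<delta>)\<^sup>2 / 2))"
proof -
  define h where "h = (\<lambda>(b::'a) x. complex_of_real (exp (-(\<delta> * x)\<^sup>2 / 2)) * exp (\<i> * complex_of_real ((z \<bullet> b) * x)))"
  interpret product_sigma_finite "\<lambda>_::'a. lborel :: real measure" ..
  have norm_eq: "(norm (v::'a))\<^sup>2 = (\<Sum>b\<in>Basis. (v \<bullet> b)\<^sup>2)" for v
    by (simp add: euclidean_inner[of v v] power2_norm_eq_inner power2_eq_square[of "v \<bullet> _"])
  have comp: "?g (\<Sum>b\<in>Basis. f b *\<^sub>R b) = (\<Prod>b\<in>Basis. h b (f b))" for f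
  proof -
    let ?v = "\<Sum>b\<in>Basis. f b *\<^sub>R (b::'a)"
    have v: "?v \<bullet> b = f b" if "b \<in> Basis" for b using that by simp
    have 1: "-(\<delta> * norm ?v)\<^sup>2 / 2 = (\<Sum>b\<in>Basis. -(\<delta> * f b)\<^sup>2 / 2)"
      unfolding power_mult_distrib norm_eq using v
      by (simp add: sum_distrib_left sum_negf sum_divide_distrib power_mult_distrib)
    have 2: "z \<bullet> ?v = (\<Sum>b\<in>Basis. (z \<bullet> b) * f b)"
      by (simp add: inner_sum_right mult.commute)
    show ?thesis unfolding 1 2 h_def
      by (simp add: exp_sum prod.distrib sum_distrib_left)
  qed
  have hi: "integrable lborel (h b)" and hv: "integral\<^sup>L lborel (h b) = complex_of_real (sqrt (2 * pi) / \<delta> * exp (-((z \<bullet> b) / \<delta>)\<^sup>2 / 2))" for b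
    using gaussian_integral_real[OF assms, of "z \<bullet> b"] unfolding h_def by auto
  have m: "?g \<in> borel_measurable borel" by measurable
  have d: "(lborel::'a measure) = distr (\<Pi>\<^sub>M b\<in>Basis. lborel) borel (\<lambda>f. \<Sum>b\<in>Basis. f b *\<^sub>R b)"
    by (rule lborel_eq)
  have mm: "(\<lambda>f. \<Sum>b\<in>Basis. f b *\<^sub>R (b::'a)) \<in> measurable (\<Pi>\<^sub>M b\<in>Basis. lborel) borel"
    by measurable
  have "integrable (\<Pi>\<^sub>M b\<in>(Basis::'a set). lborel) (\<lambda>f. \<Prod>b\<in>Basis. h b (f b))"
    by (rule product_integrable_prod) (auto simp: hi)
  then show "integrable lborel ?g"
    unfolding d by (subst integrable_distr_eq[OF mm m]) (simp only: comp)
  have "integral\<^sup>L lborel ?g = integral\<^sup>L (\<Pi>\<^sub>M b\<in>(Basis::'a set). lborel) (\<lambda>f. \<Prod>b\<in>Basis. h b (f b))"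
    unfolding d by (subst integral_distr[OF mm m]) (simp only: comp)
  also have "\<dots> = (\<Prod>b\<in>Basis. integral\<^sup>L lborel (h b))"
    by (rule product_integral_prod) (auto simp: hi)
  also have "\<dots> = complex_of_real (\<Prod>b\<in>(Basis::'a set). sqrt (2 * pi) / \<delta> * exp (-((z \<bullet> b) / \<delta>)\<^sup>2 / 2))"
    by (simp add: hv)
  also have "(\<Prod>b\<in>(Basis::'a set). sqrt (2 * pi) / \<delta> * exp (-((z \<bullet> b) / \<delta>)\<^sup>2 / 2)) =
     (sqrt (2 * pi) / \<delta>) ^ DIM('a) * exp (-(norm z / \<delta>)\<^sup>2 / 2)"
    unfolding prod.distrib power_divide norm_eq[of z]
    by (simp add: exp_sum[symmetric] sum_negf sum_divide_distrib power_divide)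
  finally show "integral\<^sup>L lborel ?g = complex_of_real ((sqrt (2 * pi) / \<delta>) ^ DIM('a) * exp (-(norm z / \<delta>)\<^sup>2 / 2))" .
qed

section \<open>Bounded functions with bounded support\<close>

text \<open>
  On this class the Fourier integral converges absolutely, Plancherel's theorem has an elementary
  proof, and every function to which the energy estimates apply (indicators, their slices and
  partial transforms, cross-sectional areas, cutoffs) belongs to it.
\<close>

definition bounded_cs :: "('a::euclidean_space \<Rightarrow> complex) \<Rightarrow> bool" where
  "bounded_cs f \<longleftrightarrow> f \<in> borel_measurable borel \<and> (\<exists>B R. \<forall>x. cmod (f x) \<le> B * indicat_real (ball 0 R) x)"

lemma bounded_csE:
  assumes "bounded_cs f"
  obtains B R where "f \<in> borel_measurable borel" "B > 0" "R > 0" "\<And>x. cmod (f x) \<le> B * indicat_real (ball 0 R) x"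
proof -
  obtain B R where *: "f \<in> borel_measurable borel" "\<And>x. cmod (f x) \<le> B * indicat_real (ball 0 R) x"
    using assms unfolding bounded_cs_def by auto
  have "cmod (f x) \<le> max B 1 * indicat_real (ball 0 (max R 1)) x" for x
  proof (cases "norm x < R")
    case True
    then show ?thesis using *(2)[of x] by (auto simp: indicator_def)
  next
    case False
    then have "f x = 0" using *(2)[of x] by (auto simp: indicator_def)
    then show ?thesis by simp
  qed
  then show ?thesis using that[of "max B 1" "max R 1"] *(1) by auto
qed

lemma bounded_csI:
  assumes "f \<in> borel_measurable borel" "\<And>x. cmod (f x) \<le> B * indicat_real (ball 0 R) x"
  shows "bounded_cs f"
  using assms unfolding bounded_cs_def by auto

lemma integrable_indicator_ball: "integrable lborel (\<lambda>x::'a::euclidean_space. B * indicat_real (ball c R) x :: real)"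
  by (intro integrable_mult_right integrable_real_indicator)
     (use emeasure_lborel_ball_finite in auto)

lemma bounded_cs_integrable:
  assumes "bounded_cs f" shows "integrable lborel f"
proof -
  obtain B R where *: "f \<in> borel_measurable borel" "\<And>x. cmod (f x) \<le> B * indicat_real (ball 0 R) x"
    using assms unfolding bounded_cs_def by auto
  show ?thesis
    by (rule Bochner_Integration.integrable_bound[OF integrable_indicator_ball[of B 0 R]])
       (use * in \<open>auto intro!: AE_I2 intro: order_trans[OF _ abs_ge_self]\<close>)
qed

lemma bounded_cs_mult:
  assumes f: "bounded_cs f" and g: "g \<in> borel_measurable borel" "\<And>x. cmod (g x) \<le> K"
  shows "bounded_cs (\<lambda>x. f x * g x)"
proof -
  obtain B R where *: "f \<in> borel_measurable borel" "B > 0" "R > 0" "\<And>x. cmod (f x) \<le> B * indicat_real (ball 0 R) x"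
    using bounded_csE[OF f] by metis
  have "K \<ge> 0" using g(2)[of 0] norm_ge_zero order_trans by blast
  show ?thesis
  proof (rule bounded_csI[where B = "B * K" and R = R])
    show "(\<lambda>x. f x * g x) \<in> borel_measurable borel" using * g by measurable
    fix x
    have "cmod (f x * g x) \<le> (B * indicat_real (ball 0 R) x) * K"
      unfolding norm_mult using * g \<open>K \<ge> 0\<close> by (intro mult_mono) auto
    then show "cmod (f x * g x) \<le> B * K * indicat_real (ball 0 R) x" by (simp add: mult_ac)
  qed
qed

lemma bounded_cs_add:
  assumes f: "bounded_cs f" and g: "bounded_cs g"
  shows "bounded_cs (\<lambda>x. f x + g x)"
proof -
  obtain B R where 1: "f \<in> borel_measurable borel" "B > 0" "R > 0" "\<And>x. cmod (f x) \<le> B * indicat_real (ball 0 R) x"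
    using bounded_csE[OF f] by metis
  obtain B' R' where 2: "g \<in> borel_measurable borel" "B' > 0" "R' > 0" "\<And>x. cmod (g x) \<le> B' * indicat_real (ball 0 R') x"
    using bounded_csE[OF g] by metis
  show ?thesis
  proof (rule bounded_csI[where B = "B + B'" and R = "max R R'"])
    show "(\<lambda>x. f x + g x) \<in> borel_measurable borel" using 1 2 by measurable
    fix x
    have "cmod (f x + g x) \<le> B * indicat_real (ball 0 R) x + B' * indicat_real (ball 0 R') x"
      using 1(4)[of x] 2(4)[of x] norm_triangle_ineq[of "f x" "g x"] by linarith
    also have "\<dots> \<le> (B + B') * indicat_real (ball 0 (max R R')) x"
      using 1 2 by (auto simp: indicator_def)
    finally show "cmod (f x + g x) \<le> (B + B') * indicat_real (ball 0 (max R R')) x" .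
  qed
qed

lemma bounded_cs_cmult: "bounded_cs f \<Longrightarrow> bounded_cs (\<lambda>x. c * f x)"
  using bounded_cs_mult[of f "\<lambda>_. c" "cmod c"] by (simp add: mult.commute)

lemma bounded_cs_diff:
  assumes f: "bounded_cs f" and g: "bounded_cs g"
  shows "bounded_cs (\<lambda>x. f x - g x)"
  using bounded_cs_add[OF f bounded_cs_cmult[OF g, of "-1"]] by simp

lemma bounded_cs_translate:
  assumes f: "bounded_cs f"
  shows "bounded_cs (\<lambda>x. f (x + t))"
proof -
  obtain B R where 1: "f \<in> borel_measurable borel" "B > 0" "R > 0" "\<And>x. cmod (f x) \<le> B * indicat_real (ball 0 R) x"
    using bounded_csE[OF f] by metis
  show ?thesis
  proof (rule bounded_csI[where B = "B" and R = "R + norm t"])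
    show "(\<lambda>x. f (x + t)) \<in> borel_measurable borel" using 1 by measurable
    fix x
    have "indicat_real (ball 0 R) (x + t) \<le> indicat_real (ball 0 (R + norm t)) x"
      using norm_triangle_ineq4[of "x + t" t] by (auto simp: indicator_def)
    then show "cmod (f (x + t)) \<le> B * indicat_real (ball 0 (R + norm t)) x"
      using 1(4)[of "x + t"] 1(2) by (meson mult_left_mono order_trans less_imp_le)
  qed
qed

lemma lborel_integral_translate:
  fixes f :: "'a::euclidean_space \<Rightarrow> 'b::{banach, second_countable_topology}"
  assumes [measurable]: "f \<in> borel_measurable borel"
  shows "(LINT x|lborel. f (x + t)) = (LINT x|lborel. f x)"
proof -
  have "(LINT x|lborel. f x) = (LINT x|distr lborel borel ((+) t). f x)"
    by (simp add: lborel_distr_plus)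
  also have "\<dots> = (LINT x|lborel. f (t + x))" by (subst integral_distr) auto
  finally show ?thesis by (simp add: add.commute)
qed

lemma lborel_integral_scale:
  fixes f :: "'a::euclidean_space \<Rightarrow> 'b::{banach, second_countable_topology}"
  assumes [measurable]: "f \<in> borel_measurable borel" and "c \<noteq> 0"
  shows "(LINT x|lborel. f x) = \<bar>c\<bar> ^ DIM('a) *\<^sub>R (LINT x|lborel. f (c *\<^sub>R x))"
proof -
  have "lborel = density (distr lborel borel (\<lambda>x::'a. 0 + c *\<^sub>R x)) (\<lambda>_. \<bar>c\<bar> ^ DIM('a))"
    by (rule lborel_affine[OF \<open>c \<noteq> 0\<close>])
  then have "(LINT x|lborel. f x) = (LINT x|density (distr lborel borel (\<lambda>x::'a. 0 + c *\<^sub>R x)) (\<lambda>_. \<bar>c\<bar> ^ DIM('a)). f x)"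
    by simp
  also have "\<dots> = (LINT x|distr lborel borel (\<lambda>x::'a. 0 + c *\<^sub>R x). \<bar>c\<bar> ^ DIM('a) *\<^sub>R f x)"
    by (subst integral_density) auto
  also have "\<dots> = (LINT x|lborel. \<bar>c\<bar> ^ DIM('a) *\<^sub>R f (c *\<^sub>R x))"
    by (subst integral_distr) auto
  finally show ?thesis by simp
qed

section \<open>Continuity of translations\<close>

text \<open>
  A Lebesgue measurable function is an almost everywhere limit of continuous functions. Projecting
  their values radially to the disc that contains the range of \<open>f\<close>, and multiplying by a continuous
  cutoff, makes them dominated, so that the limit also holds in \<open>L\<^sup>1\<close>.
\<close>

lemma continuous_approximation_L1:
  assumes f: "bounded_cs f" and "e > 0"
  obtains g where "continuous_on UNIV g" "bounded_cs g" "(LINT x|lborel. cmod (f x - g x)) < e"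
proof -
  obtain B R where fm: "f \<in> borel_measurable borel" and B: "B > 0" and R: "R > 0"
    and fb: "\<And>x. cmod (f x) \<le> B * indicat_real (ball 0 R) x"
    using bounded_csE[OF f] by metis
  have "f \<in> borel_measurable lebesgue"
    using fm by (intro measurable_completion) simp
  then have "f measurable_on UNIV"
    by (rule lebesgue_measurable_imp_measurable_on) auto
  then obtain N g where N: "negligible N" and gc: "\<And>n::nat. continuous_on UNIV (g n)"
    and gl: "\<And>x. x \<notin> N \<Longrightarrow> (\<lambda>n. g n x) \<longlonglongrightarrow> f x"
    unfolding measurable_on_def by auto
  \<comment> \<open>\<open>cut\<close> and \<open>P\<close> leave the values of \<open>f\<close> unchanged.\<close>
  define cut where "cut = (\<lambda>x::'a. complex_of_real (max 0 (min 1 (R + 1 - norm x))))"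
  define P where "P = (\<lambda>z. z * complex_of_real (B / max B (cmod z)))"
  have Pb: "cmod (P z) \<le> B" for z
  proof -
    have "cmod z / max B (cmod z) \<le> 1" using B by (simp add: divide_le_eq)
    from mult_left_mono[OF this, of B] have "B * (cmod z / max B (cmod z)) \<le> B" using B by simp
    then show ?thesis using B by (simp add: P_def norm_mult norm_divide mult.commute)
  qed
  have Pid: "P z = z" if "cmod z \<le> B" for z
    using that B by (simp add: P_def max_def)
  have Pc: "continuous_on UNIV P"
    unfolding P_def using B by (intro continuous_intros) auto
  have fB: "cmod (f x) \<le> B" for x
    using fb[of x] B by (auto simp: indicator_def split: if_splits intro: order_trans)
  have cutf: "cut x * f x = f x" for x
  proof (cases "norm x < R")
    case False
    then have "f x = 0" using fb[of x] by (simp add: indicator_def)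
    then show ?thesis by simp
  qed (simp add: cut_def)
  have cutb: "cmod (cut x) \<le> indicat_real (ball 0 (R + 1)) x" for x
    unfolding cut_def norm_of_real by (auto simp: indicator_def)
  define h where "h = (\<lambda>n x. cut x * P (g n x))"
  have cutc: "continuous_on UNIV cut" unfolding cut_def by (intro continuous_intros)
  have hc: "continuous_on UNIV (h n)" for n
    unfolding h_def
    by (intro continuous_intros cutc continuous_on_compose2[OF Pc gc]) auto
  have hm [measurable]: "h n \<in> borel_measurable borel" for n
    using hc by (rule borel_measurable_continuous_onI)
  have hb: "cmod (h n x) \<le> B * indicat_real (ball 0 (R + 1)) x" for n x
    using mult_mono[OF Pb cutb, of x "g n x"] B unfolding h_def norm_mult by (simp add: mult.commute)
  have hcs: "bounded_cs (h n)" for n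
    by (rule bounded_csI[OF hm hb])
  have hl: "(\<lambda>n. h n x) \<longlonglongrightarrow> f x" if "x \<notin> N" for x
  proof -
    have "isCont P (f x)" using Pc by (simp add: continuous_on_eq_continuous_at)
    then have "(\<lambda>n. P (g n x)) \<longlonglongrightarrow> P (f x)"
      using gl[OF that] by (rule isCont_tendsto_compose)
    then have "(\<lambda>n. h n x) \<longlonglongrightarrow> cut x * P (f x)"
      unfolding h_def by (intro tendsto_intros)
    then show ?thesis using Pid[OF fB] cutf by simp
  qed
  have AEN: "AE x in lborel. x \<notin> N"
    using N AE_completion_iff AE_not_in negligible_iff_null_sets by blast
  have "(\<lambda>n. LINT x|lborel. cmod (f x - h n x)) \<longlonglongrightarrow> (LINT x|(lborel::'a measure). 0)"
  proof (rule integral_dominated_convergence[where w = "\<lambda>x. 2 * B * indicat_real (ball 0 (R + 1)) x"])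
    show "AE x in lborel. (\<lambda>n. cmod (f x - h n x)) \<longlonglongrightarrow> 0"
      using AEN
    proof eventually_elim
      case (elim x)
      have "(\<lambda>n. cmod (f x - h n x)) \<longlonglongrightarrow> cmod (f x - f x)"
        using hl[OF elim] by (intro tendsto_intros)
      then show ?case by simp
    qed
    show "AE x in lborel. norm (cmod (f x - h n x)) \<le> 2 * B * indicat_real (ball 0 (R + 1)) x" for n
    proof (rule AE_I2)
      fix x :: 'a
      have "indicat_real (ball 0 R) x \<le> indicat_real (ball 0 (R + 1)) x" by (auto simp: indicator_def)
      then have "cmod (f x) \<le> B * indicat_real (ball 0 (R + 1)) x"
        using fb[of x] B by (meson mult_left_mono order_trans less_imp_le)
      then show "norm (cmod (f x - h n x)) \<le> 2 * B * indicat_real (ball 0 (R + 1)) x"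
        using hb[of n x] norm_triangle_ineq4[of "f x" "h n x"] by simp
    qed
    show "integrable lborel (\<lambda>x. 2 * B * indicat_real (ball 0 (R + 1)) x)"
      by (rule integrable_indicator_ball)
  qed (use fm in measurable)
  then have "\<forall>\<^sub>F n in sequentially. (LINT x|lborel. cmod (f x - h n x)) < e"
    using \<open>e > 0\<close> by (simp add: order_tendsto_iff)
  then obtain n where "(LINT x|lborel. cmod (f x - h n x)) < e"
    by (auto simp: eventually_sequentially)
  then show ?thesis using that hc hcs by blast
qed

lemma bounded_cs_norm_diff_integrable:
  assumes "bounded_cs f" "bounded_cs g" shows "integrable lborel (\<lambda>x. cmod (f x - g x))"
  using bounded_cs_integrable[OF bounded_cs_diff[OF assms]] by (rule integrable_norm)

text \<open>
  For continuous functions this is dominated convergence. Translations preserve the \<open>L\<^sup>1\<close> distance,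
  hence approximation by continuous functions gives the general case.
\<close>

lemma translation_continuous_L1:
  fixes t :: "nat \<Rightarrow> 'a::euclidean_space"
  assumes f: "bounded_cs f" and t: "t \<longlonglongrightarrow> 0"
  shows "(\<lambda>n. LINT x|lborel. cmod (f (x + t n) - f x)) \<longlonglongrightarrow> 0"
proof (rule LIMSEQ_I, goal_cases)
  case (1 e)
  obtain g where gc: "continuous_on UNIV g" and g: "bounded_cs g"
    and ge: "(LINT x|lborel. cmod (f x - g x)) < e / 3"
    using continuous_approximation_L1[OF f, of "e/3"] 1 by auto
  obtain B R where gm[measurable]: "g \<in> borel_measurable borel" and B: "B > 0" and R: "R > 0"
    and gb: "\<And>x. cmod (g x) \<le> B * indicat_real (ball 0 R) x"
    using bounded_csE[OF g] by metis
  have fm[measurable]: "f \<in> borel_measurable borel" using f by (simp add: bounded_cs_def)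
  obtain T where T: "\<And>n. norm (t n) \<le> T"
    using t convergent_imp_Bseq[of t] by (auto simp: convergent_def Bseq_def)
  have "(\<lambda>n. LINT x|lborel. cmod (g (x + t n) - g x)) \<longlonglongrightarrow> (LINT x|(lborel::'a measure). 0)"
  proof (rule integral_dominated_convergence[where w = "\<lambda>x. 2 * B * indicat_real (ball 0 (R + T)) x"])
    show "AE x in lborel. (\<lambda>n. cmod (g (x + t n) - g x)) \<longlonglongrightarrow> 0"
    proof (rule AE_I2)
      fix x :: 'a
      have "isCont g x" using gc by (simp add: continuous_on_eq_continuous_at)
      moreover have "(\<lambda>n. x + t n) \<longlonglongrightarrow> x" using tendsto_add[OF tendsto_const t, of x] by simp
      ultimately have "(\<lambda>n. g (x + t n)) \<longlonglongrightarrow> g x" by (rule isCont_tendsto_compose)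
      then have "(\<lambda>n. cmod (g (x + t n) - g x)) \<longlonglongrightarrow> cmod (g x - g x)" by (intro tendsto_intros)
      then show "(\<lambda>n. cmod (g (x + t n) - g x)) \<longlonglongrightarrow> 0" by simp
    qed
    show "AE x in lborel. norm (cmod (g (x + t n) - g x)) \<le> 2 * B * indicat_real (ball 0 (R + T)) x" for n
    proof (rule AE_I2)
      fix x :: 'a
      have 1: "indicat_real (ball 0 R) x \<le> indicat_real (ball 0 (R + T)) x"
        using order_trans[OF norm_ge_zero T] by (simp add: indicator_def)
        have 2: "indicat_real (ball 0 R) (x + t n) \<le> indicat_real (ball 0 (R + T)) x"
        using norm_triangle_ineq4[of "x + t n" "t n"] T[of n] by (simp add: indicator_def)
      have "cmod (g x) \<le> B * indicat_real (ball 0 (R + T)) x" "cmod (g (x + t n)) \<le> B * indicat_real (ball 0 (R + T)) x"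
        using gb[of x] gb[of "x + t n"] 1 2 B by (meson mult_left_mono order_trans less_imp_le)+
      then show "norm (cmod (g (x + t n) - g x)) \<le> 2 * B * indicat_real (ball 0 (R + T)) x"
        using norm_triangle_ineq4[of "g (x + t n)" "g x"] by simp
    qed
    show "integrable lborel (\<lambda>x. 2 * B * indicat_real (ball 0 (R + T)) x)"
      by (rule integrable_indicator_ball)
  qed measurable
  then have "\<forall>\<^sub>F n in sequentially. (LINT x|lborel. cmod (g (x + t n) - g x)) < e / 3"
    by (rule order_tendstoD) (use 1 in simp)
  then obtain n0 where n0: "\<And>n. n \<ge> n0 \<Longrightarrow> (LINT x|lborel. cmod (g (x + t n) - g x)) < e / 3"
    by (auto simp: eventually_sequentially)
  have "(LINT x|lborel. cmod (f (x + t n) - f x)) < e" if "n \<ge> n0" for n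
  proof -
    have i1: "integrable lborel (\<lambda>x. cmod (f (x + t n) - g (x + t n)))"
      and i2: "integrable lborel (\<lambda>x. cmod (g (x + t n) - g x))"
      and i3: "integrable lborel (\<lambda>x. cmod (g x - f x))"
      and i4: "integrable lborel (\<lambda>x. cmod (f (x + t n) - f x))"
      by (intro bounded_cs_norm_diff_integrable bounded_cs_translate f g)+
    have "(LINT x|lborel. cmod (f (x + t n) - f x)) \<le>
      (LINT x|lborel. (cmod (f (x + t n) - g (x + t n)) + cmod (g (x + t n) - g x)) + cmod (g x - f x))"
    proof (rule integral_mono[OF i4])
      show "integrable lborel (\<lambda>x. (cmod (f (x + t n) - g (x + t n)) + cmod (g (x + t n) - g x)) + cmod (g x - f x))"
        by (intro Bochner_Integration.integrable_add i1 i2 i3)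
      fix x
      have "f (x + t n) - f x = (f (x + t n) - g (x + t n)) + (g (x + t n) - g x) + (g x - f x)" by simp
      then show "cmod (f (x + t n) - f x) \<le> (cmod (f (x + t n) - g (x + t n)) + cmod (g (x + t n) - g x)) + cmod (g x - f x)"
        by (metis add_mono norm_triangle_ineq norm_triangle_mono order_refl)
    qed
    also have "\<dots> = (LINT x|lborel. cmod (f (x + t n) - g (x + t n))) + (LINT x|lborel. cmod (g (x + t n) - g x)) + (LINT x|lborel. cmod (g x - f x))"
      using i1 i2 i3 by (simp add: Bochner_Integration.integrable_add)
    also have "(LINT x|lborel. cmod (f (x + t n) - g (x + t n))) = (LINT x|lborel. cmod (f x - g x))"
      by (rule lborel_integral_translate[of "\<lambda>x. cmod (f x - g x)"]) measurable
    also have "(LINT x|lborel. cmod (g x - f x)) = (LINT x|lborel. cmod (f x - g x))"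
      by (simp add: norm_minus_commute)
    finally show ?thesis using ge n0[OF that] by linarith
  qed
  then show ?case
    by (intro exI[of _ n0]) (auto intro!: Bochner_Integration.integral_nonneg simp: abs_of_nonneg)
qed

section \<open>Plancherel's theorem\<close>

text \<open>
  The transform without the normalising power of \<open>2\<pi>\<close>: then partial transforms compose, and
  evaluation at frequency \<open>0\<close> is integration, without any constants.
\<close>

definition FT :: "('a::euclidean_space \<Rightarrow> complex) \<Rightarrow> 'a \<Rightarrow> complex" where
  "FT f \<xi> = (LINT x|lborel. f x * exp (- \<i> * complex_of_real (x \<bullet> \<xi>)))"

lemma cmod_exp_ii [simp]: "cmod (exp (\<i> * complex_of_real r)) = 1" "cmod (exp (- (\<i> * complex_of_real r))) = 1"
  using norm_exp_i_times[of r] norm_exp_i_times[of "-r"] by simp_all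

lemma cnj_exp_ii [simp]: "cnj (exp (\<i> * complex_of_real r)) = exp (- (\<i> * complex_of_real r))"
  "cnj (exp (- (\<i> * complex_of_real r))) = exp (\<i> * complex_of_real r)"
  by (simp_all add: exp_cnj)

lemma FT_measurable [measurable]:
  assumes "f \<in> borel_measurable borel"
  shows "FT f \<in> borel_measurable borel"
proof -
  have [measurable]: "f \<in> borel_measurable lborel" using assms by simp
  show ?thesis unfolding FT_def
    by (rule lborel.borel_measurable_lebesgue_integral) (use assms in measurable)
qed

lemma bounded_cs_modulate:
  assumes "bounded_cs f" shows "bounded_cs (\<lambda>x. f x * exp (- \<i> * complex_of_real (x \<bullet> \<xi>)))"
  by (rule bounded_cs_mult[OF assms, where K=1]) auto

lemma cmod_FT_le:
  assumes "bounded_cs f"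
  shows "cmod (FT f \<xi>) \<le> (LINT x|lborel. cmod (f x))"
proof -
  have "cmod (FT f \<xi>) \<le> (LINT x|lborel. cmod (f x * exp (- \<i> * complex_of_real (x \<bullet> \<xi>))))"
    unfolding FT_def by (rule integral_norm_bound)
  then show ?thesis by (simp add: norm_mult)
qed

text \<open>
  Its value at \<open>0\<close> is the squared \<open>L\<^sup>2\<close> norm of \<open>f\<close>, and its Fourier transform is, up to a
  reflection, the squared modulus of the transform of \<open>f\<close>; Plancherel's theorem is Fourier inversion for it at \<open>0\<close>.
\<close>

definition autocorr :: "('a::euclidean_space \<Rightarrow> complex) \<Rightarrow> 'a \<Rightarrow> complex" where
  "autocorr f z = (LINT x|lborel. f x * cnj (f (x + z)))"

lemma cnj_measurable [measurable (raw)]: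
  "f \<in> borel_measurable M \<Longrightarrow> (\<lambda>x. cnj (f x)) \<in> borel_measurable M"
  by (rule measurable_compose[OF _ borel_measurable_continuous_onI[OF continuous_on_cnj[OF continuous_on_id]]])

lemma autocorr_bounded_cs:
  assumes f: "bounded_cs f" shows "bounded_cs (autocorr f)"
proof -
  obtain B R where fm[measurable]: "f \<in> borel_measurable borel" and B: "B > 0" and R: "R > 0"
    and fb: "\<And>x. cmod (f x) \<le> B * indicat_real (ball 0 R) x"
    using bounded_csE[OF f] by metis
  show ?thesis
  proof (rule bounded_csI[where B = "LINT x|(lborel::'a measure). B * B * indicat_real (ball 0 R) x" and R = "2 * R"])
    show "autocorr f \<in> borel_measurable borel"
    proof -
      have "(\<lambda>(z, x). f x * cnj (f (x + z))) \<in> borel_measurable (borel \<Otimes>\<^sub>M lborel)"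
        by measurable
      then show ?thesis unfolding autocorr_def[abs_def]
        by (intro lborel.borel_measurable_lebesgue_integral) 
    qed
    fix z :: 'a
    have fB: "cmod (f y) \<le> B" for y
      using fb[of y] B by (auto simp: indicator_def split: if_splits intro: order_trans)
    have pt: "cmod (f x * cnj (f (x + z))) \<le> B * B * indicat_real (ball 0 R) x" for x
      using mult_mono[OF fb[of x] fB[of "x + z"]] B by (simp add: norm_mult mult_ac)
    show "cmod (autocorr f z) \<le> (LINT x|(lborel::'a measure). B * B * indicat_real (ball 0 R) x) * indicat_real (ball 0 (2 * R)) z"
    proof (cases "norm z < 2 * R")
      case True
      have "cmod (autocorr f z) \<le> (LINT x|lborel. cmod (f x * cnj (f (x + z))))"
        unfolding autocorr_def by (rule integral_norm_bound)
      also have "\<dots> \<le> (LINT x|(lborel::'a measure). B * B * indicat_real (ball 0 R) x)"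
        by (rule integral_mono_AE'[OF integrable_indicator_ball]) (use pt B in auto)
      finally show ?thesis using True by (simp add: indicator_def)
    next
      case False
      have "f x * cnj (f (x + z)) = 0" for x
      proof (cases "norm x < R")
        case True
        then have "\<not> norm (x + z) < R" using False norm_triangle_ineq4[of "x + z" x] by auto
        then have "f (x + z) = 0" using fb[of "x + z"] by simp
        then show ?thesis by simp
      next
        case False
        then show ?thesis using fb[of x] by simp
      qed
      then have "(\<lambda>x. f x * cnj (f (x + z))) = (\<lambda>_. 0)" by (rule ext)
      then have "autocorr f z = 0" unfolding autocorr_def by simp
      then show ?thesis using False by simp
    qed
  qed
qed

lemma autocorr_zero: "autocorr f 0 = complex_of_real (LINT x|lborel. (cmod (f x))\<^sup>2)"
  unfolding autocorr_def by (simp add: complex_norm_square[symmetric] del: of_real_power)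

lemma autocorr_tendsto:
  fixes t :: "nat \<Rightarrow> 'a::euclidean_space"
  assumes f: "bounded_cs f" and t: "t \<longlonglongrightarrow> 0"
  shows "(\<lambda>n. autocorr f (t n)) \<longlonglongrightarrow> autocorr f 0"
proof -
  obtain B R where fm[measurable]: "f \<in> borel_measurable borel" and B: "B > 0" and R: "R > 0"
    and fb: "\<And>x. cmod (f x) \<le> B * indicat_real (ball 0 R) x"
    using bounded_csE[OF f] by metis
  have fB: "cmod (f y) \<le> B" for y
    using fb[of y] B by (auto simp: indicator_def split: if_splits intro: order_trans)
  have bd: "bounded_cs (\<lambda>x. f x * cnj (f (x + z)))" for z
    by (rule bounded_cs_mult[OF f, where K=B]) (use fB in auto)
  have "(\<lambda>n. autocorr f (t n) - autocorr f 0) \<longlonglongrightarrow> 0"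
  proof (rule Lim_null_comparison)
    show "\<forall>\<^sub>F n in sequentially. cmod (autocorr f (t n) - autocorr f 0) \<le> B * (LINT x|lborel. cmod (f (x + t n) - f x))"
    proof (rule always_eventually, rule allI)
      fix n
      have "autocorr f (t n) - autocorr f 0 = (LINT x|lborel. f x * cnj (f (x + t n) - f x))"
        unfolding autocorr_def
        by (subst Bochner_Integration.integral_diff[symmetric])
           (auto intro!: bounded_cs_integrable bd bd[of 0, simplified] simp: algebra_simps)
      also have "cmod \<dots> \<le> (LINT x|lborel. cmod (f x * cnj (f (x + t n) - f x)))"
        by (rule integral_norm_bound)
      also have "\<dots> \<le> (LINT x|lborel. B * cmod (f (x + t n) - f x))"
        by (rule integral_mono_AE')
           (auto intro!: bounded_cs_norm_diff_integrable bounded_cs_translate f mult_right_mono fB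
             mult_nonneg_nonneg less_imp_le[OF B] simp: norm_mult simp flip: complex_cnj_diff)
      also have "\<dots> = B * (LINT x|lborel. cmod (f (x + t n) - f x))" by simp
      finally show "cmod (autocorr f (t n) - autocorr f 0) \<le> B * (LINT x|lborel. cmod (f (x + t n) - f x))" .
    qed
    show "(\<lambda>n. B * (LINT x|lborel. cmod (f (x + t n) - f x))) \<longlonglongrightarrow> 0"
      using tendsto_mult_right_zero[OF translation_continuous_L1[OF f t]] .
  qed
  then show ?thesis by (rule LIM_zero_cancel)
qed

lemma integrable_pair_indicator:
  "integrable (lborel \<Otimes>\<^sub>M lborel) (\<lambda>(x::'a::euclidean_space, y::'b::euclidean_space). B * indicat_real (ball 0 R) x * indicat_real (ball 0 S) y)"
proof -
  have eq: "(\<lambda>(x::'a, y::'b). B * indicat_real (ball 0 R) x * indicat_real (ball 0 S) y)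
    = (\<lambda>p. B * indicat_real (ball 0 R \<times> ball 0 S) p)"
    by (auto simp: indicator_def fun_eq_iff)
  have "emeasure (lborel \<Otimes>\<^sub>M lborel) (ball (0::'a) R \<times> ball (0::'b) S) < \<infinity>"
    by (subst lborel.emeasure_pair_measure_Times)
       (auto intro: ennreal_mult_less_top[THEN iffD2] simp: ennreal_mult_less_top emeasure_lborel_ball_finite[unfolded infinity_ennreal_def])
  then show ?thesis unfolding eq
    by (intro integrable_mult_right integrable_real_indicator) auto
qed

text \<open>
  Fubini, after the substitution \<open>y = x + z\<close> in the conjugate factor.
\<close>

lemma FT_autocorr:
  assumes f: "bounded_cs f"
  shows "complex_of_real ((cmod (FT f \<xi>))\<^sup>2) = (LINT z|lborel. autocorr f z * exp (\<i> * complex_of_real (z \<bullet> \<xi>)))"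
proof -
  obtain B R where fm[measurable]: "f \<in> borel_measurable borel" and B: "B > 0" and R: "R > 0"
    and fb: "\<And>x. cmod (f x) \<le> B * indicat_real (ball 0 R) x"
    using bounded_csE[OF f] by metis
  have fB: "cmod (f y) \<le> B" for y
    using fb[of y] B by (auto simp: indicator_def split: if_splits intro: order_trans)
  define k where "k = (\<lambda>x z. f x * cnj (f (x + z)) * exp (\<i> * complex_of_real (z \<bullet> \<xi>)))"
  have int: "integrable (lborel \<Otimes>\<^sub>M lborel) (\<lambda>(x, z). k x z)"
  proof (rule Bochner_Integration.integrable_bound[OF integrable_pair_indicator[of "B * B" R "2 * R"]])
    show "AE p in lborel \<Otimes>\<^sub>M lborel. norm (case p of (x, z) \<Rightarrow> k x z) \<le>
       norm (case p of (x, y) \<Rightarrow> B * B * indicat_real (ball 0 R) x * indicat_real (ball 0 (2 * R)) y)"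
    proof (rule AE_I2, clarify)
      fix x z :: 'a
      show "norm (k x z) \<le> norm (B * B * indicat_real (ball 0 R) x * indicat_real (ball 0 (2 * R)) z)"
      proof (cases "norm x < R \<and> norm (x + z) < R")
        case True
        then have "norm z < 2 * R" using norm_triangle_ineq4[of "x + z" x] by auto
        moreover have "norm (k x z) \<le> B * B"
          unfolding k_def using mult_mono[OF fB[of x] fB[of "x + z"]] B by (simp add: norm_mult)
        ultimately show ?thesis using True B by (simp add: indicator_def)
      next
        case False
        then have "f x = 0 \<or> f (x + z) = 0" using fb[of x] fb[of "x + z"] by auto
        then have "k x z = 0" unfolding k_def by auto
        then show ?thesis by simp
      qed
    qed
  qed (simp add: k_def split_beta')
  have "complex_of_real ((cmod (FT f \<xi>))\<^sup>2) = FT f \<xi> * cnj (FT f \<xi>)"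
    by (rule complex_norm_square)
  also have "cnj (FT f \<xi>) = (LINT y|lborel. cnj (f y) * exp (\<i> * complex_of_real (y \<bullet> \<xi>)))"
    unfolding FT_def by (simp add: Bochner_Integration.integral_cnj[symmetric] exp_cnj)
  also have "FT f \<xi> * \<dots> = (LINT x|lborel. f x * exp (- \<i> * complex_of_real (x \<bullet> \<xi>)) * (LINT y|lborel. cnj (f y) * exp (\<i> * complex_of_real (y \<bullet> \<xi>))))"
    unfolding FT_def by simp
  also have "\<dots> = (LINT x|lborel. (LINT z|lborel. k x z))"
  proof (rule Bochner_Integration.integral_cong[OF refl])
    fix x :: 'a
    have "(LINT y|lborel. cnj (f y) * exp (\<i> * complex_of_real (y \<bullet> \<xi>))) =
      (LINT z|lborel. cnj (f (z + x)) * exp (\<i> * complex_of_real ((z + x) \<bullet> \<xi>)))"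
      by (rule lborel_integral_translate[symmetric]) measurable
    then have "f x * exp (- \<i> * complex_of_real (x \<bullet> \<xi>)) * (LINT y|lborel. cnj (f y) * exp (\<i> * complex_of_real (y \<bullet> \<xi>)))
      = (LINT z|lborel. f x * exp (- \<i> * complex_of_real (x \<bullet> \<xi>)) * (cnj (f (z + x)) * exp (\<i> * complex_of_real ((z + x) \<bullet> \<xi>))))"
      by simp
    also have "\<dots> = (LINT z|lborel. k x z)"
      by (rule Bochner_Integration.integral_cong[OF refl])
         (simp add: k_def inner_add_left distrib_left exp_add exp_minus field_simps)
    finally show "f x * exp (- \<i> * complex_of_real (x \<bullet> \<xi>)) * (LINT y|lborel. cnj (f y) * exp (\<i> * complex_of_real (y \<bullet> \<xi>))) = (LINT z|lborel. k x z)" .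
  qed
  also have "\<dots> = (LINT z|lborel. (LINT x|lborel. k x z))"
    by (rule lborel_pair.Fubini_integral[OF int, symmetric])
  also have "\<dots> = (LINT z|lborel. autocorr f z * exp (\<i> * complex_of_real (z \<bullet> \<xi>)))"
    unfolding k_def autocorr_def by simp
  finally show ?thesis .
qed

text \<open>
  The Gaussian factor makes the frequency integral absolutely convergent, so that it can be carried
  out before the integral over \<open>z\<close>. It becomes a Gaussian of width \<open>\<delta>\<close>, and the substitution of
  \<open>\<delta> *\<^sub>R z\<close> for \<open>z\<close> moves \<open>\<delta>\<close> into the autocorrelation.
\<close>

lemma plancherel_gaussian:
  fixes f :: "'a::euclidean_space \<Rightarrow> complex"
  assumes f: "bounded_cs f" and \<delta>: "\<delta> > 0"
  shows "(LINT \<xi>|lborel. complex_of_real (exp (-(\<delta> * norm \<xi>)\<^sup>2 / 2) * (cmod (FT f \<xi>))\<^sup>2))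
    = complex_of_real (sqrt (2 * pi) ^ DIM('a)) * (LINT z|lborel. autocorr f (\<delta> *\<^sub>R z) * complex_of_real (exp (-(norm z)\<^sup>2 / 2)))"
proof -
  let ?c = "autocorr f" and ?G = "\<lambda>\<xi>::'a. complex_of_real (exp (-(\<delta> * norm \<xi>)\<^sup>2 / 2))"
  define K where "K = complex_of_real ((sqrt (2 * pi) / \<delta>) ^ DIM('a))"
  have c: "bounded_cs ?c" by (rule autocorr_bounded_cs[OF f])
  then have cm [measurable]: "?c \<in> borel_measurable borel" by (simp add: bounded_cs_def)
  have Gi: "integrable lborel ?G"
    using gaussian_integral(1)[OF \<delta>, of 0] by simp
  have int: "integrable (lborel \<Otimes>\<^sub>M lborel) (\<lambda>(\<xi>, z). ?G \<xi> * (?c z * exp (\<i> * complex_of_real (z \<bullet> \<xi>))))"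
  proof (rule lborel_pair.Fubini_integrable)
    show "AE \<xi> in lborel. integrable lborel (\<lambda>z. case (\<xi>, z) of (\<xi>, z) \<Rightarrow> ?G \<xi> * (?c z * exp (\<i> * complex_of_real (z \<bullet> \<xi>))))"
    proof (rule AE_I2)
      fix \<xi> :: 'a
      have "bounded_cs (\<lambda>z. ?c z * exp (\<i> * complex_of_real (z \<bullet> \<xi>)))"
        by (rule bounded_cs_mult[OF c, where K = 1]) auto
      then show "integrable lborel (\<lambda>z. case (\<xi>, z) of (\<xi>, z) \<Rightarrow> ?G \<xi> * (?c z * exp (\<i> * complex_of_real (z \<bullet> \<xi>))))"
        by (auto intro!: bounded_cs_integrable bounded_cs_cmult)
    qed
    have "(\<lambda>\<xi>. LINT z|lborel. norm (case (\<xi>, z) of (\<xi>, z) \<Rightarrow> ?G \<xi> * (?c z * exp (\<i> * complex_of_real (z \<bullet> \<xi>)))))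
      = (\<lambda>\<xi>. cmod (?G \<xi>) * (LINT z|lborel. cmod (?c z)))"
      by (simp add: norm_mult)
    moreover have "integrable lborel (\<lambda>\<xi>. cmod (?G \<xi>) * (LINT z|lborel. cmod (?c z)))"
      by (intro integrable_mult_left integrable_norm Gi)
    ultimately show "integrable lborel (\<lambda>\<xi>. LINT z|lborel. norm (case (\<xi>, z) of (\<xi>, z) \<Rightarrow> ?G \<xi> * (?c z * exp (\<i> * complex_of_real (z \<bullet> \<xi>)))))"
      by simp
  qed (simp add: split_beta')
  have "(LINT \<xi>|lborel. complex_of_real (exp (-(\<delta> * norm \<xi>)\<^sup>2 / 2) * (cmod (FT f \<xi>))\<^sup>2))
     = (LINT \<xi>|lborel. (LINT z|lborel. ?G \<xi> * (?c z * exp (\<i> * complex_of_real (z \<bullet> \<xi>)))))"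
    using FT_autocorr[OF f] by simp
  also have "\<dots> = (LINT z|lborel. (LINT \<xi>|lborel. ?G \<xi> * (?c z * exp (\<i> * complex_of_real (z \<bullet> \<xi>)))))"
    by (rule lborel_pair.Fubini_integral[OF int, symmetric])
  also have "\<dots> = (LINT z|lborel. K * (?c z * complex_of_real (exp (-(norm z / \<delta>)\<^sup>2 / 2))))"
  proof (rule Bochner_Integration.integral_cong[OF refl])
    fix z :: 'a
    have "(LINT \<xi>|lborel. ?G \<xi> * (?c z * exp (\<i> * complex_of_real (z \<bullet> \<xi>)))) = (LINT \<xi>|lborel. ?c z * (?G \<xi> * exp (\<i> * complex_of_real (z \<bullet> \<xi>))))"
      by (simp add: mult_ac)
    also have "\<dots> = ?c z * complex_of_real ((sqrt (2 * pi) / \<delta>) ^ DIM('a) * exp (-(norm z / \<delta>)\<^sup>2 / 2))"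
      unfolding integral_mult_right_zero gaussian_integral(2)[OF \<delta>] ..
    finally show "(LINT \<xi>|lborel. ?G \<xi> * (?c z * exp (\<i> * complex_of_real (z \<bullet> \<xi>)))) = K * (?c z * complex_of_real (exp (-(norm z / \<delta>)\<^sup>2 / 2)))"
      by (simp add: K_def mult_ac)
  qed
  also have "\<dots> = K * (LINT z|lborel. ?c z * complex_of_real (exp (-(norm z / \<delta>)\<^sup>2 / 2)))"
    by (rule integral_mult_right_zero)
  also have "(LINT z|lborel. ?c z * complex_of_real (exp (-(norm z / \<delta>)\<^sup>2 / 2))) =
      \<bar>\<delta>\<bar> ^ DIM('a) *\<^sub>R (LINT z|lborel. ?c (\<delta> *\<^sub>R z) * complex_of_real (exp (-(norm (\<delta> *\<^sub>R z) / \<delta>)\<^sup>2 / 2)))"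
    by (rule lborel_integral_scale) (use \<delta> in auto)
  also have "(\<lambda>z::'a. norm (\<delta> *\<^sub>R z) / \<delta>) = norm" using \<delta> by auto
  also have "K * (\<bar>\<delta>\<bar> ^ DIM('a) *\<^sub>R (LINT z|lborel. ?c (\<delta> *\<^sub>R z) * complex_of_real (exp (-(norm z)\<^sup>2 / 2)))) =
     complex_of_real (sqrt (2 * pi) ^ DIM('a)) * (LINT z|lborel. ?c (\<delta> *\<^sub>R z) * complex_of_real (exp (-(norm z)\<^sup>2 / 2)))"
    using \<delta> by (simp add: K_def scaleR_conv_of_real power_divide)
  finally show ?thesis .
qed

text \<open>
  Let the Gaussian weight in \<open>plancherel_gaussian\<close> widen. The left-hand side increases to the integral of the squared
  transform; on the right the autocorrelation tends to its value at \<open>0\<close>, and the factor in front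
  and the remaining Gaussian integral contribute \<open>sqrt (2\<pi>)\<close> to the power of the dimension each.
\<close>

theorem plancherel_FT:
  fixes f :: "'a::euclidean_space \<Rightarrow> complex"
  assumes f: "bounded_cs f"
  shows "(\<integral>\<^sup>+\<xi>. ennreal ((cmod (FT f \<xi>))\<^sup>2) \<partial>lborel) = ennreal ((2 * pi) ^ DIM('a) * (LINT x|lborel. (cmod (f x))\<^sup>2))"
proof -
  let ?d = "\<lambda>n. inverse (real (Suc n))"
  let ?c = "autocorr f"
  have fm [measurable]: "f \<in> borel_measurable borel" using f by (simp add: bounded_cs_def)
  have c: "bounded_cs ?c" by (rule autocorr_bounded_cs[OF f])
  obtain B R where cm [measurable]: "?c \<in> borel_measurable borel" and B: "B > 0"
    and cb: "\<And>x. cmod (?c x) \<le> B * indicat_real (ball 0 R) x"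
    using bounded_csE[OF c] by metis
  have cB: "cmod (?c y) \<le> B" for y
    using cb[of y] B by (auto simp: indicator_def split: if_splits intro: order_trans)
  let ?g = "\<lambda>z::'a. complex_of_real (exp (-(norm z)\<^sup>2 / 2))"
  have gi: "integrable lborel ?g" "integral\<^sup>L lborel ?g = complex_of_real (sqrt (2 * pi) ^ DIM('a))"
    using gaussian_integral[of 1 "0::'a"] by simp_all
  define I where "I = (\<lambda>n \<xi>. exp (-(?d n * norm \<xi>)\<^sup>2 / 2) * (cmod (FT f \<xi>))\<^sup>2)"
  have Im [measurable]: "I n \<in> borel_measurable borel" for n
    unfolding I_def by measurable
  define D where "D = (LINT x|lborel. cmod (f x))"
  have D: "cmod (FT f \<xi>) \<le> D" for \<xi> unfolding D_def by (rule cmod_FT_le[OF f])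
  have Ii: "integrable lborel (I n)" for n
  proof (rule Bochner_Integration.integrable_bound)
    show "integrable lborel (\<lambda>\<xi>::'a. D\<^sup>2 * cmod (complex_of_real (exp (-(?d n * norm \<xi>)\<^sup>2 / 2))))"
      using gaussian_integral(1)[of "?d n" "0::'a"] by (intro integrable_mult_right integrable_norm) simp
    show "AE x in lborel. norm (I n x) \<le> norm (D\<^sup>2 * cmod (complex_of_real (exp (-(?d n * norm x)\<^sup>2 / 2))))"
      using D by (auto simp: I_def mult.commute intro!: mult_right_mono power_mono)
  qed simp
  have I0: "0 \<le> I n \<xi>" for n \<xi> unfolding I_def by simp
  have d0: "?d \<longlonglongrightarrow> 0" by (rule LIMSEQ_inverse_real_of_nat)
  have lim1: "(\<lambda>n. LINT z|lborel. ?c (?d n *\<^sub>R z) * ?g z) \<longlonglongrightarrow> (LINT z|lborel. ?c 0 * ?g z)"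
  proof (rule integral_dominated_convergence[where w = "\<lambda>z. B * cmod (?g z)"])
    show "integrable lborel (\<lambda>z. B * cmod (?g z))" by (intro integrable_mult_right integrable_norm gi)
    show "AE z in lborel. (\<lambda>n. ?c (?d n *\<^sub>R z) * ?g z) \<longlonglongrightarrow> ?c 0 * ?g z"
    proof (rule AE_I2)
      fix z :: 'a
      have "(\<lambda>n. ?d n *\<^sub>R z) \<longlonglongrightarrow> 0" using tendsto_scaleR[OF d0 tendsto_const, of z] by simp
      then show "(\<lambda>n. ?c (?d n *\<^sub>R z) * ?g z) \<longlonglongrightarrow> ?c 0 * ?g z"
        by (intro tendsto_mult autocorr_tendsto[OF f] tendsto_const)
    qed
    show "AE z in lborel. norm (?c (?d n *\<^sub>R z) * ?g z) \<le> B * cmod (?g z)" for n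
      by (rule AE_I2) (auto simp: norm_mult intro!: mult_right_mono cB)
  qed measurable
  have "(\<lambda>n. complex_of_real (integral\<^sup>L lborel (I n))) \<longlonglongrightarrow>
      complex_of_real (sqrt (2 * pi) ^ DIM('a)) * (LINT z|lborel. ?c 0 * ?g z)"
  proof -
    have "complex_of_real (integral\<^sup>L lborel (I n)) = complex_of_real (sqrt (2 * pi) ^ DIM('a)) * (LINT z|lborel. ?c (?d n *\<^sub>R z) * ?g z)" for n
      unfolding I_def integral_complex_of_real[symmetric] by (rule plancherel_gaussian[OF f]) simp
    then show ?thesis using lim1 by (auto intro!: tendsto_intros)
  qed
  also have "(LINT z|lborel. ?c 0 * ?g z) = ?c 0 * complex_of_real (sqrt (2 * pi) ^ DIM('a))"
    unfolding integral_mult_right_zero gi ..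
  also have "complex_of_real (sqrt (2 * pi) ^ DIM('a)) * (?c 0 * complex_of_real (sqrt (2 * pi) ^ DIM('a)))
     = complex_of_real ((sqrt (2 * pi))\<^sup>2 ^ DIM('a) * (LINT x|lborel. (cmod (f x))\<^sup>2))"
    unfolding autocorr_zero power2_eq_square power_mult_distrib by simp
  finally have lim2: "(\<lambda>n. integral\<^sup>L lborel (I n)) \<longlonglongrightarrow> (2 * pi) ^ DIM('a) * (LINT x|lborel. (cmod (f x))\<^sup>2)"
    unfolding tendsto_of_real_iff by simp
  have "(\<lambda>n. \<integral>\<^sup>+\<xi>. ennreal (I n \<xi>) \<partial>lborel) \<longlonglongrightarrow> (\<integral>\<^sup>+\<xi>. ennreal ((cmod (FT f \<xi>))\<^sup>2) \<partial>lborel)"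
  proof (rule nn_integral_LIMSEQ)
    show "incseq (\<lambda>n \<xi>. ennreal (I n \<xi>))"
    proof (rule incseq_SucI, rule le_funI, rule ennreal_leI)
      fix n and \<xi> :: 'a
      have "(?d (Suc n) * norm \<xi>)\<^sup>2 \<le> (?d n * norm \<xi>)\<^sup>2"
        by (intro power_mono mult_right_mono) (auto simp: field_simps)
      then show "I n \<xi> \<le> I (Suc n) \<xi>"
        unfolding I_def by (intro mult_right_mono) auto
    qed
    fix \<xi> :: 'a
    have "(\<lambda>n. I n \<xi>) \<longlonglongrightarrow> exp (-(0 * norm \<xi>)\<^sup>2 / 2) * (cmod (FT f \<xi>))\<^sup>2"
      unfolding I_def by (intro tendsto_intros d0)  simp
    then show "(\<lambda>n. ennreal (I n \<xi>)) \<longlonglongrightarrow> ennreal ((cmod (FT f \<xi>))\<^sup>2)"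
      by (intro tendsto_ennrealI) simp
  qed measurable
  moreover have "(\<integral>\<^sup>+\<xi>. ennreal (I n \<xi>) \<partial>lborel) = ennreal (integral\<^sup>L lborel (I n))" for n
    by (rule nn_integral_eq_integral[OF Ii]) (simp add: I0)
  ultimately have "(\<lambda>n. ennreal (integral\<^sup>L lborel (I n))) \<longlonglongrightarrow> (\<integral>\<^sup>+\<xi>. ennreal ((cmod (FT f \<xi>))\<^sup>2) \<partial>lborel)"
    by simp
  then show ?thesis
    using tendsto_ennrealI[OF lim2] by (rule LIMSEQ_unique)
qed

section \<open>Fourier integrals and Sobolev spaces\<close>

lemma fourier_eq_FT:
  fixes f :: "'a::euclidean_space \<Rightarrow> complex"
  assumes [measurable]: "f \<in> borel_measurable borel"
  shows "fourier f \<xi> = complex_of_real ((2 * pi) powr (- real DIM('a) / 2)) * FT f \<xi>"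
  unfolding fourier_def FT_def by (subst integral_completion) auto

lemma fourier_cong_AE:
  assumes "f \<in> borel_measurable lebesgue" "g \<in> borel_measurable lebesgue" "AE x in lborel. f x = g x"
  shows "fourier f \<xi> = fourier g \<xi>"
proof -
  have [measurable]: "(\<lambda>x. exp (- (\<i> * complex_of_real (x \<bullet> \<xi>)))) \<in> borel_measurable lebesgue"
    by (intro measurable_completion) simp
  note [measurable] = assms(1,2)
  have "AE x in lebesgue. f x = g x" using assms(3) by (rule AE_completion)
  then show ?thesis unfolding fourier_def
    by (intro arg_cong2[where f = "(*)"] refl integral_cong_AE) (auto elim: eventually_mono)
qed

lemma two_pi_powr: "((2 * pi) powr (- real d / 2))\<^sup>2 * (2 * pi) ^ d = 1"
proof -
  have "((2 * pi) powr (- real d / 2))\<^sup>2 = (2 * pi) powr (- real d)"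
    by (simp add: power2_eq_square powr_add[symmetric])
  moreover have "(2 * pi) ^ d = (2 * pi) powr (real d)" by (simp add: powr_realpow)
  ultimately show ?thesis by (simp add: powr_minus)
qed

theorem plancherel_fourier:
  fixes f :: "'a::euclidean_space \<Rightarrow> complex"
  assumes f: "bounded_cs f"
  shows "(\<integral>\<^sup>+\<xi>. ennreal ((cmod (fourier f \<xi>))\<^sup>2) \<partial>lborel) = ennreal (LINT x|lborel. (cmod (f x))\<^sup>2)"
proof -
  have fm [measurable]: "f \<in> borel_measurable borel" using f by (simp add: bounded_cs_def)
  let ?k = "((2 * pi) powr (- real DIM('a) / 2))\<^sup>2"
  have "(\<integral>\<^sup>+\<xi>. ennreal ((cmod (fourier f \<xi>))\<^sup>2) \<partial>lborel) = (\<integral>\<^sup>+\<xi>. ennreal ?k * ennreal ((cmod (FT f \<xi>))\<^sup>2) \<partial>lborel)"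
    unfolding fourier_eq_FT[OF fm] by (simp add: norm_mult power_mult_distrib ennreal_mult)
  also have "\<dots> = ennreal ?k * ennreal ((2 * pi) ^ DIM('a) * (LINT x|lborel. (cmod (f x))\<^sup>2))"
    by (subst nn_integral_cmult) (auto simp: plancherel_FT[OF f])
  also have "\<dots> = ennreal (?k * (2 * pi) ^ DIM('a) * (LINT x|lborel. (cmod (f x))\<^sup>2))"
    by (subst ennreal_mult[symmetric]) (auto simp: mult_ac)
  finally show ?thesis unfolding two_pi_powr by simp
qed

lemma bounded_cs_square_integrable:
  assumes f: "bounded_cs f" shows "integrable lborel (\<lambda>x. (cmod (f x))\<^sup>2)"
proof -
  obtain B R where fm[measurable]: "f \<in> borel_measurable borel" and B: "B > 0"
    and fb: "\<And>x. cmod (f x) \<le> B * indicat_real (ball 0 R) x"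
    using bounded_csE[OF f] by metis
  show ?thesis
  proof (rule Bochner_Integration.integrable_bound[OF integrable_indicator_ball[of "B\<^sup>2" 0 R]])
    show "AE x in lborel. norm ((cmod (f x))\<^sup>2) \<le> norm (B\<^sup>2 * indicat_real (ball 0 R) x)"
    proof (rule AE_I2)
      fix x
      show "norm ((cmod (f x))\<^sup>2) \<le> norm (B\<^sup>2 * indicat_real (ball 0 R) x)"
        using power_mono[OF fb[of x], of 2] by (auto simp: indicator_def split: if_splits)
    qed
  qed simp
qed

lemma has_bochner_integral_plancherel_FT:
  fixes f :: "'a::euclidean_space \<Rightarrow> complex"
  assumes f: "bounded_cs f"
  shows "has_bochner_integral lborel (\<lambda>\<xi>. (cmod (FT f \<xi>))\<^sup>2) ((2 * pi) ^ DIM('a) * (LINT x|lborel. (cmod (f x))\<^sup>2))"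
proof (rule has_bochner_integral_nn_integral)
  have [measurable]: "f \<in> borel_measurable borel" using f by (simp add: bounded_cs_def)
  show "(\<lambda>\<xi>. (cmod (FT f \<xi>))\<^sup>2) \<in> borel_measurable lborel" by measurable
qed (use plancherel_FT[OF f] in auto)

lemma fourier_measurable:
  assumes [measurable]: "f \<in> borel_measurable borel" shows "fourier f \<in> borel_measurable borel"
  unfolding fourier_eq_FT[OF assms, abs_def] by measurable

lemma square_integrable_AE:
  assumes f: "f \<in> borel_measurable lebesgue" and g: "g \<in> borel_measurable borel"
    and eq: "AE x in lborel. f x = g x" and i: "integrable lborel (\<lambda>x. (norm (g x))\<^sup>2)"
  shows "square_integrable f"
  unfolding square_integrable_def
proof
  have "integrable lebesgue (\<lambda>x. (norm (g x))\<^sup>2)" using i g by (subst integrable_completion) auto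
  moreover have "AE x in lebesgue. (norm (g x))\<^sup>2 = (norm (f x))\<^sup>2"
    using AE_completion[OF eq] by eventually_elim simp
  moreover have "(\<lambda>x. (norm (f x))\<^sup>2) \<in> borel_measurable lebesgue" using f by measurable
  moreover have "(\<lambda>x. (norm (g x))\<^sup>2) \<in> borel_measurable lebesgue" using g by (intro measurable_completion) measurable
  ultimately show "integrable lebesgue (\<lambda>x. (norm (f x))\<^sup>2)"
    by (subst integrable_cong_AE[symmetric]) auto
qed (rule f)

text \<open>
  Truncations of \<open>f\<close> to large balls agree with \<open>g\<close> almost everywhere, so the limit in the definition
  of the \<open>L\<^sup>2\<close> transform is that of an eventually constant family. Any function that satisfies the
  definition is therefore at \<open>L\<^sup>2\<close> distance \<open>0\<close> from the Fourier integral of \<open>g\<close>.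
\<close>

lemma fourier_L2_eq:
  fixes f g :: "'a::euclidean_space \<Rightarrow> complex"
  assumes fm: "f \<in> borel_measurable lebesgue" and g: "bounded_cs g"
    and eq: "AE x in lborel. f x = g x"
  shows "fourier_L2 f \<in> borel_measurable lebesgue" and "AE \<xi> in lebesgue. fourier_L2 f \<xi> = fourier g \<xi>"
proof -
  obtain B R where gm: "g \<in> borel_measurable borel"
    and gb: "\<And>x. cmod (g x) \<le> B * indicat_real (ball 0 R) x"
    using bounded_csE[OF g] by metis
  have Fm: "fourier g \<in> borel_measurable borel" by (rule fourier_measurable[OF gm])
  then have Fm': "fourier g \<in> borel_measurable lebesgue" by (intro measurable_completion) simp
  have tr: "fourier (\<lambda>x. indicat_real (ball 0 r) x *\<^sub>R f x) = fourier g" if "r \<ge> R" for r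
  proof
    fix \<xi>
    show "fourier (\<lambda>x. indicat_real (ball 0 r) x *\<^sub>R f x) \<xi> = fourier g \<xi>"
    proof (rule fourier_cong_AE)
      show "(\<lambda>x. indicat_real (ball 0 r) x *\<^sub>R f x) \<in> borel_measurable lebesgue"
        using fm by (intro borel_measurable_scaleR borel_measurable_indicator) auto
      show "g \<in> borel_measurable lebesgue" using gm by (intro measurable_completion) simp
      show "AE x in lborel. indicat_real (ball 0 r) x *\<^sub>R f x = g x"
        using eq
      proof eventually_elim
        case (elim x)
        show ?case
        proof (cases "norm x < r")
          case False
          then show ?thesis using gb[of x] that by auto
        qed (use elim in auto)
      qed
    qed
  qed
  let ?I = "\<lambda>h. \<integral>\<^sup>+\<xi>. ennreal ((cmod (fourier g \<xi> - h \<xi>))\<^sup>2) \<partial>lebesgue"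
  have lim: "((\<lambda>r::real. \<integral>\<^sup>+\<xi>. ennreal ((cmod (fourier (\<lambda>x. indicat_real (ball 0 r) x *\<^sub>R f x) \<xi> - h \<xi>))\<^sup>2) \<partial>lebesgue)
        \<longlongrightarrow> ?I h) at_top" for h
    by (rule tendsto_eventually) (use tr in \<open>auto simp: eventually_at_top_linorder intro!: exI[of _ R]\<close>)
  have sf: "square_integrable f"
    by (rule square_integrable_AE[OF fm gm eq]) (rule bounded_cs_square_integrable[OF g])
  have "integrable lborel (\<lambda>x. (cmod (fourier g x))\<^sup>2)"
    by (rule integrableI_nn_integral_finite[where x = "LINT x|lborel. (cmod (g x))\<^sup>2"])
       (use Fm plancherel_fourier[OF g] in auto)
  then have "square_integrable (fourier g)"
    using square_integrable_AE[OF Fm' Fm] by simp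
  then have "has_fourier_L2 f (fourier g)"
    unfolding has_fourier_L2_def using sf lim[of "fourier g"] by simp
  then have *: "has_fourier_L2 f (fourier_L2 f)"
    unfolding fourier_L2_def by (rule someI[of "has_fourier_L2 f"])
  then show m: "fourier_L2 f \<in> borel_measurable lebesgue"
    unfolding has_fourier_L2_def square_integrable_def by auto
  have "?I (fourier_L2 f) = 0"
    using * lim[of "fourier_L2 f"] unfolding has_fourier_L2_def
    using tendsto_unique trivial_limit_at_top_linorder by blast
  then have "AE \<xi> in lebesgue. ennreal ((cmod (fourier g \<xi> - fourier_L2 f \<xi>))\<^sup>2) = 0"
    by (subst (asm) nn_integral_0_iff_AE) (use m Fm' in auto)
  then show "AE \<xi> in lebesgue. fourier_L2 f \<xi> = fourier g \<xi>"
    by eventually_elim (auto simp: ennreal_eq_0_iff)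
qed

lemma sobolev_weight_integral:
  fixes f :: "real \<Rightarrow> real"
  assumes fm: "f \<in> borel_measurable lebesgue" and g: "bounded_cs g"
    and eq: "AE x in lborel. complex_of_real (f x) = g x"
  shows "f \<in> sobolev s \<longleftrightarrow> (\<integral>\<^sup>+\<xi>. ennreal ((1 + \<xi>\<^sup>2) powr s * (cmod (fourier g \<xi>))\<^sup>2) \<partial>lborel) < \<infinity>"
    and "ennreal ((sobolev_norm s f)\<^sup>2) \<le> (\<integral>\<^sup>+\<xi>. ennreal ((1 + \<xi>\<^sup>2) powr s * (cmod (fourier g \<xi>))\<^sup>2) \<partial>lborel)"
proof -
  have cm: "(\<lambda>x. complex_of_real (f x)) \<in> borel_measurable lebesgue" using fm by measurable
  have gm: "g \<in> borel_measurable borel" using g by (simp add: bounded_cs_def)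
  let ?F = "\<lambda>\<xi>. (1 + \<xi>\<^sup>2) powr s * (cmod (fourier g \<xi>))\<^sup>2"
  let ?L = "\<lambda>\<xi>. (1 + \<xi>\<^sup>2) powr s * (cmod (fourier_L2 (\<lambda>x. complex_of_real (f x)) \<xi>))\<^sup>2"
  note L = fourier_L2_eq[OF cm g eq]
  have Fm [measurable]: "?F \<in> borel_measurable borel" using fourier_measurable[OF gm] by measurable
  have pm: "(\<lambda>\<xi>::real. (1 + \<xi>\<^sup>2) powr s) \<in> borel_measurable lebesgue"
    by (intro measurable_completion) simp
  have Lm: "?L \<in> borel_measurable lebesgue" using L(1) pm by measurable
  have ae: "AE \<xi> in lebesgue. ?L \<xi> = ?F \<xi>" using L(2) by eventually_elim simp
  have Fm': "?F \<in> borel_measurable lebesgue" by (intro measurable_completion) simp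
  have sq: "square_integrable f"
  proof (rule square_integrable_AE[OF fm, of "\<lambda>x. Re (g x)"])
    show "AE x in lborel. f x = Re (g x)" using eq by eventually_elim (metis Re_complex_of_real)
    show "integrable lborel (\<lambda>x. (norm (Re (g x)))\<^sup>2)"
      by (rule Bochner_Integration.integrable_bound[OF bounded_cs_square_integrable[OF g]])
         (use gm abs_Re_le_cmod in \<open>auto intro!: power_mono simp: abs_le_square_iff[symmetric]\<close>)
  qed (use gm in measurable)
  have "integrable lebesgue ?L \<longleftrightarrow> integrable lebesgue ?F"
    by (rule integrable_cong_AE[OF Lm Fm' ae])
  also have "\<dots> \<longleftrightarrow> integrable lborel ?F" by (rule integrable_completion) simp
  also have "\<dots> \<longleftrightarrow> (\<integral>\<^sup>+\<xi>. ennreal (?F \<xi>) \<partial>lborel) < \<infinity>"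
    by (subst integrable_iff_bounded) auto
  finally show "f \<in> sobolev s \<longleftrightarrow> (\<integral>\<^sup>+\<xi>. ennreal (?F \<xi>) \<partial>lborel) < \<infinity>"
    unfolding sobolev_def using sq by simp
  have "integral\<^sup>L lebesgue ?L = integral\<^sup>L lebesgue ?F" by (rule integral_cong_AE[OF Lm Fm' ae])
  also have "\<dots> = integral\<^sup>L lborel ?F" by (rule integral_completion) simp
  finally have "(sobolev_norm s f)\<^sup>2 = integral\<^sup>L lborel ?F"
    unfolding sobolev_norm_def by simp
  also have "ennreal \<dots> \<le> (\<integral>\<^sup>+\<xi>. ennreal (?F \<xi>) \<partial>lborel)"
  proof (cases "integrable lborel ?F")
    case True
    then show ?thesis by (subst nn_integral_eq_integral) auto
  qed (simp add: not_integrable_integral_eq)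
  finally show "ennreal ((sobolev_norm s f)\<^sup>2) \<le> (\<integral>\<^sup>+\<xi>. ennreal (?F \<xi>) \<partial>lborel)" .
qed

section \<open>Localization in frequency\<close>

lemma FT_translate:
  assumes [measurable]: "f \<in> borel_measurable borel"
  shows "FT (\<lambda>x. f (x + t)) \<xi> = exp (\<i> * complex_of_real (t \<bullet> \<xi>)) * FT f \<xi>"
proof -
  have "FT (\<lambda>x. f (x + t)) \<xi> = (LINT x|lborel. exp (\<i> * complex_of_real (t \<bullet> \<xi>)) * (f (x + t) * exp (- \<i> * complex_of_real ((x + t) \<bullet> \<xi>))))"
    unfolding FT_def
    proof (rule Bochner_Integration.integral_cong[OF refl])
    fix x
    have "exp (- \<i> * complex_of_real (x \<bullet> \<xi>)) = exp (\<i> * complex_of_real (t \<bullet> \<xi>)) * exp (- \<i> * complex_of_real ((x + t) \<bullet> \<xi>))"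
      by (simp add: exp_add[symmetric] inner_add_left algebra_simps)
    then show "f (x + t) * exp (- \<i> * complex_of_real (x \<bullet> \<xi>)) =
        exp (\<i> * complex_of_real (t \<bullet> \<xi>)) * (f (x + t) * exp (- \<i> * complex_of_real ((x + t) \<bullet> \<xi>)))"
      by (simp only: mult_ac)
  qed
  also have "\<dots> = exp (\<i> * complex_of_real (t \<bullet> \<xi>)) * (LINT x|lborel. (f (x + t) * exp (- \<i> * complex_of_real ((x + t) \<bullet> \<xi>))))"
    by (rule integral_mult_right_zero)
  also have "(LINT x|lborel. (f (x + t) * exp (- \<i> * complex_of_real ((x + t) \<bullet> \<xi>)))) = FT f \<xi>"
    unfolding FT_def by (rule lborel_integral_translate[of "\<lambda>x. f x * exp (- \<i> * complex_of_real (x \<bullet> \<xi>))"]) measurable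
  finally show ?thesis .
qed

lemma FT_cmult: "FT (\<lambda>x. c * f x) \<xi> = c * FT f \<xi>"
  unfolding FT_def by (simp add: mult.assoc)

lemma FT_add:
  assumes "bounded_cs f" "bounded_cs g"
  shows "FT (\<lambda>x. f x + g x) \<xi> = FT f \<xi> + FT g \<xi>"
  unfolding FT_def
  by (simp add: distrib_right Bochner_Integration.integral_add bounded_cs_integrable bounded_cs_modulate[simplified] assms)

lemma FT_diff:
  assumes "bounded_cs f" "bounded_cs g"
  shows "FT (\<lambda>x. f x - g x) \<xi> = FT f \<xi> - FT g \<xi>"
  unfolding FT_def
  by (simp add: left_diff_distrib Bochner_Integration.integral_diff bounded_cs_integrable bounded_cs_modulate[simplified] assms)

text \<open>
  The difference quotients of a Lipschitz function with bounded support are bounded in \<open>L\<^sup>2\<close>. Along a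
  basis vector \<open>b\<close> their transforms converge pointwise to \<open>\<i> (\<xi> \<bullet> b)\<close> times the transform of the
  function, and Fatou's lemma bounds the limit.
\<close>

lemma FT_lipschitz_H1:
  fixes \<eta> :: "'a::euclidean_space \<Rightarrow> complex"
  assumes \<eta>: "bounded_cs \<eta>" and lip: "\<And>x y. cmod (\<eta> x - \<eta> y) \<le> L * norm (x - y)"
  shows "(\<integral>\<^sup>+\<xi>. ennreal ((1 + (norm \<xi>)\<^sup>2) * (cmod (FT \<eta> \<xi>))\<^sup>2) \<partial>lborel) < \<infinity>"
proof -
  obtain B R where m [measurable]: "\<eta> \<in> borel_measurable borel" and R: "R > 0" and B: "B > 0"
    and b: "\<And>x. cmod (\<eta> x) \<le> B * indicat_real (ball 0 R) x"
    using bounded_csE[OF \<eta>] by metis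
  have part: "(\<integral>\<^sup>+\<xi>. ennreal ((\<xi> \<bullet> b)\<^sup>2 * (cmod (FT \<eta> \<xi>))\<^sup>2) \<partial>lborel) < \<infinity>" if b: "b \<in> Basis" for b :: 'a
  proof -
    define t where "t = (\<lambda>n. inverse (real (Suc n)))"
    have t0: "t n > 0" "t n \<le> 1" for n by (auto simp: t_def field_simps)
    have tl: "t \<longlonglongrightarrow> 0" unfolding t_def by (rule LIMSEQ_inverse_real_of_nat)
    define q where "q = (\<lambda>n x. complex_of_real (inverse (t n)) * (\<eta> (x + t n *\<^sub>R b) - \<eta> x))"
    have qcs: "bounded_cs (q n)" for n
      unfolding q_def by (intro bounded_cs_cmult bounded_cs_diff bounded_cs_translate \<eta>)
    have qb: "cmod (q n x) \<le> L * indicat_real (ball 0 (R + 1)) x" for n x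
    proof (cases "norm x < R + 1")
      case True
      have "cmod (q n x) = inverse (t n) * cmod (\<eta> (x + t n *\<^sub>R b) - \<eta> x)"
        using t0[of n] by (simp add: q_def norm_mult norm_inverse)
      also have "\<dots> \<le> inverse (t n) * (L * norm ((x + t n *\<^sub>R b) - x))"
        using t0[of n] by (intro mult_left_mono lip) auto
      also have "\<dots> = L" using t0[of n] b by simp
      finally show ?thesis using True by simp
    next
      case False
      have "norm (t n *\<^sub>R b) \<le> 1" using t0[of n] b by simp
      then have "\<not> norm (x + t n *\<^sub>R b) < R" using False norm_triangle_ineq4[of "x + t n *\<^sub>R b" "t n *\<^sub>R b"] by auto
      then have "\<eta> (x + t n *\<^sub>R b) = 0" "\<eta> x = 0"
        using assms(1) \<open>\<And>x. cmod (\<eta> x) \<le> B * indicat_real (ball 0 R) x\<close>[of x] \<open>\<And>x. cmod (\<eta> x) \<le> B * indicat_real (ball 0 R) x\<close>[of "x + t n *\<^sub>R b"] False by auto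
      then show ?thesis using False by (simp add: q_def)
    qed
    define K where "K = (2 * pi) ^ DIM('a) * (LINT x|(lborel::'a measure). L\<^sup>2 * indicat_real (ball 0 (R + 1)) x)"
    have bound: "(\<integral>\<^sup>+\<xi>. ennreal ((cmod (FT (q n) \<xi>))\<^sup>2) \<partial>lborel) \<le> ennreal K" for n
      unfolding plancherel_FT[OF qcs] K_def
    proof (intro ennreal_leI mult_left_mono integral_mono_AE')
      show "AE x in lborel. (cmod (q n x))\<^sup>2 \<le> L\<^sup>2 * indicat_real (ball 0 (R + 1)) x"
      proof (rule AE_I2)
        fix x show "(cmod (q n x))\<^sup>2 \<le> L\<^sup>2 * indicat_real (ball 0 (R + 1)) x"
          using power_mono[OF qb[of n x], of 2] by (cases "norm x < R + 1") (simp_all add: power_mult_distrib)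
      qed
    qed (auto simp: integrable_indicator_ball[of 1, simplified])
    have FTq: "FT (q n) \<xi> = (exp (complex_of_real (t n) * (\<i> * complex_of_real (b \<bullet> \<xi>))) - 1) / complex_of_real (t n) * FT \<eta> \<xi>" for n \<xi>
    proof -
      have "FT (q n) \<xi> = complex_of_real (inverse (t n)) * (exp (\<i> * complex_of_real ((t n *\<^sub>R b) \<bullet> \<xi>)) * FT \<eta> \<xi> - FT \<eta> \<xi>)"
        unfolding q_def FT_cmult
        by (subst FT_diff) (auto intro!: bounded_cs_translate \<eta> simp: FT_translate)
      then show ?thesis by (simp add: field_simps)
    qed
    have lim: "(\<lambda>n. (cmod (FT (q n) \<xi>))\<^sup>2) \<longlonglongrightarrow> (\<xi> \<bullet> b)\<^sup>2 * (cmod (FT \<eta> \<xi>))\<^sup>2" for \<xi>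
    proof -
      define w where "w = \<i> * complex_of_real (b \<bullet> \<xi>)"
      have "((\<lambda>h. exp (h * w)) has_field_derivative w) (at 0)"
        by (auto intro!: derivative_eq_intros)
      then have "((\<lambda>h. (exp (h * w) - 1) / h) \<longlongrightarrow> w) (at 0)"
        by (simp add: DERIV_def)
      moreover have "filterlim (\<lambda>n. complex_of_real (t n)) (at 0) sequentially"
        unfolding filterlim_at using tendsto_of_real[OF tl, where 'a=complex] t0
        by (auto simp: less_imp_neq[OF t0(1), symmetric] intro!: always_eventually)
      ultimately have "(\<lambda>n. (exp (complex_of_real (t n) * w) - 1) / complex_of_real (t n)) \<longlonglongrightarrow> w"
        by (rule filterlim_compose)
      then have "(\<lambda>n. (cmod (FT (q n) \<xi>))\<^sup>2) \<longlonglongrightarrow> (cmod (w * FT \<eta> \<xi>))\<^sup>2"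
        unfolding FTq w_def[symmetric] by (intro tendsto_intros)
      then show ?thesis by (simp add: w_def norm_mult power_mult_distrib inner_commute)
    qed
    have qm [measurable]: "q n \<in> borel_measurable borel" for n using qcs by (simp add: bounded_cs_def)
    have "(\<integral>\<^sup>+\<xi>. ennreal ((\<xi> \<bullet> b)\<^sup>2 * (cmod (FT \<eta> \<xi>))\<^sup>2) \<partial>lborel) = (\<integral>\<^sup>+\<xi>. liminf (\<lambda>n. ennreal ((cmod (FT (q n) \<xi>))\<^sup>2)) \<partial>lborel)"
      using tendsto_ennrealI[OF lim] by (intro nn_integral_cong lim_imp_Liminf[symmetric]) auto
    also have "\<dots> \<le> liminf (\<lambda>n. \<integral>\<^sup>+\<xi>. ennreal ((cmod (FT (q n) \<xi>))\<^sup>2) \<partial>lborel)"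
      by (rule nn_integral_liminf) measurable
    also have "\<dots> \<le> ennreal K"
      using bound by (intro Liminf_le) (auto intro!: always_eventually)
    finally show ?thesis using ennreal_less_top le_less_trans by (metis infinity_ennreal_def)
  qed
  have norm_eq: "(norm (v::'a))\<^sup>2 = (\<Sum>b\<in>Basis. (v \<bullet> b)\<^sup>2)" for v
    by (simp add: euclidean_inner[of v v] power2_norm_eq_inner power2_eq_square[of "v \<bullet> _"])
  have "(\<integral>\<^sup>+\<xi>. ennreal ((1 + (norm \<xi>)\<^sup>2) * (cmod (FT \<eta> \<xi>))\<^sup>2) \<partial>lborel)
     = (\<integral>\<^sup>+\<xi>. ennreal ((cmod (FT \<eta> \<xi>))\<^sup>2) + (\<Sum>b\<in>Basis. ennreal ((\<xi> \<bullet> b)\<^sup>2 * (cmod (FT \<eta> \<xi>))\<^sup>2)) \<partial>lborel)"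
    by (simp add: norm_eq distrib_right sum_distrib_right sum_nonneg flip: ennreal_plus)
  also have "\<dots> = (\<integral>\<^sup>+\<xi>. ennreal ((cmod (FT \<eta> \<xi>))\<^sup>2) \<partial>lborel) + (\<Sum>b\<in>Basis. \<integral>\<^sup>+\<xi>. ennreal ((\<xi> \<bullet> b)\<^sup>2 * (cmod (FT \<eta> \<xi>))\<^sup>2) \<partial>lborel)"
    by (subst nn_integral_add, simp, simp, subst nn_integral_sum) (simp_all del: sum_ennreal)
  also have "\<dots> < \<infinity>"
    using part plancherel_FT[OF \<eta>] by (simp add: ennreal_add_less_top)
  finally show ?thesis .
qed

lemma ennreal_integral_le_nn_integral:
  assumes "integrable M f"
  shows "ennreal (integral\<^sup>L M f) \<le> (\<integral>\<^sup>+x. ennreal (f x) \<partial>M)"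
proof -
  have i: "integrable M (\<lambda>x. max 0 (f x))" using assms by simp
  have "ennreal (integral\<^sup>L M f) \<le> ennreal (LINT x|M. max 0 (f x))"
    by (intro ennreal_leI integral_mono assms i) auto
  also have "\<dots> = (\<integral>\<^sup>+x. ennreal (max 0 (f x)) \<partial>M)"
    by (rule nn_integral_eq_integral[OF i, symmetric]) auto
  also have "(\<lambda>x. ennreal (max 0 (f x))) = (\<lambda>x. ennreal (f x))"
    by (auto simp: max_def ennreal_neg)
  finally show ?thesis .
qed

text \<open>
  Let \<open>\<eta>\<close> be a Lipschitz cutoff that is \<open>1\<close> on the ball which carries \<open>h\<close>, so that the integral of \<open>h\<close> is
  that of \<open>h \<eta>\<close>. By Parseval's identity it is bounded by the integral of the product of the two
  transforms, and the Cauchy-Schwarz inequality with the weight \<open>1 + |\<xi>|\<^sup>2\<close> finishes the proof because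
  \<open>\<eta>\<close> lies in \<open>H\<^sup>1\<close>.
\<close>

lemma localization:
  assumes \<rho>: "\<rho> > 0"
  obtains C where "C \<ge> 0" "\<And>h :: 'a::euclidean_space \<Rightarrow> complex. bounded_cs h \<Longrightarrow> (\<And>x. norm x \<ge> \<rho> \<Longrightarrow> h x = 0) \<Longrightarrow>
    ennreal ((cmod (LINT x|lborel. h x))\<^sup>2) \<le> ennreal C * (\<integral>\<^sup>+\<xi>. ennreal ((cmod (FT h \<xi>))\<^sup>2 / (1 + (norm \<xi>)\<^sup>2)) \<partial>lborel)"
proof -
  define \<eta> where "\<eta> = (\<lambda>x::'a. complex_of_real (max 0 (min 1 (2 - norm x / \<rho>))))"
  have \<eta>m [measurable]: "\<eta> \<in> borel_measurable borel" unfolding \<eta>_def by measurable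
  have \<eta>cs: "bounded_cs \<eta>"
  proof (rule bounded_csI[OF \<eta>m, where B = 1 and R = "2 * \<rho>"])
    fix x show "cmod (\<eta> x) \<le> 1 * indicat_real (ball 0 (2 * \<rho>)) x"
      unfolding \<eta>_def norm_of_real using \<rho> by (auto simp: indicator_def field_simps)
  qed
  have \<eta>lip: "cmod (\<eta> x - \<eta> y) \<le> (1 / \<rho>) * norm (x - y)" for x y
  proof -
    have "\<bar>max 0 (min 1 a) - max 0 (min 1 b)\<bar> \<le> \<bar>a - b\<bar>" for a b :: real by linarith
    then have "cmod (\<eta> x - \<eta> y) \<le> \<bar>(2 - norm x / \<rho>) - (2 - norm y / \<rho>)\<bar>"
      unfolding \<eta>_def of_real_diff[symmetric] norm_of_real .
    also have "\<dots> = \<bar>norm x - norm y\<bar> / \<rho>"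
      using \<rho> by (simp add: abs_minus_commute diff_divide_distrib[symmetric] abs_divide)
    also have "\<dots> \<le> norm (x - y) / \<rho>"
      using \<rho> norm_triangle_ineq3[of x y] by (intro divide_right_mono) auto
    finally show ?thesis by simp
  qed
  have \<eta>1: "\<eta> x = 1" if "norm x < \<rho>" for x
    using that \<rho> by (simp add: \<eta>_def)
  define H where "H = (\<integral>\<^sup>+\<xi>. ennreal ((1 + (norm \<xi>)\<^sup>2) * (cmod (FT \<eta> \<xi>))\<^sup>2) \<partial>lborel)"
  have Hfin: "H < \<infinity>" unfolding H_def by (rule FT_lipschitz_H1[OF \<eta>cs \<eta>lip])
  define p where "p = (2 * pi) ^ DIM('a)"
  have p: "p \<ge> 1" unfolding p_def using pi_gt3 by (intro one_le_power) auto
  have "ennreal ((cmod (LINT x|lborel. h x))\<^sup>2) \<le> ennreal (enn2real H) * (\<integral>\<^sup>+\<xi>. ennreal ((cmod (FT h \<xi>))\<^sup>2 / (1 + (norm \<xi>)\<^sup>2)) \<partial>lborel)"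
    if h: "bounded_cs h" and supp: "\<And>x. norm x \<ge> \<rho> \<Longrightarrow> h x = 0" for h :: "'a \<Rightarrow> complex"
  proof -
    have hm [measurable]: "h \<in> borel_measurable borel" using h by (simp add: bounded_cs_def)
    define z where "z = (LINT x|lborel. h x)"
    \<comment> \<open>A phase factor makes the integral of \<open>h\<close> nonnegative, so that polarization only involves real parts.\<close>
    obtain c where c: "cmod c = 1" "c * z = complex_of_real (cmod z)"
    proof (cases "z = 0")
      case True then show ?thesis using that[of 1] by simp
    next
      case False
      have "cnj z / complex_of_real (cmod z) * z = complex_of_real (cmod z)"
        using False complex_norm_square[of z] by (simp add: field_simps power2_eq_square)
      then show ?thesis using that[of "cnj z / complex_of_real (cmod z)"] False by (simp add: norm_divide)
    qed
    define k where "k = (\<lambda>x. c * h x)"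
    have k: "bounded_cs k" unfolding k_def by (rule bounded_cs_cmult[OF h])
    have km [measurable]: "k \<in> borel_measurable borel" using k by (simp add: bounded_cs_def)
    have ki: "integrable lborel k" by (rule bounded_cs_integrable[OF k])
    have "integral\<^sup>L lborel k = complex_of_real (cmod z)"
      unfolding k_def using c by (simp add: z_def)
    then have kz: "(LINT x|lborel. Re (k x)) = cmod z"
      using ki by simp
    have pt: "(cmod (k x + \<eta> x))\<^sup>2 - (cmod (k x - \<eta> x))\<^sup>2 = 4 * Re (k x)" for x
    proof (cases "norm x < \<rho>")
      case True then show ?thesis unfolding \<eta>1[OF True] cmod_power2
        by (simp add: power2_eq_square algebra_simps)
    next
      case False then show ?thesis using supp[of x] by (simp add: k_def)
    qed
    let ?F = "FT k" and ?E = "FT \<eta>"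
    note P1 = has_bochner_integral_plancherel_FT[OF bounded_cs_add[OF k \<eta>cs]]
      and P2 = has_bochner_integral_plancherel_FT[OF bounded_cs_diff[OF k \<eta>cs]]
    have ptF: "(cmod (FT (\<lambda>x. k x + \<eta> x) \<xi>))\<^sup>2 - (cmod (FT (\<lambda>x. k x - \<eta> x) \<xi>))\<^sup>2 \<le> 4 * (cmod (?F \<xi>) * cmod (?E \<xi>))" for \<xi>
    proof -
      have "(cmod (a + b))\<^sup>2 - (cmod (a - b))\<^sup>2 = 4 * Re (a * cnj b)" for a b
        unfolding cmod_power2 by (simp add: power2_eq_square algebra_simps)
      moreover have "Re (a * cnj b) \<le> cmod a * cmod b" for a b
        using complex_Re_le_cmod[of "a * cnj b"] by (simp add: norm_mult)
      ultimately show ?thesis unfolding FT_add[OF k \<eta>cs] FT_diff[OF k \<eta>cs]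
        by (metis mult_left_mono zero_le_numeral)
    qed
    have "p * (LINT x|lborel. (cmod (k x + \<eta> x))\<^sup>2) - p * (LINT x|lborel. (cmod (k x - \<eta> x))\<^sup>2)
       = p * (LINT x|lborel. (cmod (k x + \<eta> x))\<^sup>2 - (cmod (k x - \<eta> x))\<^sup>2)"
      by (simp add: Bochner_Integration.integral_diff bounded_cs_square_integrable bounded_cs_add bounded_cs_diff k \<eta>cs right_diff_distrib)
    also have "\<dots> = p * (4 * cmod z)" unfolding pt using kz by simp
    finally have val: "has_bochner_integral lborel (\<lambda>\<xi>. (cmod (FT (\<lambda>x. k x + \<eta> x) \<xi>))\<^sup>2 - (cmod (FT (\<lambda>x. k x - \<eta> x) \<xi>))\<^sup>2) (p * (4 * cmod z))"
      using has_bochner_integral_diff[OF P1 P2] by (simp add: p_def)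
    have "ennreal (4 * cmod z) \<le> ennreal (p * (4 * cmod z))"
      by (intro ennreal_leI) (use p in \<open>auto simp: mult_le_cancel_right1\<close>)
    also have "\<dots> \<le> (\<integral>\<^sup>+\<xi>. ennreal ((cmod (FT (\<lambda>x. k x + \<eta> x) \<xi>))\<^sup>2 - (cmod (FT (\<lambda>x. k x - \<eta> x) \<xi>))\<^sup>2) \<partial>lborel)"
    using ennreal_integral_le_nn_integral[OF integrable.intros[OF val]]
      unfolding has_bochner_integral_integral_eq[OF val] .
    also have "\<dots> \<le> (\<integral>\<^sup>+\<xi>. ennreal (4 * (cmod (?F \<xi>) * cmod (?E \<xi>))) \<partial>lborel)"
      by (intro nn_integral_mono ennreal_leI ptF)
    also have "\<dots> = ennreal 4 * (\<integral>\<^sup>+\<xi>. ennreal (cmod (?F \<xi>) * cmod (?E \<xi>)) \<partial>lborel)"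
      by (subst nn_integral_cmult[symmetric]) (auto simp: ennreal_mult)
    finally have "ennreal (cmod z) \<le> (\<integral>\<^sup>+\<xi>. ennreal (cmod (?F \<xi>) * cmod (?E \<xi>)) \<partial>lborel)"
      by (simp add: ennreal_mult ennreal_mult_le_mult_iff)
    also have "\<dots> = (\<integral>\<^sup>+\<xi>. ennreal (cmod (?F \<xi>) / sqrt (1 + (norm \<xi>)\<^sup>2)) * ennreal (sqrt (1 + (norm \<xi>)\<^sup>2) * cmod (?E \<xi>)) \<partial>lborel)"
      by (intro nn_integral_cong, subst ennreal_mult[symmetric]) (auto simp: add_nonneg_eq_0_iff)
    finally have "(ennreal (cmod z))\<^sup>2 \<le> (\<integral>\<^sup>+\<xi>. ennreal (cmod (?F \<xi>) / sqrt (1 + (norm \<xi>)\<^sup>2)) * ennreal (sqrt (1 + (norm \<xi>)\<^sup>2) * cmod (?E \<xi>)) \<partial>lborel)\<^sup>2"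
      by (rule power_mono) simp
    also have "\<dots> \<le> (\<integral>\<^sup>+\<xi>. (ennreal (cmod (?F \<xi>) / sqrt (1 + (norm \<xi>)\<^sup>2)))\<^sup>2 \<partial>lborel) * (\<integral>\<^sup>+\<xi>. (ennreal (sqrt (1 + (norm \<xi>)\<^sup>2) * cmod (?E \<xi>)))\<^sup>2 \<partial>lborel)"
      by (rule Cauchy_Schwarz_nn_integral) measurable
    also have "(\<integral>\<^sup>+\<xi>. (ennreal (cmod (?F \<xi>) / sqrt (1 + (norm \<xi>)\<^sup>2)))\<^sup>2 \<partial>lborel) = (\<integral>\<^sup>+\<xi>. ennreal ((cmod (FT h \<xi>))\<^sup>2 / (1 + (norm \<xi>)\<^sup>2)) \<partial>lborel)"
      using c(1) by (intro nn_integral_cong) (simp add: ennreal_power power_divide k_def FT_cmult norm_mult)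
    also have "(\<integral>\<^sup>+\<xi>. (ennreal (sqrt (1 + (norm \<xi>)\<^sup>2) * cmod (?E \<xi>)))\<^sup>2 \<partial>lborel) = H"
      unfolding H_def by (intro nn_integral_cong) (simp add: ennreal_power power_mult_distrib)
    also have "H = ennreal (enn2real H)" using Hfin by simp
    finally show ?thesis unfolding z_def by (simp add: ennreal_power mult.commute)
  qed
  then show ?thesis using that[of "enn2real H"] by simp
qed

section \<open>Partial Fourier transforms\<close>

lemma bounded_cs_pair_integrable:
  fixes h :: "'a::euclidean_space \<times> 'b::euclidean_space \<Rightarrow> complex"
  assumes "bounded_cs h"
  shows "integrable (lborel \<Otimes>\<^sub>M lborel) h"
  using bounded_cs_integrable[OF assms] by (simp add: lborel_prod)

lemma bounded_cs_slices:
  fixes h :: "'a::euclidean_space \<times> 'b::euclidean_space \<Rightarrow> complex"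
  assumes h: "bounded_cs h"
  shows "bounded_cs (\<lambda>y. h (x, y))" "bounded_cs (\<lambda>x. h (x, y))"
proof -
  obtain B R where hm[measurable]: "h \<in> borel_measurable borel" and B: "B > 0"
    and hb: "\<And>x. cmod (h x) \<le> B * indicat_real (ball 0 R) x"
    using bounded_csE[OF h] by metis
  have hm': "h \<in> borel_measurable (borel \<Otimes>\<^sub>M borel)" using hm by (simp add: borel_prod)
  have 1: "indicat_real (ball 0 R) (x, y) \<le> indicat_real (ball 0 R) y"
     and 2: "indicat_real (ball 0 R) (x, y) \<le> indicat_real (ball 0 R) x" for x :: 'a and y :: 'b
    using norm_snd_le[of y x] norm_fst_le[of x y] by (auto simp: indicator_def)
  show "bounded_cs (\<lambda>y. h (x, y))"
  proof (rule bounded_csI[where B=B and R=R])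
    show "(\<lambda>y. h (x, y)) \<in> borel_measurable borel" using hm' by measurable
    show "cmod (h (x, y)) \<le> B * indicat_real (ball 0 R) y" for y
      by (rule order_trans[OF hb mult_left_mono[OF 1]]) (use B in auto)
  qed
  show "bounded_cs (\<lambda>x. h (x, y))"
  proof (rule bounded_csI[where B=B and R=R])
    show "(\<lambda>x. h (x, y)) \<in> borel_measurable borel" using hm' by measurable
    show "cmod (h (x, y)) \<le> B * indicat_real (ball 0 R) x" for x
      by (rule order_trans[OF hb mult_left_mono[OF 2]]) (use B in auto)
  qed
qed

lemma bounded_cs_partial_integral_snd:
  fixes h :: "'a::euclidean_space \<times> 'b::euclidean_space \<Rightarrow> complex"
  assumes h: "bounded_cs h"
  shows "bounded_cs (\<lambda>x. LINT y|lborel. h (x, y))"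
proof -
  obtain B R where hm[measurable]: "h \<in> borel_measurable borel" and B: "B > 0" and R: "R > 0"
    and hb: "\<And>x. cmod (h x) \<le> B * indicat_real (ball 0 R) x"
    using bounded_csE[OF h] by metis
  have hm': "h \<in> borel_measurable (borel \<Otimes>\<^sub>M borel)" using hm by (simp add: borel_prod)
  have bd: "indicat_real (ball 0 R) (x, y) \<le> indicat_real (ball 0 R) x * indicat_real (ball 0 R) y" for x :: 'a and y :: 'b
    using norm_snd_le[of y x] norm_fst_le[of x y] by (auto simp: indicator_def)
  show "bounded_cs (\<lambda>x. LINT y|lborel. h (x, y))"
  proof (rule bounded_csI[where B="(LINT y|(lborel::'b measure). B * indicat_real (ball 0 R) y)" and R=R])
    show "(\<lambda>x. LINT y|lborel. h (x, y)) \<in> borel_measurable borel"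
      using hm' by (intro lborel.borel_measurable_lebesgue_integral) (simp add: split_beta')
    fix x :: 'a
    have "cmod (LINT y|lborel. h (x, y)) \<le> (LINT y|lborel. cmod (h (x, y)))" by (rule integral_norm_bound)
    also have "\<dots> \<le> (LINT y|(lborel::'b measure). indicat_real (ball 0 R) x * (B * indicat_real (ball 0 R) y))"
    proof (rule integral_mono_AE')
      show "AE y in lborel. cmod (h (x, y)) \<le> indicat_real (ball 0 R) x * (B * indicat_real (ball 0 R) y)"
      proof (rule AE_I2)
        fix y :: 'b
        have "cmod (h (x, y)) \<le> B * (indicat_real (ball 0 R) x * indicat_real (ball 0 R) y)"
          by (rule order_trans[OF hb mult_left_mono[OF bd]]) (use B in auto)
        then show "cmod (h (x, y)) \<le> indicat_real (ball 0 R) x * (B * indicat_real (ball 0 R) y)"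
          by (simp only: mult_ac)
      qed
    qed (use integrable_indicator_ball B in \<open>auto intro!: integrable_mult_right AE_I2 mult_nonneg_nonneg\<close>)
    finally show "cmod (LINT y|lborel. h (x, y)) \<le> (LINT y|(lborel::'b measure). B * indicat_real (ball 0 R) y) * indicat_real (ball 0 R) x"
      by (simp add: mult_ac)
  qed
qed

lemma bounded_cs_partial_integral:
  fixes h :: "'a::euclidean_space \<times> 'b::euclidean_space \<Rightarrow> complex"
  assumes h: "bounded_cs h"
  shows "bounded_cs (\<lambda>x. LINT y|lborel. h (x, y))" "bounded_cs (\<lambda>y. LINT x|lborel. h (x, y))"
proof -
  show "bounded_cs (\<lambda>x. LINT y|lborel. h (x, y))" by (rule bounded_cs_partial_integral_snd[OF h])
  obtain B R where hm: "h \<in> borel_measurable borel"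
    and hb: "\<And>p. cmod (h p) \<le> B * indicat_real (ball 0 R) p"
    using bounded_csE[OF h] by metis
  have hm' [measurable]: "h \<in> borel_measurable (borel \<Otimes>\<^sub>M borel)" using hm by (simp add: borel_prod)
  let ?k = "\<lambda>q. h (snd q, fst q)"
  have "bounded_cs ?k"
  proof (rule bounded_csI[where B = B and R = R])
    have "?k \<in> borel_measurable (borel \<Otimes>\<^sub>M borel)" by measurable
    then show "?k \<in> borel_measurable borel" by (simp add: borel_prod)
    fix q :: "'b \<times> 'a"
    have "norm (snd q, fst q) = norm q" by (simp add: norm_prod_def add.commute)
    then show "cmod (?k q) \<le> B * indicat_real (ball 0 R) q" using hb[of "(snd q, fst q)"] by (simp add: indicator_def)
  qed
  from bounded_cs_partial_integral_snd[OF this] show "bounded_cs (\<lambda>y. LINT x|lborel. h (x, y))" by simp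
qed

lemma bounded_cs_pair_modulate:
  fixes h :: "'a::euclidean_space \<times> 'b::euclidean_space \<Rightarrow> complex"
  assumes h: "bounded_cs h"
  shows "bounded_cs (\<lambda>p. h p * exp (- \<i> * complex_of_real (snd p \<bullet> \<xi>')))" "bounded_cs (\<lambda>p. h p * exp (- \<i> * complex_of_real (fst p \<bullet> \<xi>)))"
  by (rule bounded_cs_mult[OF h, where K=1]; (intro borel_measurable_continuous_onI continuous_intros)?; simp)+

lemma bounded_cs_partial_FT:
  fixes h :: "'a::euclidean_space \<times> 'b::euclidean_space \<Rightarrow> complex"
  assumes h: "bounded_cs h"
  shows "bounded_cs (\<lambda>x. FT (\<lambda>y. h (x, y)) \<xi>')" "bounded_cs (\<lambda>y. FT (\<lambda>x. h (x, y)) \<xi>)"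
  using bounded_cs_partial_integral(1)[OF bounded_cs_pair_modulate(1)[OF h, of \<xi>']]
     bounded_cs_partial_integral(2)[OF bounded_cs_pair_modulate(2)[OF h, of \<xi>]]
  unfolding FT_def by simp_all

lemma FT_pair:
  fixes h :: "'a::euclidean_space \<times> 'b::euclidean_space \<Rightarrow> complex"
  assumes h: "bounded_cs h"
  shows "FT h (\<xi>, \<xi>') = FT (\<lambda>x. FT (\<lambda>y. h (x, y)) \<xi>') \<xi>"
    and "FT h (\<xi>, \<xi>') = FT (\<lambda>y. FT (\<lambda>x. h (x, y)) \<xi>) \<xi>'"
proof -
  let ?k = "\<lambda>p. h p * exp (- \<i> * complex_of_real (p \<bullet> (\<xi>, \<xi>')))"
  have k: "bounded_cs ?k" by (rule bounded_cs_modulate[OF h])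
  note i = bounded_cs_pair_integrable[OF k]
  have ke: "?k (x, y) = h (x, y) * exp (- \<i> * complex_of_real (y \<bullet> \<xi>')) * exp (- \<i> * complex_of_real (x \<bullet> \<xi>))" for x y
    by (simp add: exp_add[symmetric] distrib_left add.commute mult.assoc)
  have e: "FT h (\<xi>, \<xi>') = integral\<^sup>L (lborel \<Otimes>\<^sub>M lborel) ?k"
    unfolding FT_def by (simp add: lborel_prod)
  have "FT h (\<xi>, \<xi>') = (LINT x|lborel. LINT y|lborel. ?k (x, y))"
    unfolding e by (rule lborel_pair.integral_fst'[OF i, symmetric])
  also have "\<dots> = FT (\<lambda>x. FT (\<lambda>y. h (x, y)) \<xi>') \<xi>"
    unfolding ke FT_def by simp
  finally show 1: "FT h (\<xi>, \<xi>') = FT (\<lambda>x. FT (\<lambda>y. h (x, y)) \<xi>') \<xi>" .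
  have "(LINT x|lborel. LINT y|lborel. ?k (x, y)) = (LINT y|lborel. LINT x|lborel. ?k (x, y))"
    by (rule lborel_pair.Fubini_integral[symmetric]) (use i in \<open>simp only: case_prod_beta' prod.collapse\<close>)
  also have "\<dots> = (LINT y|lborel. LINT x|lborel. (h (x, y) * exp (- \<i> * complex_of_real (x \<bullet> \<xi>))) * exp (- \<i> * complex_of_real (y \<bullet> \<xi>')))"
    unfolding ke by (simp only: mult_ac)
  also have "\<dots> = FT (\<lambda>y. FT (\<lambda>x. h (x, y)) \<xi>) \<xi>'"
    unfolding FT_def by simp
  finally show "FT h (\<xi>, \<xi>') = FT (\<lambda>y. FT (\<lambda>x. h (x, y)) \<xi>) \<xi>'"
    using \<open>FT h (\<xi>, \<xi>') = (LINT x|lborel. LINT y|lborel. ?k (x, y))\<close> by simp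
qed

section \<open>Cross sections of indicator functions\<close>

lemma borel_measurable_lebesgue_AE:
  fixes f :: "'a::euclidean_space \<Rightarrow> 'b::real_normed_vector"
  assumes g: "g \<in> borel_measurable borel" and eq: "AE x in lborel. f x = g x"
  shows "f \<in> borel_measurable lebesgue"
proof (rule measurableI)
  fix A :: "'b set" assume A: "A \<in> sets borel"
  have "g -` A \<inter> space borel \<in> sets borel" using g A by (rule measurable_sets)
  then have gA: "g -` A \<in> sets lebesgue" by simp
  have "AE x in lebesgue. x \<in> g -` A \<longleftrightarrow> x \<in> f -` A"
    using AE_completion[OF eq] by eventually_elim simp
  then have "f -` A \<in> sets lebesgue"
    by (rule completion.in_sets_AE[OF _ gA]) simp
  then show "f -` A \<inter> space lebesgue \<in> sets lebesgue" by simp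
qed simp

text \<open>
  Borel representatives of admissible functions whose essential support lies in the ball.
\<close>

definition cs_indicator :: "real \<Rightarrow> ('a::euclidean_space \<Rightarrow> real) \<Rightarrow> bool" where
  "cs_indicator \<rho> v \<longleftrightarrow> v \<in> borel_measurable borel \<and> (\<forall>x. v x \<in> {0, 1}) \<and> (\<forall>x. norm x \<ge> \<rho> \<longrightarrow> v x = 0)"

lemma cs_indicatorD:
  assumes "cs_indicator \<rho> v"
  shows "v \<in> borel_measurable borel" "v x \<in> {0, 1}" "\<rho> \<le> norm x \<Longrightarrow> v x = 0"
  using assms unfolding cs_indicator_def by auto

text \<open>
  The complement of the essential support is a union of null open sets; by Lindelof's theorem
  countably many of them suffice.
\<close>

lemma AE_zero_outside_ess_support:
  fixes u :: "'a::euclidean_space \<Rightarrow> real"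
  shows "AE x in lborel. x \<notin> ess_support u \<longrightarrow> u x = 0"
proof -
  let ?F = "{U. open U \<and> (AE x in lebesgue. x \<in> U \<longrightarrow> u x = 0)}"
  obtain F' where F': "F' \<subseteq> ?F" "countable F'" "\<Union>F' = \<Union>?F"
    using Lindelof[of ?F] by auto
  have "AE x in lebesgue. \<forall>U\<in>F'. x \<in> U \<longrightarrow> u x = 0"
    using F'(1,2) by (subst AE_ball_countable) auto
  then have "AE x in lebesgue. x \<notin> ess_support u \<longrightarrow> u x = 0"
    by eventually_elim (use F'(3) in \<open>auto simp: ess_support_def\<close>)
  then show ?thesis by (simp add: AE_completion_iff)
qed

lemma borel_representative:
  fixes u :: "'a::euclidean_space \<Rightarrow> real"
  assumes um: "u \<in> borel_measurable lebesgue" and u01: "AE x in lebesgue. u x \<in> {0, 1}"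
    and supp: "ess_support u \<subseteq> ball 0 \<rho>"
  obtains v where "cs_indicator \<rho> v" "AE x in lborel. u x = v x"
proof -
  obtain u' where u': "u' \<in> borel_measurable lborel" "AE x in lborel. u x = u' x"
    using completion_ex_borel_measurable_real[OF um] by auto
  have [measurable]: "u' \<in> borel_measurable borel" using u'(1) by simp
  define v where "v = (\<lambda>x. if u' x = 1 \<and> norm x < \<rho> then 1 else 0 :: real)"
  have "v \<in> borel_measurable borel" unfolding v_def by measurable
  then have "cs_indicator \<rho> v" unfolding cs_indicator_def by (auto simp: v_def)
  moreover have "AE x in lborel. u x \<in> {0, 1}" using u01 by (simp only: AE_completion_iff)
  then have "AE x in lborel. u x = v x"
    using u'(2) AE_zero_outside_ess_support[of u]
  proof eventually_elim
    case (elim x)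
    show ?case
    proof (cases "norm x < \<rho>")
      case False
      then have "x \<notin> ess_support u" using supp by auto
      then show ?thesis using elim False by (simp add: v_def)
    qed (use elim in \<open>auto simp: v_def\<close>)
  qed
  ultimately show ?thesis using that by blast
qed

abbreviation cfun :: "('a \<Rightarrow> real) \<Rightarrow> 'a \<Rightarrow> complex" where
  "cfun f \<equiv> (\<lambda>x. complex_of_real (f x))"

lemma cs_indicator_bounded_cs:
  assumes "cs_indicator \<rho> v" shows "bounded_cs (\<lambda>x. complex_of_real (v x))"
proof (rule bounded_csI[where B = 1 and R = \<rho>])
  have [measurable]: "v \<in> borel_measurable borel" using assms by (simp add: cs_indicator_def)
  show "(\<lambda>x. complex_of_real (v x)) \<in> borel_measurable borel" by measurable
  show "cmod (complex_of_real (v x)) \<le> 1 * indicat_real (ball 0 \<rho>) x" for x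
    using cs_indicatorD(2,3)[OF assms, of x] by (cases "norm x < \<rho>") auto
qed

definition section_area :: "(real \<times> 'b::euclidean_space \<Rightarrow> real) \<Rightarrow> real \<Rightarrow> real" where
  "section_area v x = (LINT y|lborel. v (x, y))"

lemma section_area_bounds:
  fixes v :: "real \<times> 'b::euclidean_space \<Rightarrow> real"
  assumes v: "cs_indicator \<rho> v"
  shows "section_area v \<in> borel_measurable borel" "0 \<le> section_area v x"
    "section_area v x \<le> measure lborel (ball (0::'b) \<rho>) * indicat_real (ball 0 \<rho>) x"
proof -
  have m: "v \<in> borel_measurable (borel \<Otimes>\<^sub>M borel)" and v01: "v p \<in> {0, 1}" and v0: "norm p \<ge> \<rho> \<Longrightarrow> v p = 0" for p
    unfolding borel_prod by (rule cs_indicatorD[OF v], assumption?)+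
  show "section_area v \<in> borel_measurable borel"
    unfolding section_area_def[abs_def]
    using m by (intro lborel.borel_measurable_lebesgue_integral) (simp add: split_beta')
  have nn: "0 \<le> v p" for p using v01[of p] by auto
  show "0 \<le> section_area v x" unfolding section_area_def using nn by (intro Bochner_Integration.integral_nonneg) auto
  have "section_area v x \<le> (LINT y|lborel. indicat_real (ball 0 \<rho>) x * (1 * indicat_real (ball (0::'b) \<rho>) y))"
    unfolding section_area_def
  proof (rule integral_mono_AE')
    show "integrable lborel (\<lambda>y. indicat_real (ball 0 \<rho>) x * (1 * indicat_real (ball (0::'b) \<rho>) y))"
      by (intro integrable_mult_right integrable_indicator_ball)
    show "AE y in lborel. v (x, y) \<le> indicat_real (ball 0 \<rho>) x * (1 * indicat_real (ball 0 \<rho>) y)"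
    proof (rule AE_I2)
      fix y
      show "v (x, y) \<le> indicat_real (ball 0 \<rho>) x * (1 * indicat_real (ball 0 \<rho>) y)"
        using v01[of "(x, y)"] v0[of "(x, y)"] norm_snd_le[of y x] norm_fst_le[of x y]
        by (auto simp: indicator_def)
    qed
  qed (use nn in auto)
  then show "section_area v x \<le> measure lborel (ball (0::'b) \<rho>) * indicat_real (ball 0 \<rho>) x"
    by (simp add: mult.commute)
qed

lemma section_area_bounded_cs:
  fixes v :: "real \<times> 'b::euclidean_space \<Rightarrow> real"
  assumes v: "cs_indicator \<rho> v"
  shows "bounded_cs (cfun (section_area v))"
proof (rule bounded_csI[where B = "measure lborel (ball (0::'b) \<rho>)" and R = \<rho>])
  show "(cfun (section_area v)) \<in> borel_measurable borel"
    using section_area_bounds(1)[OF v] by measurable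
  show "cmod (complex_of_real (section_area v x)) \<le> measure lborel (ball (0::'b) \<rho>) * indicat_real (ball 0 \<rho>) x" for x
    using section_area_bounds(2,3)[OF v, of x] by simp
qed

lemma cross_area_eq_section_area:
  fixes u :: "real \<times> (real^'m) \<Rightarrow> real"
  assumes v: "cs_indicator \<rho> v" and eq: "AE x in lborel. u x = v x"
  shows "AE x in lborel. cross_area u x = section_area v x"
proof -
  have m: "v \<in> borel_measurable (borel \<Otimes>\<^sub>M borel)"
    unfolding borel_prod by (rule cs_indicatorD(1)[OF v])
  have "AE x in lborel. AE y in lborel. u (x, y) = v (x, y)"
    by (rule lborel_pair.AE_pair) (subst lborel_prod, rule eq)
  then show ?thesis
  proof eventually_elim
    case (elim x)
    have vm: "(\<lambda>y. v (x, y)) \<in> borel_measurable borel" using m by measurable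
    have "cross_area u x = (LINT y|lebesgue. v (x, y))"
      unfolding cross_area_def
      by (rule integral_cong_AE[OF borel_measurable_lebesgue_AE[OF vm elim] _ AE_completion[OF elim]])
         (use vm in \<open>auto intro: measurable_completion\<close>)
    also have "\<dots> = section_area v x" unfolding section_area_def using vm by (intro integral_completion) simp
    finally show ?case .
  qed
qed

text \<open>
  This is why the nonlocal energy sees the cross-sectional area: integrating out \<open>x'\<close> amounts to
  evaluating the transform on the axis \<open>\<xi>' = 0\<close>, where the kernel is largest.
\<close>

lemma FT_section_area:
  fixes v :: "real \<times> 'b::euclidean_space \<Rightarrow> real"
  assumes v: "cs_indicator \<rho> v"
  shows "FT (cfun (section_area v)) \<xi> = FT (cfun v) (\<xi>, 0)"
  unfolding FT_pair(1)[OF cs_indicator_bounded_cs[OF v]]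
  by (simp add: FT_def[of _ "0::'b"] section_area_def)

section \<open>Estimates from the nonlocal energy\<close>

definition kernel_weight :: "real \<Rightarrow> real \<Rightarrow> 'b::euclidean_space \<Rightarrow> real" where
  "kernel_weight \<epsilon> \<xi> \<xi>' = \<xi>\<^sup>2 / (\<epsilon>\<^sup>2 * \<xi>\<^sup>2 + (norm \<xi>')\<^sup>2)"

abbreviation kernel_integral :: "'b::euclidean_space set \<Rightarrow> real \<Rightarrow> real \<Rightarrow> ennreal" where
  "kernel_integral S \<epsilon> \<xi> \<equiv> \<integral>\<^sup>+\<xi>'. indicator S \<xi>' * ennreal (kernel_weight \<epsilon> \<xi> \<xi>') \<partial>lborel"

lemma kernel_weight_nonneg: "0 \<le> kernel_weight \<epsilon> \<xi> \<xi>'"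
  unfolding kernel_weight_def by simp

lemma kernel_weight_measurable [measurable]:
  "(\<lambda>x. kernel_weight \<epsilon> (f x) (g x)) \<in> borel_measurable M" if "f \<in> borel_measurable M" "g \<in> borel_measurable M"
  using that unfolding kernel_weight_def by measurable

text \<open>
  The nonlocal energy without its prefactor, for the transform \<open>FT\<close> and as an iterated integral;
  \<open>nonlocal_energy_eq\<close> supplies the constants.
\<close>

definition nonlocal :: "real \<Rightarrow> (real \<times> 'b::euclidean_space \<Rightarrow> real) \<Rightarrow> ennreal" where
  "nonlocal \<epsilon> v = (\<integral>\<^sup>+\<xi>. (\<integral>\<^sup>+\<xi>'. ennreal (kernel_weight \<epsilon> \<xi> \<xi>' * (cmod (FT (cfun v) (\<xi>, \<xi>')))\<^sup>2) \<partial>lborel) \<partial>lborel)"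

lemma FT_pair_measurable [measurable]:
  fixes h :: "'a::euclidean_space \<times> 'b::euclidean_space \<Rightarrow> complex"
  assumes "h \<in> borel_measurable borel"
  shows "FT h \<in> borel_measurable (borel \<Otimes>\<^sub>M borel)"
  using FT_measurable[OF assms] by (simp add: borel_prod)

lemma nonlocal_energy_eq:
  fixes u v :: "real \<times> (real^'m) \<Rightarrow> real"
  assumes v: "cs_indicator \<rho> v" and um: "u \<in> borel_measurable lebesgue" and eq: "AE x in lborel. u x = v x"
  shows "ennreal (prefactor (CARD('m) + 1) \<epsilon>) * nonlocal \<epsilon> v = ennreal ((2 * pi) ^ (CARD('m) + 1)) * nonlocal_energy \<epsilon> u"
proof -
  let ?V = "cfun v"
  let ?d = "CARD('m) + 1"
  let ?k = "((2 * pi) powr (- real ?d / 2))\<^sup>2"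
  have V: "bounded_cs ?V" by (rule cs_indicator_bounded_cs[OF v])
  then have Vm [measurable]: "?V \<in> borel_measurable borel" by (simp add: bounded_cs_def)
  have [measurable]: "(fst :: real \<times> (real^'m) \<Rightarrow> real) \<in> borel_measurable borel" "(snd :: real \<times> (real^'m) \<Rightarrow> real^'m) \<in> borel_measurable borel"
    by (intro borel_measurable_continuous_onI continuous_intros)+
  have D: "DIM(real \<times> (real^'m)) = ?d" by simp
  have fe: "fourier (\<lambda>x. complex_of_real (u x)) = fourier ?V"
  proof
    fix \<xi> show "fourier (\<lambda>x. complex_of_real (u x)) \<xi> = fourier ?V \<xi>"
    proof (rule fourier_cong_AE)
      show "?V \<in> borel_measurable lebesgue" using Vm by (intro measurable_completion) simp
      show "AE x in lborel. complex_of_real (u x) = ?V x" using eq by eventually_elim simp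
    qed (use um in measurable)
  qed
  have "nonlocal_energy \<epsilon> u = ennreal (prefactor ?d \<epsilon>) *
     (\<integral>\<^sup>+\<xi>. ennreal ?k * ennreal (kernel_weight \<epsilon> (fst \<xi>) (snd \<xi>) * (cmod (FT ?V \<xi>))\<^sup>2) \<partial>lborel)"
    unfolding nonlocal_energy_def nn_integral_completion fe fourier_eq_FT[OF Vm] D kernel_weight_def
    by (intro arg_cong2[where f = "(*)"] refl nn_integral_cong, subst ennreal_mult[symmetric])
       (auto simp: norm_mult power_mult_distrib mult_ac)
  also have "\<dots> = ennreal (prefactor ?d \<epsilon>) * (ennreal ?k * (\<integral>\<^sup>+\<xi>. ennreal (kernel_weight \<epsilon> (fst \<xi>) (snd \<xi>) * (cmod (FT ?V \<xi>))\<^sup>2) \<partial>(lborel \<Otimes>\<^sub>M lborel)))"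
    unfolding lborel_prod by (subst nn_integral_cmult) auto
  also have "(\<integral>\<^sup>+\<xi>. ennreal (kernel_weight \<epsilon> (fst \<xi>) (snd \<xi>) * (cmod (FT ?V \<xi>))\<^sup>2) \<partial>(lborel \<Otimes>\<^sub>M lborel)) = nonlocal \<epsilon> v"
    unfolding nonlocal_def by (subst lborel.nn_integral_fst[symmetric]) auto
  finally have "nonlocal_energy \<epsilon> u = ennreal (prefactor ?d \<epsilon>) * (ennreal ?k * nonlocal \<epsilon> v)" .
  then have "ennreal ((2 * pi) ^ ?d) * nonlocal_energy \<epsilon> u = (ennreal ?k * ennreal ((2 * pi) ^ ?d)) * (ennreal (prefactor ?d \<epsilon>) * nonlocal \<epsilon> v)"
    by (simp only: mult_ac)
  also have "ennreal ?k * ennreal ((2 * pi) ^ ?d) = 1"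
    by (subst ennreal_mult[symmetric]) (auto simp only: two_pi_powr ennreal_1 zero_le_power2 zero_le_power pi_ge_zero mult_nonneg_nonneg zero_le_numeral)
  finally show ?thesis by simp
qed

text \<open>
  At fixed \<open>\<xi>\<close>, apply \<open>localization\<close> to the partial transform of \<open>v\<close> in \<open>x\<^sub>1\<close>, whose integral over \<open>x'\<close> is
  the transform of the area. The kernel dominates \<open>min (\<xi>\<^sup>2) (1 / \<epsilon>\<^sup>2) / (1 + |\<xi>'|\<^sup>2)\<close>: compare \<open>\<epsilon>\<^sup>2 \<xi>\<^sup>2\<close>
  with \<open>1\<close>.
\<close>

lemma high_frequency_bound:
  fixes \<rho> :: real assumes \<rho>: "\<rho> > 0"
  obtains K where "K \<ge> 0" "\<And>\<epsilon> (v :: real \<times> 'b::euclidean_space \<Rightarrow> real). \<epsilon> > 0 \<Longrightarrow> cs_indicator \<rho> v \<Longrightarrow>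
    (\<integral>\<^sup>+\<xi>. ennreal (min (\<xi>\<^sup>2) (1 / \<epsilon>\<^sup>2) * (cmod (FT (cfun (section_area v)) \<xi>))\<^sup>2) \<partial>lborel) \<le> ennreal K * nonlocal \<epsilon> v"
proof -
  obtain K where K: "K \<ge> 0" and loc: "\<And>h :: 'b \<Rightarrow> complex. bounded_cs h \<Longrightarrow> (\<And>x. norm x \<ge> \<rho> \<Longrightarrow> h x = 0) \<Longrightarrow>
    ennreal ((cmod (LINT x|lborel. h x))\<^sup>2) \<le> ennreal K * (\<integral>\<^sup>+\<xi>. ennreal ((cmod (FT h \<xi>))\<^sup>2 / (1 + (norm \<xi>)\<^sup>2)) \<partial>lborel)"
    using localization[OF \<rho>, where 'a = 'b] by blast
  have "(\<integral>\<^sup>+\<xi>. ennreal (min (\<xi>\<^sup>2) (1 / \<epsilon>\<^sup>2) * (cmod (FT (cfun (section_area v)) \<xi>))\<^sup>2) \<partial>lborel) \<le> ennreal K * nonlocal \<epsilon> v"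
    if \<epsilon>: "\<epsilon> > 0" and v: "cs_indicator \<rho> v" for \<epsilon> and v :: "real \<times> 'b \<Rightarrow> real"
  proof -
    let ?V = "cfun v"
    let ?m = "\<lambda>\<xi>::real. min (\<xi>\<^sup>2) (1 / \<epsilon>\<^sup>2)"
    have V: "bounded_cs ?V" by (rule cs_indicator_bounded_cs[OF v])
    then have Vm [measurable]: "?V \<in> borel_measurable borel" by (simp add: bounded_cs_def)
    have m0: "?m \<xi> \<ge> 0" for \<xi> by simp
    have wt: "?m \<xi> / (1 + (norm \<xi>')\<^sup>2) \<le> kernel_weight \<epsilon> \<xi> \<xi>'" for \<xi> and \<xi>' :: 'b
    proof (cases "\<xi> = 0")
      case False
      let ?t = "(norm \<xi>')\<^sup>2" and ?a = "\<epsilon>\<^sup>2 * \<xi>\<^sup>2"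
      have a: "?a > 0" using False \<epsilon> by simp
      have "?m \<xi> * (?a + ?t) \<le> \<xi>\<^sup>2 * (1 + ?t)"
      proof -
        have "?m \<xi> * ?a \<le> (1 / \<epsilon>\<^sup>2) * ?a" using a by (intro mult_right_mono) auto
        also have "\<dots> = \<xi>\<^sup>2" using \<epsilon> by simp
        finally have "?m \<xi> * ?a \<le> \<xi>\<^sup>2" .
        moreover have "?m \<xi> * ?t \<le> \<xi>\<^sup>2 * ?t" by (intro mult_right_mono) auto
        ultimately show ?thesis by (simp add: distrib_left)
      qed
      moreover have "0 < ?a + ?t" using a by (simp add: add_pos_nonneg)
      moreover have "0 < 1 + ?t" by (simp add: add_pos_nonneg)
      ultimately show ?thesis unfolding kernel_weight_def
        by (intro mult_imp_div_pos_le) (simp_all only: times_divide_eq_left pos_le_divide_eq)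
    qed (simp add: kernel_weight_nonneg)
    have pt: "ennreal (?m \<xi> * (cmod (FT (cfun (section_area v)) \<xi>))\<^sup>2) \<le>
        ennreal K * (\<integral>\<^sup>+\<xi>'. ennreal (kernel_weight \<epsilon> \<xi> \<xi>' * (cmod (FT ?V (\<xi>, \<xi>')))\<^sup>2) \<partial>lborel)" for \<xi>
    proof -
      define h where "h = (\<lambda>y. FT (\<lambda>x. ?V (x, y)) \<xi>)"
      have h: "bounded_cs h" unfolding h_def by (rule bounded_cs_partial_FT(2)[OF V])
      have hs: "h y = 0" if "norm y \<ge> \<rho>" for y
      proof -
        have "v (x, y) = 0" for x
          proof -
          have "\<rho> \<le> norm (x, y)" using that norm_snd_le[of y x] by linarith
          then show ?thesis by (rule cs_indicatorD(3)[OF v])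
        qed
        then show ?thesis by (simp add: h_def FT_def)
      qed
      have hF: "FT h \<xi>' = FT ?V (\<xi>, \<xi>')" for \<xi>' unfolding h_def by (rule FT_pair(2)[OF V, symmetric])
      have "FT (cfun (section_area v)) \<xi> = FT h 0"
        unfolding FT_section_area[OF v] hF ..
      also have "\<dots> = (LINT y|lborel. h y)" by (simp add: FT_def)
      finally have "ennreal (?m \<xi> * (cmod (FT (cfun (section_area v)) \<xi>))\<^sup>2) = ennreal (?m \<xi>) * ennreal ((cmod (LINT y|lborel. h y))\<^sup>2)"
        using m0 by (simp add: ennreal_mult)
      also have "\<dots> \<le> ennreal (?m \<xi>) * (ennreal K * (\<integral>\<^sup>+\<xi>'. ennreal ((cmod (FT h \<xi>'))\<^sup>2 / (1 + (norm \<xi>')\<^sup>2)) \<partial>lborel))"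
        by (intro mult_left_mono loc h hs) auto
      also have "\<dots> = ennreal K * (\<integral>\<^sup>+\<xi>'. ennreal (?m \<xi>) * ennreal ((cmod (FT ?V (\<xi>, \<xi>')))\<^sup>2 / (1 + (norm \<xi>')\<^sup>2)) \<partial>lborel)"
        unfolding hF by (subst nn_integral_cmult) (auto simp: mult_ac)
      also have "\<dots> \<le> ennreal K * (\<integral>\<^sup>+\<xi>'. ennreal (kernel_weight \<epsilon> \<xi> \<xi>' * (cmod (FT ?V (\<xi>, \<xi>')))\<^sup>2) \<partial>lborel)"
      proof (intro mult_left_mono nn_integral_mono)
        fix \<xi>' :: 'b
        have "ennreal (?m \<xi>) * ennreal ((cmod (FT ?V (\<xi>, \<xi>')))\<^sup>2 / (1 + (norm \<xi>')\<^sup>2)) = ennreal (?m \<xi> / (1 + (norm \<xi>')\<^sup>2) * (cmod (FT ?V (\<xi>, \<xi>')))\<^sup>2)"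
          using m0[of \<xi>] by (subst ennreal_mult[symmetric]) auto
        also have "\<dots> \<le> ennreal (kernel_weight \<epsilon> \<xi> \<xi>' * (cmod (FT ?V (\<xi>, \<xi>')))\<^sup>2)"
          by (intro ennreal_leI mult_right_mono wt) auto
        finally show "ennreal (?m \<xi>) * ennreal ((cmod (FT ?V (\<xi>, \<xi>')))\<^sup>2 / (1 + (norm \<xi>')\<^sup>2)) \<le> ennreal (kernel_weight \<epsilon> \<xi> \<xi>' * (cmod (FT ?V (\<xi>, \<xi>')))\<^sup>2)" .
      qed auto
      finally show ?thesis .
    qed
    have "(\<integral>\<^sup>+\<xi>. ennreal (?m \<xi> * (cmod (FT (cfun (section_area v)) \<xi>))\<^sup>2) \<partial>lborel)
      \<le> (\<integral>\<^sup>+\<xi>. ennreal K * (\<integral>\<^sup>+\<xi>'. ennreal (kernel_weight \<epsilon> \<xi> \<xi>' * (cmod (FT ?V (\<xi>, \<xi>')))\<^sup>2) \<partial>lborel) \<partial>lborel)"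
      by (intro nn_integral_mono pt)
    also have "\<dots> = ennreal K * nonlocal \<epsilon> v"
      unfolding nonlocal_def by (rule nn_integral_cmult) measurable
    finally show ?thesis .
  qed
  from that[OF K this] show ?thesis .
qed

lemma cmod_exp_minus_one_le: "cmod (exp (- (\<i> * complex_of_real t)) - 1) \<le> \<bar>t\<bar>"
  using iexp_approx1[of "-t" 0] by simp

text \<open>
  For fixed \<open>\<xi>'\<close> the difference is a transform in \<open>x\<^sub>1\<close> alone, of a function that is bounded by a
  multiple of \<open>|\<xi>'|\<close> and vanishes outside a ball, because \<open>|exp (- \<i> (y \<bullet> \<xi>')) - 1| \<le> |y| |\<xi>'|\<close>.
  Plancherel's theorem on the line turns this into the bound.
\<close>

lemma transverse_difference_bound:
  fixes \<rho> :: real assumes \<rho>: "\<rho> > 0"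
  obtains K where "K \<ge> 0" "\<And>(v :: real \<times> 'b::euclidean_space \<Rightarrow> real) \<xi>'. cs_indicator \<rho> v \<Longrightarrow>
    (\<integral>\<^sup>+\<xi>. ennreal ((cmod (FT (cfun v) (\<xi>, \<xi>') - FT (cfun v) (\<xi>, 0)))\<^sup>2) \<partial>lborel) \<le> ennreal (K * (norm \<xi>')\<^sup>2)"
proof -
  define c where "c = (LINT y|(lborel :: 'b measure). \<rho> * indicat_real (ball 0 \<rho>) y)"
  define K where "K = 2 * pi * (c\<^sup>2 * (LINT x|lborel. 1 * indicat_real (ball (0::real) \<rho>) x))"
  have K0: "K \<ge> 0" unfolding K_def by (intro mult_nonneg_nonneg Bochner_Integration.integral_nonneg) auto
  have "(\<integral>\<^sup>+\<xi>. ennreal ((cmod (FT (cfun v) (\<xi>, \<xi>') - FT (cfun v) (\<xi>, 0)))\<^sup>2) \<partial>lborel) \<le> ennreal (K * (norm \<xi>')\<^sup>2)"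
    if v: "cs_indicator \<rho> v" for v :: "real \<times> 'b \<Rightarrow> real" and \<xi>' :: 'b
  proof -
    let ?V = "cfun v"
    have V: "bounded_cs ?V" by (rule cs_indicator_bounded_cs[OF v])
    have v01: "v p \<in> {0, 1}" and v0: "norm p \<ge> \<rho> \<Longrightarrow> v p = 0" for p
      by (rule cs_indicatorD[OF v], assumption?)+
    define g where "g = (\<lambda>x. FT (\<lambda>y. ?V (x, y)) \<xi>' - FT (\<lambda>y. ?V (x, y)) 0)"
    have g: "bounded_cs g" unfolding g_def by (intro bounded_cs_diff bounded_cs_partial_FT(1)[OF V])
    have Fg: "FT g \<xi> = FT ?V (\<xi>, \<xi>') - FT ?V (\<xi>, 0)" for \<xi>
      unfolding g_def FT_pair(1)[OF V] by (rule FT_diff) (intro bounded_cs_partial_FT(1)[OF V])+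
    have gb: "cmod (g x) \<le> c * norm \<xi>' * indicat_real (ball 0 \<rho>) x" for x
    proof -
      have "g x = (LINT y|lborel. ?V (x, y) * exp (- \<i> * complex_of_real (y \<bullet> \<xi>')) - ?V (x, y) * exp (- \<i> * complex_of_real (y \<bullet> 0)))"
        unfolding g_def FT_def
        by (rule Bochner_Integration.integral_diff[symmetric]; intro bounded_cs_integrable bounded_cs_modulate bounded_cs_slices(1)[OF V])
      then have "cmod (g x) \<le> (LINT y|lborel. cmod (?V (x, y) * exp (- \<i> * complex_of_real (y \<bullet> \<xi>')) - ?V (x, y) * exp (- \<i> * complex_of_real (y \<bullet> 0))))"
        by (simp only: integral_norm_bound)
      also have "\<dots> \<le> (LINT y|(lborel::'b measure). (norm \<xi>' * indicat_real (ball 0 \<rho>) x) * (\<rho> * indicat_real (ball 0 \<rho>) y))"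
      proof (rule integral_mono_AE')
        show "AE y in lborel. cmod (?V (x, y) * exp (- \<i> * complex_of_real (y \<bullet> \<xi>')) - ?V (x, y) * exp (- \<i> * complex_of_real (y \<bullet> 0)))
           \<le> (norm \<xi>' * indicat_real (ball 0 \<rho>) x) * (\<rho> * indicat_real (ball 0 \<rho>) y)"
        proof (rule AE_I2)
          fix y :: 'b
          have eq: "cmod (?V (x, y) * exp (- \<i> * complex_of_real (y \<bullet> \<xi>')) - ?V (x, y) * exp (- \<i> * complex_of_real (y \<bullet> 0))) = \<bar>v (x, y)\<bar> * cmod (exp (- (\<i> * complex_of_real (y \<bullet> \<xi>'))) - 1)"
            proof -
            have "?V (x, y) * exp (- \<i> * complex_of_real (y \<bullet> \<xi>')) - ?V (x, y) * exp (- \<i> * complex_of_real (y \<bullet> 0))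
               = ?V (x, y) * (exp (- (\<i> * complex_of_real (y \<bullet> \<xi>'))) - 1)" by (simp add: right_diff_distrib)
            then show ?thesis by (simp only: norm_mult norm_of_real)
          qed
          show "cmod (?V (x, y) * exp (- \<i> * complex_of_real (y \<bullet> \<xi>')) - ?V (x, y) * exp (- \<i> * complex_of_real (y \<bullet> 0)))
           \<le> (norm \<xi>' * indicat_real (ball 0 \<rho>) x) * (\<rho> * indicat_real (ball 0 \<rho>) y)"
          proof (cases "norm x < \<rho> \<and> norm y < \<rho>")
            case True
            have "\<bar>v (x, y)\<bar> * cmod (exp (- (\<i> * complex_of_real (y \<bullet> \<xi>'))) - 1) \<le> 1 * \<bar>y \<bullet> \<xi>'\<bar>"
              using v01[of "(x, y)"] by (intro mult_mono cmod_exp_minus_one_le) auto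
            also have "\<dots> \<le> norm y * norm \<xi>'" using Cauchy_Schwarz_ineq2[of y \<xi>'] by simp
            also have "\<dots> \<le> \<rho> * norm \<xi>'" using True by (intro mult_right_mono) auto
            finally show ?thesis unfolding eq using True by (simp add: mult.commute)
          next
            case False
            then have "v (x, y) = 0" using norm_snd_le[of y x] norm_fst_le[of x y] by (intro v0) auto
            then show ?thesis using \<rho> by simp
          qed
        qed
        show "integrable lborel (\<lambda>y::'b. (norm \<xi>' * indicat_real (ball 0 \<rho>) x) * (\<rho> * indicat_real (ball 0 \<rho>) y))"
          by (intro integrable_mult_right integrable_indicator_ball)
        show "AE y in (lborel::'b measure). 0 \<le> (norm \<xi>' * indicat_real (ball 0 \<rho>) x) * (\<rho> * indicat_real (ball 0 \<rho>) y)"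
          using \<rho> by (intro AE_I2 mult_nonneg_nonneg) auto
      qed
      also have "\<dots> = c * norm \<xi>' * indicat_real (ball 0 \<rho>) x"
        unfolding integral_mult_right_zero c_def by (simp add: mult_ac)
      finally show ?thesis .
    qed
    have "(\<integral>\<^sup>+\<xi>. ennreal ((cmod (FT ?V (\<xi>, \<xi>') - FT ?V (\<xi>, 0)))\<^sup>2) \<partial>lborel) = ennreal (2 * pi * (LINT x|lborel. (cmod (g x))\<^sup>2))"
      unfolding Fg[symmetric] plancherel_FT[OF g] by simp
    moreover have "(LINT x|lborel. (cmod (g x))\<^sup>2) \<le> (LINT x|(lborel::real measure). (c * norm \<xi>')\<^sup>2 * (1 * indicat_real (ball 0 \<rho>) x))"
    proof (rule integral_mono_AE')
      show "AE x in lborel. (cmod (g x))\<^sup>2 \<le> (c * norm \<xi>')\<^sup>2 * (1 * indicat_real (ball 0 \<rho>) x)"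
      proof (rule AE_I2)
        fix x show "(cmod (g x))\<^sup>2 \<le> (c * norm \<xi>')\<^sup>2 * (1 * indicat_real (ball 0 \<rho>) x)"
          using power_mono[OF gb[of x], of 2] by (cases "norm x < \<rho>") simp_all
      qed
      show "integrable lborel (\<lambda>x::real. (c * norm \<xi>')\<^sup>2 * (1 * indicat_real (ball 0 \<rho>) x))"
        by (intro integrable_mult_right integrable_indicator_ball)
    qed auto
    then have "2 * pi * (LINT x|lborel. (cmod (g x))\<^sup>2) \<le> 2 * pi * (LINT x|(lborel::real measure). (c * norm \<xi>')\<^sup>2 * (1 * indicat_real (ball 0 \<rho>) x))"
      by (rule mult_left_mono) simp
    moreover have "2 * pi * (LINT x|(lborel::real measure). (c * norm \<xi>')\<^sup>2 * (1 * indicat_real (ball 0 \<rho>) x)) = K * (norm \<xi>')\<^sup>2"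
      unfolding K_def integral_mult_right_zero by (simp add: power_mult_distrib)
    ultimately show ?thesis by (metis ennreal_leI)
  qed
  from that[OF K0 this] show ?thesis .
qed

text \<open>
  Compare the value \<open>a\<close> of the transform on the axis with its value \<open>b\<close> at \<open>\<xi>'\<close> through
  \<open>|a|\<^sup>2 \<le> 2 |b|\<^sup>2 + 2 |a - b|\<^sup>2\<close>. The kernel times \<open>|b|\<^sup>2\<close> is the energy density. In the other term the kernel
  is at most \<open>M\<^sup>2 / |\<xi>'|\<^sup>2\<close>, which cancels the factor \<open>|\<xi>'|\<^sup>2\<close> of \<open>transverse_difference_bound\<close> and leaves
  the volume of the ball.
\<close>

lemma low_frequency_bound:
  fixes \<rho> :: real assumes \<rho>: "\<rho> > 0"
  obtains K where "K \<ge> 0" "\<And>\<epsilon> M r (v :: real \<times> 'b::euclidean_space \<Rightarrow> real). \<epsilon> > 0 \<Longrightarrow> M \<ge> 0 \<Longrightarrow> r > 0 \<Longrightarrow> cs_indicator \<rho> v \<Longrightarrow>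
    (\<integral>\<^sup>+\<xi>. indicator {-M..M} \<xi> * (kernel_integral (ball (0::'b) r) \<epsilon> \<xi> *
       ennreal ((cmod (FT (cfun (section_area v)) \<xi>))\<^sup>2)) \<partial>lborel) \<le> 2 * nonlocal \<epsilon> v + ennreal (K * M\<^sup>2 * r ^ DIM('b))"
proof -
  obtain K where K: "K \<ge> 0" and diff: "\<And>(v :: real \<times> 'b \<Rightarrow> real) \<xi>'. cs_indicator \<rho> v \<Longrightarrow>
    (\<integral>\<^sup>+\<xi>. ennreal ((cmod (FT (cfun v) (\<xi>, \<xi>') - FT (cfun v) (\<xi>, 0)))\<^sup>2) \<partial>lborel) \<le> ennreal (K * (norm \<xi>')\<^sup>2)"
    using transverse_difference_bound[OF \<rho>, where 'b = 'b] by blast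
  define K' where "K' = 2 * K * unit_ball_vol (real DIM('b))"
  have K': "K' \<ge> 0" unfolding K'_def using K by simp
  have main: "(\<integral>\<^sup>+\<xi>. indicator {-M..M} \<xi> * (kernel_integral (ball (0::'b) r) \<epsilon> \<xi> *
       ennreal ((cmod (FT (cfun (section_area v)) \<xi>))\<^sup>2)) \<partial>lborel) \<le> 2 * nonlocal \<epsilon> v + ennreal (K' * M\<^sup>2 * r ^ DIM('b))"
    if \<epsilon>: "\<epsilon> > 0" and M: "M \<ge> 0" and r: "r > 0" and v: "cs_indicator \<rho> v" for \<epsilon> M r and v :: "real \<times> 'b \<Rightarrow> real"
  proof -
    let ?V = "cfun v"
    let ?B = "{x::'b. norm x < r}"
    have B: "ball (0::'b) r = ?B" by auto
    have V: "bounded_cs ?V" by (rule cs_indicator_bounded_cs[OF v])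
    then have Vm [measurable]: "?V \<in> borel_measurable borel" by (simp add: bounded_cs_def)
    define U where "U = (\<lambda>\<xi> \<xi>'. FT ?V (\<xi>, \<xi>'))"
    have Um [measurable]: "(\<lambda>(\<xi>, \<xi>'). U \<xi> \<xi>') \<in> borel_measurable (borel \<Otimes>\<^sub>M borel)"
      using FT_pair_measurable[OF Vm] unfolding U_def by (simp add: case_prod_beta')
    have FS: "FT (cfun (section_area v)) \<xi> = U \<xi> 0" for \<xi>
      unfolding U_def by (rule FT_section_area[OF v])
    have U1 [measurable]: "(\<lambda>\<xi>. U \<xi> \<xi>') \<in> borel_measurable borel" for \<xi>'
      unfolding U_def by measurable
    have U0 [measurable]: "(\<lambda>p :: real \<times> 'b. U (fst p) 0) \<in> borel_measurable (borel \<Otimes>\<^sub>M borel)"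
      by (rule measurable_compose[OF measurable_fst U1])
    define P where "P = (\<lambda>\<xi> \<xi>'. ennreal (kernel_weight \<epsilon> \<xi> \<xi>' * (cmod (U \<xi> \<xi>'))\<^sup>2))"
    define Q where "Q = (\<lambda>\<xi> \<xi>'. indicator ?B \<xi>' * ennreal (2 * M\<^sup>2 / (norm \<xi>')\<^sup>2 * (cmod (U \<xi> \<xi>' - U \<xi> 0))\<^sup>2))"
    have Pm [measurable]: "(\<lambda>(\<xi>, \<xi>'). P \<xi> \<xi>') \<in> borel_measurable (borel \<Otimes>\<^sub>M borel)"
      unfolding P_def by measurable
    have Qm [measurable]: "(\<lambda>(\<xi>, \<xi>'). Q \<xi> \<xi>') \<in> borel_measurable (borel \<Otimes>\<^sub>M borel)"
      unfolding Q_def by measurable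
    have pt: "indicator ?B \<xi>' * ennreal (kernel_weight \<epsilon> \<xi> \<xi>') * ennreal ((cmod (U \<xi> 0))\<^sup>2) \<le> 2 * P \<xi> \<xi>' + Q \<xi> \<xi>'"
      if \<xi>: "\<bar>\<xi>\<bar> \<le> M" for \<xi> \<xi>'
    proof (cases "\<xi>' \<in> ?B")
      case True
      let ?w = "kernel_weight \<epsilon> \<xi> \<xi>'"
      have w0: "?w \<ge> 0" by (rule kernel_weight_nonneg)
      have "(cmod (U \<xi> 0))\<^sup>2 \<le> (cmod (U \<xi> \<xi>') + cmod (U \<xi> \<xi>' - U \<xi> 0))\<^sup>2"
        using norm_triangle_ineq2[of "U \<xi> 0" "U \<xi> \<xi>'"] by (intro power_mono) (auto simp: norm_minus_commute)
      also have "\<dots> \<le> 2 * (cmod (U \<xi> \<xi>'))\<^sup>2 + 2 * (cmod (U \<xi> \<xi>' - U \<xi> 0))\<^sup>2"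
        using sum_squares_bound[of "cmod (U \<xi> \<xi>')" "cmod (U \<xi> \<xi>' - U \<xi> 0)"] by (simp add: power2_sum)
      finally have "?w * (cmod (U \<xi> 0))\<^sup>2 \<le> ?w * (2 * (cmod (U \<xi> \<xi>'))\<^sup>2 + 2 * (cmod (U \<xi> \<xi>' - U \<xi> 0))\<^sup>2)"
        using w0 by (rule mult_left_mono)
      also have "\<dots> = 2 * (?w * (cmod (U \<xi> \<xi>'))\<^sup>2) + 2 * ?w * (cmod (U \<xi> \<xi>' - U \<xi> 0))\<^sup>2"
        by (simp add: algebra_simps)
      also have "2 * ?w * (cmod (U \<xi> \<xi>' - U \<xi> 0))\<^sup>2 \<le> 2 * M\<^sup>2 / (norm \<xi>')\<^sup>2 * (cmod (U \<xi> \<xi>' - U \<xi> 0))\<^sup>2"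
      proof (cases "\<xi>' = 0")
        case False
        have "\<xi>\<^sup>2 \<le> M\<^sup>2" using \<xi> M by (simp add: abs_le_square_iff[symmetric])
        then have "?w \<le> M\<^sup>2 / (norm \<xi>')\<^sup>2" unfolding kernel_weight_def
          using False by (intro frac_le) auto
        then show ?thesis by (intro mult_right_mono) auto
      qed simp
      finally have "ennreal (?w * (cmod (U \<xi> 0))\<^sup>2) \<le> ennreal (2 * (?w * (cmod (U \<xi> \<xi>'))\<^sup>2) + 2 * M\<^sup>2 / (norm \<xi>')\<^sup>2 * (cmod (U \<xi> \<xi>' - U \<xi> 0))\<^sup>2)"
        by (simp add: ennreal_leI)
      also have "\<dots> = 2 * P \<xi> \<xi>' + Q \<xi> \<xi>'"
        using True w0 by (simp add: P_def Q_def ennreal_mult ennreal_plus)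
      finally show ?thesis using True w0 by (simp add: ennreal_mult)
    qed simp
    have "(\<integral>\<^sup>+\<xi>. indicator {-M..M} \<xi> * (kernel_integral (ball (0::'b) r) \<epsilon> \<xi> *
       ennreal ((cmod (FT (cfun (section_area v)) \<xi>))\<^sup>2)) \<partial>lborel)
      = (\<integral>\<^sup>+\<xi>. indicator {-M..M} \<xi> * (\<integral>\<^sup>+\<xi>'. indicator ?B \<xi>' * ennreal (kernel_weight \<epsilon> \<xi> \<xi>') * ennreal ((cmod (U \<xi> 0))\<^sup>2) \<partial>lborel) \<partial>lborel)"
      unfolding FS B
      by (intro nn_integral_cong arg_cong2[where f = "(*)"] refl nn_integral_multc[symmetric]) measurable
    also have "\<dots> \<le> (\<integral>\<^sup>+\<xi>. (\<integral>\<^sup>+\<xi>'. 2 * P \<xi> \<xi>' + Q \<xi> \<xi>' \<partial>lborel) \<partial>lborel)"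
    proof (rule nn_integral_mono)
      fix \<xi> :: real
      show "indicator {-M..M} \<xi> * (\<integral>\<^sup>+\<xi>'. indicator ?B \<xi>' * ennreal (kernel_weight \<epsilon> \<xi> \<xi>') * ennreal ((cmod (U \<xi> 0))\<^sup>2) \<partial>lborel)
         \<le> (\<integral>\<^sup>+\<xi>'. 2 * P \<xi> \<xi>' + Q \<xi> \<xi>' \<partial>lborel)"
      proof (cases "\<bar>\<xi>\<bar> \<le> M")
        case True
        then have "\<xi> \<in> {-M..M}" by auto
        then have i1: "indicator {-M..M} \<xi> = (1::ennreal)" by (rule indicator_simps(1))
        show ?thesis unfolding i1 mult_1_left by (intro nn_integral_mono pt True)
      next
        case False
        then have "\<xi> \<notin> {-M..M}" by auto
        then show ?thesis by simp
      qed
    qed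
    also have "\<dots> = (\<integral>\<^sup>+\<xi>. 2 * (\<integral>\<^sup>+\<xi>'. P \<xi> \<xi>' \<partial>lborel) + (\<integral>\<^sup>+\<xi>'. Q \<xi> \<xi>' \<partial>lborel) \<partial>lborel)"
      by (intro nn_integral_cong, subst nn_integral_add) (auto simp: nn_integral_cmult)
    also have "\<dots> = 2 * (\<integral>\<^sup>+\<xi>. (\<integral>\<^sup>+\<xi>'. P \<xi> \<xi>' \<partial>lborel) \<partial>lborel) + (\<integral>\<^sup>+\<xi>. (\<integral>\<^sup>+\<xi>'. Q \<xi> \<xi>' \<partial>lborel) \<partial>lborel)"
      by (subst nn_integral_add) (auto simp: nn_integral_cmult)
    also have "(\<integral>\<^sup>+\<xi>. (\<integral>\<^sup>+\<xi>'. P \<xi> \<xi>' \<partial>lborel) \<partial>lborel) = nonlocal \<epsilon> v"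
      unfolding nonlocal_def P_def U_def ..
    also have "(\<integral>\<^sup>+\<xi>. (\<integral>\<^sup>+\<xi>'. Q \<xi> \<xi>' \<partial>lborel) \<partial>lborel) = (\<integral>\<^sup>+\<xi>'. (\<integral>\<^sup>+\<xi>. Q \<xi> \<xi>' \<partial>lborel) \<partial>lborel)"
      by (rule lborel_pair.Fubini'[symmetric]) measurable
    also have "\<dots> \<le> (\<integral>\<^sup>+\<xi>'. ennreal (2 * M\<^sup>2 * K) * indicator ?B \<xi>' \<partial>lborel)"
    proof (rule nn_integral_mono)
      fix \<xi>' :: 'b
      have c0: "0 \<le> 2 * M\<^sup>2 / (norm \<xi>')\<^sup>2" by simp
      have "(\<integral>\<^sup>+\<xi>. Q \<xi> \<xi>' \<partial>lborel) = indicator ?B \<xi>' * (ennreal (2 * M\<^sup>2 / (norm \<xi>')\<^sup>2) * (\<integral>\<^sup>+\<xi>. ennreal ((cmod (U \<xi> \<xi>' - U \<xi> 0))\<^sup>2) \<partial>lborel))"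
        unfolding Q_def ennreal_mult[OF c0 zero_le_power2] by (simp add: nn_integral_cmult)
      also have "\<dots> \<le> indicator ?B \<xi>' * (ennreal (2 * M\<^sup>2 / (norm \<xi>')\<^sup>2) * ennreal (K * (norm \<xi>')\<^sup>2))"
        unfolding U_def by (intro mult_left_mono diff v) auto
      also have "\<dots> \<le> indicator ?B \<xi>' * ennreal (2 * M\<^sup>2 * K)"
      proof (rule mult_left_mono)
        show "ennreal (2 * M\<^sup>2 / (norm \<xi>')\<^sup>2) * ennreal (K * (norm \<xi>')\<^sup>2) \<le> ennreal (2 * M\<^sup>2 * K)"
          using K by (subst ennreal_mult[symmetric]) (auto intro!: ennreal_leI simp: divide_simps)
      qed simp
      finally show "(\<integral>\<^sup>+\<xi>. Q \<xi> \<xi>' \<partial>lborel) \<le> ennreal (2 * M\<^sup>2 * K) * indicator ?B \<xi>'"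
        by (simp only: mult.commute)
    qed
    also have "\<dots> = ennreal (K' * M\<^sup>2 * r ^ DIM('b))"
      using r K unfolding B[symmetric]
      by (subst nn_integral_cmult_indicator) (auto simp: emeasure_ball K'_def ennreal_mult[symmetric] mult_ac)
    finally show ?thesis by (simp add: add_left_mono)
  qed
  from that[OF K' main] show ?thesis .
qed

text \<open>
  For \<open>|\<xi>'| < \<epsilon> |\<xi>|\<close> the kernel is at least \<open>1 / (2 \<epsilon>\<^sup>2)\<close>.
\<close>

lemma kernel_integral_dim1:
  fixes \<xi> :: real
  assumes d: "DIM('b::euclidean_space) = 1" and \<epsilon>: "\<epsilon> > 0" and r: "\<epsilon> * \<bar>\<xi>\<bar> \<le> r"
  shows "ennreal (\<bar>\<xi>\<bar> / \<epsilon>) \<le> kernel_integral (ball (0::'b) r) \<epsilon> \<xi>"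
proof (cases "\<xi> = 0")
  case False
  let ?a = "\<epsilon> * \<bar>\<xi>\<bar>"
  have a: "?a > 0" using False \<epsilon> by simp
  have "ennreal (\<bar>\<xi>\<bar> / \<epsilon>) = ennreal (1 / (2 * \<epsilon>\<^sup>2)) * emeasure lborel (ball (0::'b) ?a)"
    using a \<epsilon> by (simp add: emeasure_ball d ennreal_mult[symmetric] power2_eq_square)
  also have "\<dots> = (\<integral>\<^sup>+\<xi>'. ennreal (1 / (2 * \<epsilon>\<^sup>2)) * indicator (ball (0::'b) ?a) \<xi>' \<partial>lborel)"
    by (subst nn_integral_cmult_indicator) auto
  also have "\<dots> \<le> kernel_integral (ball (0::'b) r) \<epsilon> \<xi>"
  proof (rule nn_integral_mono)
    fix \<xi>' :: 'b
    show "ennreal (1 / (2 * \<epsilon>\<^sup>2)) * indicator (ball 0 ?a) \<xi>' \<le> indicator (ball 0 r) \<xi>' * ennreal (kernel_weight \<epsilon> \<xi> \<xi>')"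
    proof (cases "norm \<xi>' < ?a")
      case True
      have "(norm \<xi>')\<^sup>2 \<le> ?a\<^sup>2" using True by (intro power_mono) auto
      then have "\<epsilon>\<^sup>2 * \<xi>\<^sup>2 + (norm \<xi>')\<^sup>2 \<le> 2 * \<epsilon>\<^sup>2 * \<xi>\<^sup>2" by (simp add: power_mult_distrib)
      then have "\<xi>\<^sup>2 / (2 * \<epsilon>\<^sup>2 * \<xi>\<^sup>2) \<le> kernel_weight \<epsilon> \<xi> \<xi>'"
        unfolding kernel_weight_def using False \<epsilon> by (intro divide_left_mono) (auto intro!: mult_pos_pos add_pos_nonneg)
      then have "1 / (2 * \<epsilon>\<^sup>2) \<le> kernel_weight \<epsilon> \<xi> \<xi>'" using False by simp
      then show ?thesis using True r by (simp add: ennreal_leI)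
    qed simp
  qed
  finally show ?thesis .
qed simp

text \<open>
  A layer-cake formula in place of polar coordinates. With \<open>t = max (\<epsilon> |\<xi>|) |\<xi>'|\<close> the kernel is at least
  \<open>\<xi>\<^sup>2 / (2 t\<^sup>2)\<close>, hence at least the integral of \<open>\<xi>\<^sup>2 / \<tau>\<^sup>3\<close> over \<open>\<tau>\<close> between \<open>t\<close> and \<open>r\<close>. After exchanging the
  integrals, the disc of radius \<open>\<tau>\<close> contributes its area \<open>\<pi> \<tau>\<^sup>2\<close>, and \<open>\<pi> \<xi>\<^sup>2 / \<tau>\<close> is integrated from \<open>\<epsilon> |\<xi>|\<close>
  to \<open>r\<close>.
\<close>

lemma kernel_integral_dim2:
  fixes \<xi> :: real
  assumes d: "DIM('b::euclidean_space) = 2" and \<epsilon>: "\<epsilon> > 0" and \<xi>: "\<xi> \<noteq> 0" and r: "\<epsilon> * \<bar>\<xi>\<bar> \<le> r"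
  shows "ennreal (pi * ln (r / (\<epsilon> * \<bar>\<xi>\<bar>)) * \<xi>\<^sup>2) \<le> kernel_integral (ball (0::'b) r) \<epsilon> \<xi>"
proof -
  let ?a = "\<epsilon> * \<bar>\<xi>\<bar>"
  have a: "?a > 0" using \<xi> \<epsilon> by simp
  have r0: "r > 0" using a r by simp
  have v2: "unit_ball_vol (real DIM('b)) = pi" using unit_ball_vol_numeral(1)[of Num.One] d by (simp add: unit_ball_vol_2)
  let ?f = "\<lambda>\<tau> (\<xi>'::'b). ennreal (\<xi>\<^sup>2 / \<tau> ^ 3) * indicator {?a..r} \<tau> * indicator {\<xi>'. norm \<xi>' < \<tau>} \<xi>'"
  have "ennreal (pi * ln (r / ?a) * \<xi>\<^sup>2) = ennreal (pi * \<xi>\<^sup>2 * ln r - pi * \<xi>\<^sup>2 * ln ?a)"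
    using a r0 \<xi> \<epsilon> by (simp add: ln_div algebra_simps)
  also have "\<dots> = (\<integral>\<^sup>+\<tau>. ennreal (pi * \<xi>\<^sup>2 * (1 / \<tau>)) * indicator {?a..r} \<tau> \<partial>lborel)"
    by (rule nn_integral_FTC_Icc[symmetric]) (use a r in \<open>auto intro!: derivative_eq_intros\<close>)
  also have "\<dots> = (\<integral>\<^sup>+\<tau>. (\<integral>\<^sup>+\<xi>'. ?f \<tau> \<xi>' \<partial>lborel) \<partial>lborel)"
  proof (rule nn_integral_cong)
    fix \<tau> :: real
    show "ennreal (pi * \<xi>\<^sup>2 * (1 / \<tau>)) * indicator {?a..r} \<tau> = (\<integral>\<^sup>+\<xi>'. ?f \<tau> \<xi>' \<partial>lborel)"
    proof (cases "\<tau> \<in> {?a..r}")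
      case True
      then have t: "\<tau> > 0" using a by auto
      have b: "{\<xi>'::'b. norm \<xi>' < \<tau>} = ball 0 \<tau>" by auto
      have "(\<integral>\<^sup>+\<xi>'. ?f \<tau> \<xi>' \<partial>lborel) = ennreal (\<xi>\<^sup>2 / \<tau> ^ 3) * emeasure lborel (ball (0::'b) \<tau>)"
        unfolding b using True by (subst nn_integral_cmult_indicator) auto
      also have "\<dots> = ennreal (pi * \<xi>\<^sup>2 * (1 / \<tau>))"
        using t v2 by (simp add: emeasure_ball d ennreal_mult[symmetric] power2_eq_square power3_eq_cube mult_ac)
      finally show ?thesis using True by simp
    qed simp
  qed
  also have "\<dots> = (\<integral>\<^sup>+\<xi>'. (\<integral>\<^sup>+\<tau>. ?f \<tau> \<xi>' \<partial>lborel) \<partial>lborel)"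
    by (rule lborel_pair.Fubini'[symmetric]) measurable
  also have "\<dots> \<le> kernel_integral (ball (0::'b) r) \<epsilon> \<xi>"
  proof (rule nn_integral_mono)
    fix \<xi>' :: 'b
    show "(\<integral>\<^sup>+\<tau>. ?f \<tau> \<xi>' \<partial>lborel) \<le> indicator (ball 0 r) \<xi>' * ennreal (kernel_weight \<epsilon> \<xi> \<xi>')"
    proof (cases "norm \<xi>' < r")
      case True
      let ?s = "max ?a (norm \<xi>')"
      have s: "?s > 0" "?s \<le> r" using a r True by auto
      have "(\<integral>\<^sup>+\<tau>. ?f \<tau> \<xi>' \<partial>lborel) \<le> (\<integral>\<^sup>+\<tau>. ennreal (\<xi>\<^sup>2 / \<tau> ^ 3) * indicator {?s..r} \<tau> \<partial>lborel)"
        by (intro nn_integral_mono) (auto simp: indicator_def)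
      also have "\<dots> = ennreal (- \<xi>\<^sup>2 / (2 * r\<^sup>2) - (- \<xi>\<^sup>2 / (2 * ?s\<^sup>2)))"
      proof (rule nn_integral_FTC_Icc)
        fix x assume "x \<in> {?s..r}"
        then have x: "x > 0" using s by auto
        show "((\<lambda>\<tau>. - \<xi>\<^sup>2 / (2 * \<tau>\<^sup>2)) has_real_derivative \<xi>\<^sup>2 / x ^ 3) (at x)"
          using x by (auto intro!: derivative_eq_intros simp: power2_eq_square power3_eq_cube)
        show "0 \<le> \<xi>\<^sup>2 / x ^ 3" using x by simp
      qed (use s in auto)
      also have "\<dots> \<le> ennreal (\<xi>\<^sup>2 / (2 * ?s\<^sup>2))" by (intro ennreal_leI) simp
      also have "\<dots> \<le> ennreal (kernel_weight \<epsilon> \<xi> \<xi>')"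
      proof (rule ennreal_leI)
        have "?a\<^sup>2 \<le> ?s\<^sup>2" "(norm \<xi>')\<^sup>2 \<le> ?s\<^sup>2" using a by (intro power_mono; simp)+
        then have "\<epsilon>\<^sup>2 * \<xi>\<^sup>2 + (norm \<xi>')\<^sup>2 \<le> 2 * ?s\<^sup>2" by (simp add: power_mult_distrib)
        then show "\<xi>\<^sup>2 / (2 * ?s\<^sup>2) \<le> kernel_weight \<epsilon> \<xi> \<xi>'"
          unfolding kernel_weight_def using \<xi> \<epsilon> s by (intro divide_left_mono) (auto intro!: mult_pos_pos add_pos_nonneg)
      qed
      finally show ?thesis using True by simp
    next
      case False
      then have "(\<lambda>\<tau>. ?f \<tau> \<xi>') = (\<lambda>_. 0)" by (auto simp: indicator_def fun_eq_iff)
      then show ?thesis by simp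
    qed
  qed
  finally show ?thesis .
qed

section \<open>Decay from the anisotropic variation\<close>

text \<open>
  Continuously differentiable, unlike the positive part; used twice it gives a smooth enough cutoff.
\<close>

definition pos_square :: "real \<Rightarrow> real" where "pos_square y = (max 0 y)\<^sup>2"

lemma pos_square_deriv: "(pos_square has_real_derivative 2 * max 0 y) (at y)"
proof -
  consider "y > 0" | "y < 0" | "y = 0" by linarith
  then show ?thesis
  proof cases
    case 1
    have "((\<lambda>y. y\<^sup>2) has_real_derivative 2 * max 0 y) (at y)"
      using 1 by (auto intro!: derivative_eq_intros)
    then show ?thesis
      by (rule has_field_derivative_transform_within_open[of _ _ _ "{0<..}"]) (use 1 in \<open>auto simp: pos_square_def\<close>)
  next
    case 2
    have "((\<lambda>y. 0) has_real_derivative 2 * max 0 y) (at y)"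
      using 2 by simp
    then show ?thesis
      by (rule has_field_derivative_transform_within_open[of _ _ _ "{..<0}"]) (use 2 in \<open>auto simp: pos_square_def\<close>)
  next
    case 3
    have "((\<lambda>h. (pos_square (0 + h) - pos_square 0) / h) \<longlongrightarrow> 0) (at 0)"
    proof (rule Lim_null_comparison)
      show "\<forall>\<^sub>F h in at 0. norm ((pos_square (0 + h) - pos_square 0) / h) \<le> \<bar>h\<bar>"
        by (rule always_eventually) (auto simp: pos_square_def max_def power2_eq_square)
      show "((\<lambda>h::real. \<bar>h\<bar>) \<longlongrightarrow> 0) (at 0)" by (rule tendsto_rabs_zero) (rule tendsto_ident_at)
    qed
    then show ?thesis using 3 by (simp add: DERIV_def)
  qed
qed

lemma pos_square_has_derivative:
  assumes "(f has_derivative f') (at x)"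
  shows "((\<lambda>x. pos_square (f x)) has_derivative (\<lambda>v. 2 * max 0 (f x) * f' v)) (at x)"
  using has_derivative_compose[OF assms has_field_derivative_imp_has_derivative[OF pos_square_deriv]] by simp

lemma continuous_on_pos_square [continuous_intros]:
  "continuous_on S f \<Longrightarrow> continuous_on S (\<lambda>x. pos_square (f x))"
  unfolding pos_square_def by (intro continuous_intros)

text \<open>
  Test the variation with the field \<open>(sin (\<xi> x\<^sub>1 + \<theta>) \<eta>(x), 0)\<close>, where the cutoff \<open>\<eta>\<close> is \<open>1\<close> on the ball that
  carries \<open>v\<close>. There its anisotropic divergence is \<open>\<epsilon> \<xi> cos (\<xi> x\<^sub>1 + \<theta>)\<close>.
\<close>

lemma total_variation_frequency_bound:
  fixes u v :: "real \<times> (real^'m) \<Rightarrow> real"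
  assumes \<rho>: "\<rho> > 0" and v: "cs_indicator \<rho> v" and eq: "AE x in lborel. u x = v x"
    and TV: "aniso_variation \<epsilon> u \<le> ennreal C" and C: "C \<ge> 0"
  shows "\<epsilon> * \<xi> * (LINT x|lborel. v x * cos (\<xi> * fst x + \<theta>)) \<le> C"
proof -
  let ?a = "\<lambda>x :: real \<times> (real^'m). x \<bullet> x / \<rho>\<^sup>2 - 1"
  define \<eta> where "\<eta> = (\<lambda>x :: real \<times> (real^'m). pos_square (1 - pos_square (?a x)))"
  define D\<eta> where "D\<eta> = (\<lambda>(x :: real \<times> (real^'m)) w. 2 * max 0 (1 - pos_square (?a x)) * - (2 * max 0 (?a x) * (2 * (x \<bullet> w) / \<rho>\<^sup>2)))"
  define \<phi> where "\<phi> = (\<lambda>x :: real \<times> (real^'m). (sin (\<xi> * fst x + \<theta>) * \<eta> x, 0 :: real^'m))"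
  define D where "D = (\<lambda>(x :: real \<times> (real^'m)) w. (sin (\<xi> * fst x + \<theta>) * D\<eta> x w + cos (\<xi> * fst x + \<theta>) * (\<xi> * fst w) * \<eta> x, 0 :: real^'m))"
  have a': "(?a has_derivative (\<lambda>w. 2 * (x \<bullet> w) / \<rho>\<^sup>2)) (at x)" for x
    proof -
    have "((\<lambda>x. x \<bullet> x * c - 1) has_derivative (\<lambda>w. 2 * (x \<bullet> w) * c)) (at x)" for c
      by (auto intro!: derivative_eq_intros simp: inner_commute)
    from this[of "1 / \<rho>\<^sup>2"] show ?thesis by simp
  qed
  have \<eta>': "(\<eta> has_derivative D\<eta> x) (at x)" for x
  proof -
    have "((\<lambda>x. 1 - pos_square (?a x)) has_derivative (\<lambda>w. - (2 * max 0 (?a x) * (2 * (x \<bullet> w) / \<rho>\<^sup>2)))) (at x)"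
      using has_derivative_diff[OF has_derivative_const pos_square_has_derivative[OF a'], of 1 x] by simp
    from pos_square_has_derivative[OF this] show ?thesis unfolding \<eta>_def D\<eta>_def .
  qed
  have s': "((\<lambda>x :: real \<times> (real^'m). sin (\<xi> * fst x + \<theta>)) has_derivative (\<lambda>w. cos (\<xi> * fst x + \<theta>) * (\<xi> * fst w))) (at x)" for x
    by (auto intro!: derivative_eq_intros)
  have \<phi>': "(\<phi> has_derivative D x) (at x)" for x
    unfolding \<phi>_def D_def by (intro has_derivative_Pair has_derivative_mult s' \<eta>' has_derivative_const)
  have fd: "frechet_derivative \<phi> (at x) = D x" for x
    using frechet_derivative_at[OF \<phi>'] by simp
  have \<eta>01: "0 \<le> \<eta> x" "\<eta> x \<le> 1" for x
    unfolding \<eta>_def pos_square_def by (auto intro!: power_le_one)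
  have \<eta>far: "\<eta> x = 0" if "norm x > 2 * \<rho>" for x
  proof -
    have "(2 * \<rho>)\<^sup>2 \<le> (norm x)\<^sup>2" using that \<rho> by (intro power_mono) auto
    then have "4 * \<rho>\<^sup>2 \<le> x \<bullet> x" by (simp add: power_mult_distrib power2_norm_eq_inner)
    then have "?a x \<ge> 3" using \<rho> by (simp add: pos_le_divide_eq)
    then have "pos_square (?a x) \<ge> 3\<^sup>2" unfolding pos_square_def by (intro power_mono) auto
    then show ?thesis unfolding \<eta>_def by (simp add: pos_square_def[of "1 - _"])
  qed
  have near: "\<eta> x = 1 \<and> D\<eta> x w = 0" if "norm x < \<rho>" for x w
  proof -
    have "(norm x)\<^sup>2 \<le> \<rho>\<^sup>2" using that by (intro power_mono) auto
    then have "?a x \<le> 0" using \<rho> by (simp add: power2_norm_eq_inner pos_divide_le_eq)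
    then show ?thesis unfolding \<eta>_def D\<eta>_def pos_square_def by simp
  qed
  have \<phi>C1: "\<phi> \<in> C1_compact"
    unfolding C1_compact_def
  proof (intro CollectI conjI allI)
    show "\<phi> differentiable at x" for x using \<phi>' unfolding differentiable_def by blast
    show "continuous_on UNIV (\<lambda>x. frechet_derivative \<phi> (at x) w)" for w
      unfolding fd D_def D\<eta>_def \<eta>_def by (intro continuous_intros) (use \<rho> in auto)
    have "{x. \<phi> x \<noteq> 0} \<subseteq> cball 0 (2 * \<rho>)"
    proof (rule subsetI, rule ccontr)
      fix x assume x: "x \<in> {x. \<phi> x \<noteq> 0}" "x \<notin> cball 0 (2 * \<rho>)"
      then have "\<eta> x = 0" by (intro \<eta>far) simp
      then show False using x by (simp add: \<phi>_def zero_prod_def)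
    qed
    then show "compact (closure {x. \<phi> x \<noteq> 0})"
      by (simp add: compact_closure bounded_subset[OF bounded_cball])
  qed
  have \<phi>1: "norm (\<phi> x) \<le> 1" for x
    using mult_mono[of "\<bar>sin (\<xi> * fst x + \<theta>)\<bar>" 1 "\<bar>\<eta> x\<bar>" 1] \<eta>01[of x] by (simp add: \<phi>_def norm_Pair abs_mult)
  have div: "aniso_div \<epsilon> \<phi> x = \<epsilon> * (sin (\<xi> * fst x + \<theta>) * D\<eta> x (1, 0) + cos (\<xi> * fst x + \<theta>) * \<xi> * \<eta> x)" for x
    unfolding aniso_div_def fd D_def by simp
  let ?w = "\<lambda>x. v x * (\<epsilon> * \<xi> * cos (\<xi> * fst x + \<theta>))"
  have vm [measurable]: "v \<in> borel_measurable borel" by (rule cs_indicatorD(1)[OF v])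
  have cm [measurable]: "(\<lambda>x :: real \<times> (real^'m). cos (\<xi> * fst x + \<theta>)) \<in> borel_measurable borel"
    by (intro borel_measurable_continuous_onI continuous_intros)
  have wm: "?w \<in> borel_measurable borel" by measurable
  have ae: "AE x in lborel. u x * aniso_div \<epsilon> \<phi> x = ?w x"
    using eq
  proof eventually_elim
    case (elim x)
    show ?case
    proof (cases "norm x < \<rho>")
      case True
      then show ?thesis using near[OF True] by (simp add: elim div)
    next
      case False
      then have "v x = 0" by (intro cs_indicatorD(3)[OF v]) simp
      then show ?thesis by (simp add: elim)
    qed
  qed
  have "(LINT x|lebesgue. u x * aniso_div \<epsilon> \<phi> x) = (LINT x|lebesgue. ?w x)"
    by (rule integral_cong_AE[OF borel_measurable_lebesgue_AE[OF wm ae] _ AE_completion[OF ae]])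
       (use wm in \<open>auto intro: measurable_completion\<close>)
  also have "\<dots> = (LINT x|lborel. ?w x)" using wm by (intro integral_completion) simp
  also have "\<dots> = \<epsilon> * \<xi> * (LINT x|lborel. v x * cos (\<xi> * fst x + \<theta>))"
    by (subst integral_mult_right_zero[symmetric]) (simp add: mult_ac)
  finally have I: "(LINT x|lebesgue. u x * aniso_div \<epsilon> \<phi> x) = \<epsilon> * \<xi> * (LINT x|lborel. v x * cos (\<xi> * fst x + \<theta>))" .
  have "ennreal (LINT x|lebesgue. u x * aniso_div \<epsilon> \<phi> x) \<le> aniso_variation \<epsilon> u"
    unfolding aniso_variation_def by (rule SUP_upper) (use \<phi>C1 \<phi>1 in auto)
  also note TV
  finally show ?thesis unfolding I using C by (simp add: ennreal_le_iff)
qed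

text \<open>
  The phases \<open>0\<close> and \<open>\<pi>/2\<close> give the real and the imaginary part of the transform, and adding \<open>\<pi>\<close> to the
  phase reverses the sign.
\<close>

lemma FT_section_area_decay:
  fixes u v :: "real \<times> (real^'m) \<Rightarrow> real"
  assumes \<rho>: "\<rho> > 0" and v: "cs_indicator \<rho> v" and eq: "AE x in lborel. u x = v x"
    and TV: "aniso_variation \<epsilon> u \<le> ennreal C" and C: "C \<ge> 0" and \<epsilon>: "\<epsilon> > 0"
  shows "\<epsilon> * \<bar>\<xi>\<bar> * cmod (FT (cfun (section_area v)) \<xi>) \<le> 2 * C"
proof -
  note B = total_variation_frequency_bound[OF \<rho> v eq TV C, of \<xi>]
  let ?V = "cfun v"
  let ?F = "FT (cfun (section_area v)) \<xi>"
  let ?I = "\<lambda>\<theta>. LINT x|lborel. v x * cos (\<xi> * fst x + \<theta>)"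
  have V: "bounded_cs ?V" by (rule cs_indicator_bounded_cs[OF v])
  have i: "integrable lborel (\<lambda>x. ?V x * exp (- \<i> * complex_of_real (x \<bullet> (\<xi>, 0))))"
    by (intro bounded_cs_integrable bounded_cs_modulate V)
  have F: "?F = (LINT x|lborel. ?V x * exp (- \<i> * complex_of_real (x \<bullet> (\<xi>, 0))))"
    unfolding FT_section_area[OF v] by (simp add: FT_def)
  have e: "exp (- \<i> * complex_of_real t) = Complex (cos t) (- sin t)" for t
    using exp_Euler[of "- complex_of_real t"] by (simp add: complex_eq_iff exp_minus cis_conv_exp[symmetric] flip: cis_cnj)
  have ip: "x \<bullet> (\<xi>, 0 :: real^'m) = \<xi> * fst x" for x :: "real \<times> (real^'m)"
    by (cases x) simp
  have "Re ?F = (LINT x|lborel. Re (?V x * exp (- \<i> * complex_of_real (x \<bullet> (\<xi>, 0)))))"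
    unfolding F by (rule integral_Re[OF i, symmetric])
  also have "\<dots> = ?I 0" unfolding e ip by simp
  finally have re: "Re ?F = ?I 0" .
  have "Im ?F = (LINT x|lborel. Im (?V x * exp (- \<i> * complex_of_real (x \<bullet> (\<xi>, 0)))))"
    unfolding F by (rule integral_Im[OF i, symmetric])
  also have "\<dots> = ?I (pi / 2)" unfolding e ip by (simp add: minus_sin_cos_eq)
  finally have im: "Im ?F = ?I (pi / 2)" .
  have npi: "?I (\<theta> + pi) = - ?I \<theta>" for \<theta>
    by (simp add: add.assoc[symmetric])
  have ab: "\<bar>\<epsilon> * \<xi> * ?I \<theta>\<bar> \<le> C" for \<theta>
    using B[of \<theta>] B[of "\<theta> + pi"] unfolding npi by simp
  have "\<epsilon> * \<bar>\<xi>\<bar> * cmod ?F \<le> \<epsilon> * \<bar>\<xi>\<bar> * (\<bar>Re ?F\<bar> + \<bar>Im ?F\<bar>)"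
    using \<epsilon> by (intro mult_left_mono cmod_le) auto
  also have "\<dots> = \<bar>\<epsilon> * \<xi> * ?I 0\<bar> + \<bar>\<epsilon> * \<xi> * ?I (pi / 2)\<bar>"
    unfolding re im using \<epsilon> by (simp add: abs_mult distrib_left)
  also have "\<dots> \<le> C + C" by (intro add_mono ab)
  finally show ?thesis by simp
qed

section \<open>The logarithmic prefactor\<close>

text \<open>
  In terms of \<open>t = ln \<mu>\<close> the equation for \<open>\<mu>\<close> reads \<open>t + 3 ln t = 7 |ln \<epsilon>|\<close>, so that the prefactor is
  \<open>1 / t\<close>. The left-hand side is increasing, is \<open>1\<close> at \<open>t = 1\<close> and at least \<open>7 |ln \<epsilon>|\<close> at \<open>t = 7 |ln \<epsilon>|\<close>.
\<close>

lemma prefactor_dim3: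
  assumes \<epsilon>: "0 < \<epsilon>" "\<epsilon> \<le> exp (-1)"
  shows "1 / (7 * - ln \<epsilon>) \<le> prefactor 3 \<epsilon>" "prefactor 3 \<epsilon> \<le> 1" "- ln \<epsilon> \<ge> 1"
proof -
  define l where "l = - ln \<epsilon>"
  have l: "l \<ge> 1" using \<epsilon> ln_mono[of \<epsilon> "exp (-1)"] by (simp add: l_def)
  have eps: "\<epsilon> = exp (- l)" using \<epsilon> by (simp add: l_def)
  let ?f = "\<lambda>t. t + 3 * ln t"
  have "\<exists>t\<ge>1. t \<le> 7 * l \<and> ?f t = 7 * l"
    by (rule IVT') (use l in \<open>auto intro!: continuous_intros simp: ln_ge_zero\<close>)
  then obtain t where t: "1 \<le> t" "t \<le> 7 * l" "?f t = 7 * l" by blast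
  have inj: "t' = t" if "t' > 0" "?f t' = 7 * l" for t'
  proof (rule ccontr)
    assume "t' \<noteq> t"
    then consider "t' < t" | "t < t'" by linarith
    then show False
    proof cases
      case 1
      then have "ln t' < ln t" using that t by simp
      then show False using 1 that t by linarith
    next
      case 2
      then have "ln t < ln t'" using that t by simp
      then show False using 2 that t by linarith
    qed
  qed
  have ch: "m powr (- 1 / 7) * (ln m) powr (- 3 / 7) = exp (- (?f (ln m)) / 7)" if "m > 1" for m :: real
  proof -
    have "ln m > 0" "m > 0" using that by auto
    then have "m powr (- 1 / 7) * (ln m) powr (- 3 / 7) = exp ((- 1 / 7) * ln m + (- 3 / 7) * ln (ln m))"
      by (simp only: powr_def exp_add if_False less_imp_neq[THEN not_sym])
    then show ?thesis by (simp add: field_simps)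
  qed
  have "mu \<epsilon> = exp t"
    unfolding mu_def
  proof (rule the_equality)
    show "exp t > 1 \<and> \<epsilon> = exp t powr (- 1 / 7) * (ln (exp t)) powr (- 3 / 7)"
      using t ch[of "exp t"] by (simp add: eps)
    fix m assume m: "m > 1 \<and> \<epsilon> = m powr (- 1 / 7) * (ln m) powr (- 3 / 7)"
    then have "exp (- l) = exp (- (?f (ln m)) / 7)" using ch eps by simp
    then have "?f (ln m) = 7 * l" by simp
    then have "ln m = t" using m by (intro inj) auto
    then show "m = exp t" using m by auto
  qed
  then have "prefactor 3 \<epsilon> = 1 / t"
    using t l by (simp add: prefactor_def l_def[symmetric] flip: abs_minus_cancel[of "ln \<epsilon>"])
  moreover have "1 / (7 * l) \<le> 1 / t" using t by (intro divide_left_mono) auto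
  moreover have "1 / t \<le> 1" using t by simp
  ultimately show "1 / (7 * - ln \<epsilon>) \<le> prefactor 3 \<epsilon>" "prefactor 3 \<epsilon> \<le> 1" "- ln \<epsilon> \<ge> 1"
    using l by (simp_all add: l_def)
qed

section \<open>A uniform fractional Sobolev bound\<close>

text \<open>
  The Fourier weight of the regularity that is obtained for the limit: \<open>H\<^sup>1\<^sup>/\<^sup>2\<close> for \<open>n = 2\<close>, and \<open>H\<^sup>1\<close>
  otherwise, which for \<open>n = 4\<close> is smaller than the limit space.
\<close>

definition freq_weight :: "nat \<Rightarrow> real \<Rightarrow> real" where
  "freq_weight n \<xi> = (if n = 2 then \<bar>\<xi>\<bar> else \<xi>\<^sup>2)"

text \<open>
  Up to this frequency the transform may be replaced by its value on the axis at bounded cost. The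
  error of \<open>low_frequency_bound\<close> is \<open>M\<^sup>2 r\<^bsup>n-1\<^esup>\<close> times the prefactor. For \<open>n = 2\<close> the kernel needs
  \<open>r = \<epsilon> M\<close>, and \<open>\<epsilon>\<^sup>2 M\<^sup>3 = 1\<close> is the largest choice. For \<open>n = 3\<close> any small power would do: \<open>M\<close> must beat
  \<open>|ln \<epsilon>|\<close>, while \<open>ln (r / (\<epsilon> M))\<close> has to stay comparable to it.
\<close>

definition freq_cutoff :: "nat \<Rightarrow> real \<Rightarrow> real" where
  "freq_cutoff n \<epsilon> = (if n = 2 then \<epsilon> powr (- 2 / 3) else if n = 3 then \<epsilon> powr (- 1 / 4) else 1 / \<epsilon>)"

lemma exp_minus_one_less: "exp (-1) < (1::real)" by simp

lemma freq_cutoff_ge_1: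
  assumes "0 < \<epsilon>" "\<epsilon> \<le> exp (-1)" shows "freq_cutoff n \<epsilon> \<ge> 1"
proof -
  have e1: "\<epsilon> \<le> 1" using assms exp_minus_one_less by linarith
  have "1 \<le> \<epsilon> powr (- a)" if "a \<ge> 0" for a
    using powr_mono'[of 0 "a" \<epsilon>] assms(1) e1 that by (simp add: powr_minus divide_simps)
  from this[of "2/3"] this[of "1/4"] show ?thesis using assms(1) e1 by (simp add: freq_cutoff_def)
qed

text \<open>
  For \<open>|\<xi>| \<le> 1\<close> the summand \<open>1\<close> suffices. Otherwise, below the cutoff the weight of the limit space is larger than \<open>|\<xi>|\<^bsup>1/4\<^esup>\<close>, between the
  cutoff and \<open>1 / \<epsilon>\<close> the prefactor times \<open>\<xi>\<^sup>2\<close> is, and between \<open>1 / \<epsilon>\<close> and \<open>1 / \<epsilon>\<^sup>4\<close> the prefactor times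
  \<open>1 / \<epsilon>\<^sup>2\<close>. The constant comes from \<open>n = 3\<close>, where \<open>7 |ln \<epsilon>| \<le> 7 * 4 \<epsilon>\<^bsup>-1/4\<^esup>\<close>.
\<close>

lemma frequency_interpolation:
  assumes n: "n \<in> {2, 3, 4}" and \<epsilon>: "0 < \<epsilon>" "\<epsilon> \<le> exp (-1)" and \<xi>: "\<bar>\<xi>\<bar> \<le> \<epsilon> powr (- 4)"
  shows "\<bar>\<xi>\<bar> powr (1/4) \<le> 1 + indicator {- freq_cutoff n \<epsilon>..freq_cutoff n \<epsilon>} \<xi> * freq_weight n \<xi>
     + 28 * (prefactor n \<epsilon> * min (\<xi>\<^sup>2) (1 / \<epsilon>\<^sup>2))"
proof -
  let ?M = "freq_cutoff n \<epsilon>" and ?g = "prefactor n \<epsilon>"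
  have e1: "\<epsilon> < 1" using \<epsilon> exp_minus_one_less by linarith
  have g0: "?g \<ge> \<epsilon> / 7"
  proof -
    consider "n = 2" | "n = 3" | "n = 4" using n by auto
    then show ?thesis
    proof cases
      case 2
      have "- ln \<epsilon> \<le> 1 / \<epsilon>" using ln_le_minus_one[of "1 / \<epsilon>"] \<epsilon> by (simp add: ln_div)
      then have "7 * - ln \<epsilon> \<le> 7 / \<epsilon>" by simp
      then have "1 / (7 / \<epsilon>) \<le> 1 / (7 * - ln \<epsilon>)"
        by (intro divide_left_mono mult_pos_pos) (use prefactor_dim3(3)[OF \<epsilon>] \<epsilon> e1 in auto)
      then show ?thesis using prefactor_dim3(1)[OF \<epsilon>] 2 by simp
    qed (use e1 \<epsilon> in \<open>auto simp: prefactor_def\<close>)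
  qed
  have gm: "0 \<le> ?g * min (\<xi>\<^sup>2) (1 / \<epsilon>\<^sup>2)" using g0 \<epsilon> by (intro mult_nonneg_nonneg) (auto intro: order_trans[of _ "\<epsilon> / 7"])
  have w0: "0 \<le> indicator {- ?M..?M} \<xi> * freq_weight n \<xi>" by (simp add: freq_weight_def)
  show ?thesis
  proof (cases "\<bar>\<xi>\<bar> \<le> 1")
    case True
    then have "\<bar>\<xi>\<bar> powr (1/4) \<le> 1" by (simp add: powr_le1)
    then show ?thesis using gm w0 by linarith
  next
    case False
    then have x1: "\<bar>\<xi>\<bar> > 1" by simp
    have pm: "\<bar>\<xi>\<bar> powr a \<le> \<bar>\<xi>\<bar> powr b" if "a \<le> b" for a b
      using x1 that by (intro powr_mono) auto
    have p1: "\<bar>\<xi>\<bar> powr 1 = \<bar>\<xi>\<bar>" using x1 by simp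
    have p2: "\<bar>\<xi>\<bar> powr 2 = \<xi>\<^sup>2" using x1 by (simp add: powr_numeral)
    consider (low) "\<bar>\<xi>\<bar> \<le> ?M" | (mid) "?M < \<bar>\<xi>\<bar>" "\<bar>\<xi>\<bar> \<le> 1 / \<epsilon>" | (high) "1 / \<epsilon> < \<bar>\<xi>\<bar>" by linarith
    then show ?thesis
    proof cases
      case low
      then have "\<xi> \<in> {- ?M..?M}" by auto
      moreover have "\<bar>\<xi>\<bar> powr (1/4) \<le> freq_weight n \<xi>"
        using pm[of "1/4" 1] pm[of "1/4" 2] p1 p2 by (simp add: freq_weight_def)
      ultimately show ?thesis using gm by simp
    next
      case mid
      have "\<xi>\<^sup>2 \<le> (1 / \<epsilon>)\<^sup>2" using mid \<epsilon> by (simp add: abs_le_square_iff[symmetric])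
      then have mn: "min (\<xi>\<^sup>2) (1 / \<epsilon>\<^sup>2) = \<xi>\<^sup>2" by (simp add: power_divide)
      have "\<bar>\<xi>\<bar> powr (1/4) \<le> 28 * (?g * \<xi>\<^sup>2)"
      proof -
        consider "n = 2" | "n = 3" | "n = 4" using n by auto
        then show ?thesis
        proof cases
          case 1
          have "\<epsilon> powr (- 2 / 3) \<le> \<bar>\<xi>\<bar>" using mid 1 by (simp add: freq_cutoff_def)
          then have "\<bar>\<xi>\<bar> powr (- 3 / 2) \<le> (\<epsilon> powr (- 2 / 3)) powr (- 3 / 2)"
            using \<epsilon> by (intro powr_mono2') auto
          also have "\<dots> = \<epsilon>" using \<epsilon> by (simp add: powr_powr)
          finally have "\<bar>\<xi>\<bar> powr (- 3 / 2) * \<xi>\<^sup>2 \<le> \<epsilon> * \<xi>\<^sup>2" by (rule mult_right_mono) simp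
          moreover have "\<bar>\<xi>\<bar> powr (- 3 / 2) * \<xi>\<^sup>2 = \<bar>\<xi>\<bar> powr (1 / 2)"
            unfolding p2[symmetric] powr_add[symmetric] by simp
          ultimately have "\<bar>\<xi>\<bar> powr (1 / 4) \<le> \<epsilon> * \<xi>\<^sup>2" using pm[of "1/4" "1/2"] by linarith
          moreover have g: "?g = \<epsilon>" using 1 by (simp add: prefactor_def)
          moreover have "0 \<le> \<epsilon> * \<xi>\<^sup>2" using \<epsilon> by simp
          ultimately show ?thesis unfolding g by linarith
        next
          case 2
          let ?y = "\<epsilon> powr (- 1 / 4)"
          have y0: "?y > 0" using \<epsilon> by simp
          have "ln ?y \<le> ?y" using ln_le_minus_one[OF y0] by linarith
          then have "- ln \<epsilon> \<le> 4 * ?y" using \<epsilon> by (simp add: ln_powr)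
          also have "\<dots> \<le> 4 * \<bar>\<xi>\<bar>" using mid 2 by (simp add: freq_cutoff_def)
          finally have "7 * - ln \<epsilon> \<le> 28 * \<bar>\<xi>\<bar>" by simp
          then have "1 / (28 * \<bar>\<xi>\<bar>) \<le> 1 / (7 * - ln \<epsilon>)"
            by (intro divide_left_mono mult_pos_pos) (use prefactor_dim3(3)[OF \<epsilon>] x1 \<epsilon> e1 in auto)
          then have "1 / (28 * \<bar>\<xi>\<bar>) \<le> ?g" using prefactor_dim3(1)[OF \<epsilon>] 2 by simp
          then have "1 / (28 * \<bar>\<xi>\<bar>) * (28 * \<xi>\<^sup>2) \<le> ?g * (28 * \<xi>\<^sup>2)" by (rule mult_right_mono) simp
          moreover have "1 / (28 * \<bar>\<xi>\<bar>) * (28 * \<xi>\<^sup>2) = \<bar>\<xi>\<bar>"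
            proof -
            have "\<xi>\<^sup>2 = \<bar>\<xi>\<bar> * \<bar>\<xi>\<bar>" by (simp add: power2_eq_square)
            then show ?thesis using x1 by (simp del: abs_mult_self_eq)
          qed
          ultimately show ?thesis using pm[of "1/4" 1] p1 by linarith
        next
          case 3
          then show ?thesis using mid by (simp add: freq_cutoff_def)
        qed
      qed
      then show ?thesis using w0 unfolding mn by linarith
    next
      case high
      have "(1 / \<epsilon>)\<^sup>2 \<le> \<xi>\<^sup>2" using high \<epsilon> by (simp add: abs_le_square_iff[symmetric])
      then have mn: "min (\<xi>\<^sup>2) (1 / \<epsilon>\<^sup>2) = 1 / \<epsilon>\<^sup>2" by (simp add: power_divide)
      have "\<bar>\<xi>\<bar> powr (1/4) \<le> (\<epsilon> powr (- 4)) powr (1/4)" using \<xi> by (intro powr_mono2) auto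
      also have "(\<epsilon> powr (- 4)) powr (1/4) = 1 / \<epsilon>"
      proof -
        have "(\<epsilon> powr (- 4)) powr (1/4) = \<epsilon> powr (- 4 * (1/4))" by (rule powr_powr)
        also have "- 4 * (1/4) = (- 1 :: real)" by simp
        also have "\<epsilon> powr (- 1) = 1 / \<epsilon> powr 1" by (rule powr_minus_divide)
        also have "\<epsilon> powr 1 = \<epsilon>" using \<epsilon> by (intro powr_one) simp
        finally show ?thesis .
      qed
      also have "\<dots> \<le> 28 * (\<epsilon> / 7 * (1 / \<epsilon>\<^sup>2))" using \<epsilon> by (simp add: power2_eq_square divide_simps)
      also have "\<dots> \<le> 28 * (?g * (1 / \<epsilon>\<^sup>2))" by (intro mult_left_mono mult_right_mono g0) auto
      finally show ?thesis using w0 unfolding mn by linarith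
    qed
  qed
qed

lemma tail_integral_finite:
  "(\<integral>\<^sup>+\<xi>. ennreal (indicator {\<xi>. 1 \<le> \<bar>\<xi>\<bar>} \<xi> * \<bar>\<xi>\<bar> powr (- 5 / 4)) \<partial>(lborel :: real measure)) < \<infinity>"
proof -
  let ?g = "\<lambda>x::real. ennreal (x powr (- 5 / 4)) * indicator {1..} x"
  have l: "((\<lambda>x::real. - 4 * x powr (- 1 / 4)) \<longlongrightarrow> - 4 * 0) at_top"
    by (intro tendsto_intros tendsto_neg_powr filterlim_ident) simp
  have "(\<integral>\<^sup>+x. ?g x \<partial>lborel) = ennreal (- 4 * 0 - - 4 * 1 powr (- 1 / 4))"
    by (rule nn_integral_FTC_atLeast[OF _ _ _ l]) (auto intro!: derivative_eq_intros)
  then have fin: "(\<integral>\<^sup>+x. ?g x \<partial>lborel) < \<infinity>" by simp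
  have "(\<integral>\<^sup>+x. ?g x \<partial>lborel) = ennreal \<bar>-1\<bar> * (\<integral>\<^sup>+x. ?g (0 + - 1 * x) \<partial>lborel)"
    by (rule nn_integral_real_affine) auto
  then have fin': "(\<integral>\<^sup>+x. ?g (- x) \<partial>lborel) < \<infinity>" using fin by simp
  have "(\<integral>\<^sup>+\<xi>. ennreal (indicator {\<xi>. 1 \<le> \<bar>\<xi>\<bar>} \<xi> * \<bar>\<xi>\<bar> powr (- 5 / 4)) \<partial>(lborel :: real measure)) \<le> (\<integral>\<^sup>+x. ?g x + ?g (- x) \<partial>lborel)"
    by (rule nn_integral_mono) (auto simp: indicator_def)
  also have "\<dots> = (\<integral>\<^sup>+x. ?g x \<partial>lborel) + (\<integral>\<^sup>+x. ?g (- x) \<partial>lborel)"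
    by (rule nn_integral_add) auto
  also have "\<dots> < \<infinity>" using fin fin' by (simp add: ennreal_add_less_top)
  finally show ?thesis .
qed

text \<open>
  Up to the cutoff, the prefactor times the integral of the kernel over a ball of suitable radius
  dominates the weight of the limit space. For \<open>n = 4\<close> the cutoff is \<open>1 / \<epsilon>\<close>, and
  \<open>high_frequency_bound\<close> already gives the claim.
\<close>

lemma low_frequency_weighted_bound:
  fixes \<rho> :: real assumes \<rho>: "\<rho> > 0" and d: "CARD('m::finite) + 1 = n" and n: "n \<in> {2, 3, 4}"
  obtains K where "K \<ge> 0" "\<And>\<epsilon> C (v :: real \<times> (real^'m) \<Rightarrow> real). 0 < \<epsilon> \<Longrightarrow> \<epsilon> \<le> exp (-1) \<Longrightarrow> cs_indicator \<rho> v \<Longrightarrow> C \<ge> 0 \<Longrightarrow>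
    ennreal (prefactor n \<epsilon>) * nonlocal \<epsilon> v \<le> ennreal C \<Longrightarrow>
    (\<integral>\<^sup>+\<xi>. ennreal (indicator {- freq_cutoff n \<epsilon>..freq_cutoff n \<epsilon>} \<xi> * freq_weight n \<xi> *
       (cmod (FT (cfun (section_area v)) \<xi>))\<^sup>2) \<partial>lborel) \<le> ennreal (K * (C + 1))"
proof -
  obtain K1 where K1: "K1 \<ge> 0" and low: "\<And>\<epsilon> M r (v :: real \<times> (real^'m) \<Rightarrow> real). \<epsilon> > 0 \<Longrightarrow> M \<ge> 0 \<Longrightarrow> r > 0 \<Longrightarrow> cs_indicator \<rho> v \<Longrightarrow>
    (\<integral>\<^sup>+\<xi>. indicator {-M..M} \<xi> * (kernel_integral (ball (0::real^'m) r) \<epsilon> \<xi> *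
       ennreal ((cmod (FT (cfun (section_area v)) \<xi>))\<^sup>2)) \<partial>lborel) \<le> 2 * nonlocal \<epsilon> v + ennreal (K1 * M\<^sup>2 * r ^ DIM(real^'m))"
    using low_frequency_bound[OF \<rho>, where 'b = "real^'m"] by blast
  obtain K2 where K2: "K2 \<ge> 0" and high: "\<And>\<epsilon> (v :: real \<times> (real^'m) \<Rightarrow> real). \<epsilon> > 0 \<Longrightarrow> cs_indicator \<rho> v \<Longrightarrow>
    (\<integral>\<^sup>+\<xi>. ennreal (min (\<xi>\<^sup>2) (1 / \<epsilon>\<^sup>2) * (cmod (FT (cfun (section_area v)) \<xi>))\<^sup>2) \<partial>lborel) \<le> ennreal K2 * nonlocal \<epsilon> v"
    using high_frequency_bound[OF \<rho>, where 'b = "real^'m"] by blast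
  define K where "K = 28 * (2 + K1 + K2)"
  have K0: "K \<ge> 0" using K1 K2 by (simp add: K_def)
  have main: "(\<integral>\<^sup>+\<xi>. ennreal (indicator {- freq_cutoff n \<epsilon>..freq_cutoff n \<epsilon>} \<xi> * freq_weight n \<xi> *
       (cmod (FT (cfun (section_area v)) \<xi>))\<^sup>2) \<partial>lborel) \<le> ennreal (K * (C + 1))"
    if \<epsilon>: "0 < \<epsilon>" "\<epsilon> \<le> exp (-1)" and v: "cs_indicator \<rho> v" and C: "C \<ge> 0"
      and N: "ennreal (prefactor n \<epsilon>) * nonlocal \<epsilon> v \<le> ennreal C" for \<epsilon> C and v :: "real \<times> (real^'m) \<Rightarrow> real"
  proof -
    let ?M = "freq_cutoff n \<epsilon>" and ?g = "prefactor n \<epsilon>"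
    let ?F = "\<lambda>\<xi>. (cmod (FT (cfun (section_area v)) \<xi>))\<^sup>2"
    have e1: "\<epsilon> < 1" using \<epsilon> exp_minus_one_less by linarith
    have M1: "?M \<ge> 1" by (rule freq_cutoff_ge_1[OF \<epsilon>])
    have [measurable]: "(cfun (section_area v)) \<in> borel_measurable borel"
      using section_area_bounded_cs[OF v] by (simp add: bounded_cs_def)
    \<comment> \<open>For \<open>n = 2\<close> and \<open>n = 3\<close> it remains to choose the radius \<open>r\<close>.\<close>
    have reduce: ?thesis if r: "r > 0" and g: "0 \<le> ?g" and rem: "?g * (K1 * ?M\<^sup>2 * r ^ DIM(real^'m)) \<le> K1"
        and ker: "\<And>\<xi>. \<bar>\<xi>\<bar> \<le> ?M \<Longrightarrow> \<xi> \<noteq> 0 \<Longrightarrow> ennreal (freq_weight n \<xi>) \<le> ennreal (28 * ?g) * kernel_integral (ball (0::real^'m) r) \<epsilon> \<xi>" for r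
    proof -
      define k where "k = (\<lambda>\<xi>. kernel_integral (ball (0::real^'m) r) \<epsilon> \<xi>)"
      have B: "ball (0::real^'m) r = {x. norm x < r}" by auto
      have km [measurable]: "k \<in> borel_measurable borel" unfolding k_def B by measurable
      have "(\<integral>\<^sup>+\<xi>. ennreal (indicator {-?M..?M} \<xi> * freq_weight n \<xi> * ?F \<xi>) \<partial>lborel)
        \<le> (\<integral>\<^sup>+\<xi>. ennreal (28 * ?g) * (indicator {-?M..?M} \<xi> * (k \<xi> * ennreal (?F \<xi>))) \<partial>lborel)"
      proof (rule nn_integral_mono)
        fix \<xi> :: real
        show "ennreal (indicator {-?M..?M} \<xi> * freq_weight n \<xi> * ?F \<xi>) \<le> ennreal (28 * ?g) * (indicator {-?M..?M} \<xi> * (k \<xi> * ennreal (?F \<xi>)))"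
        proof (cases "\<bar>\<xi>\<bar> \<le> ?M \<and> \<xi> \<noteq> 0")
          case True
          then have i: "\<xi> \<in> {-?M..?M}" by auto
          have w: "freq_weight n \<xi> \<ge> 0" by (simp add: freq_weight_def)
          have "ennreal (freq_weight n \<xi> * ?F \<xi>) = ennreal (freq_weight n \<xi>) * ennreal (?F \<xi>)"
            using w by (rule ennreal_mult) simp
          also have "\<dots> \<le> (ennreal (28 * ?g) * k \<xi>) * ennreal (?F \<xi>)"
            using True unfolding k_def by (intro mult_right_mono ker) auto
          finally show ?thesis using i by (simp add: mult.assoc)
        next
          case False
          then have "indicator {-?M..?M} \<xi> * freq_weight n \<xi> = 0" by (auto simp: freq_weight_def indicator_def)
          then show ?thesis by (simp only: mult_zero_left ennreal_0 zero_le)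
        qed
      qed
      also have "\<dots> = ennreal (28 * ?g) * (\<integral>\<^sup>+\<xi>. indicator {-?M..?M} \<xi> * (k \<xi> * ennreal (?F \<xi>)) \<partial>lborel)"
        by (intro nn_integral_cmult) measurable
      also have "\<dots> \<le> ennreal (28 * ?g) * (2 * nonlocal \<epsilon> v + ennreal (K1 * ?M\<^sup>2 * r ^ DIM(real^'m)))"
        using M1 unfolding k_def by (intro mult_left_mono low \<epsilon> r v) auto
      also have "\<dots> = 56 * (ennreal ?g * nonlocal \<epsilon> v) + ennreal (28 * (?g * (K1 * ?M\<^sup>2 * r ^ DIM(real^'m))))"
        using g K1 r by (simp add: distrib_left ennreal_mult mult.assoc[symmetric] mult.commute[of _ 2])
      also have "\<dots> \<le> 56 * ennreal C + ennreal (28 * K1)"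
        using rem by (intro add_mono mult_left_mono N ennreal_leI) auto
      also have "\<dots> = ennreal (56 * C + 28 * K1)"
        using C K1 by (simp add: ennreal_plus ennreal_mult)
      also have "\<dots> \<le> ennreal (K * (C + 1))"
        using C K1 K2 by (intro ennreal_leI) (simp add: K_def algebra_simps)
      finally show ?thesis .
    qed
    consider "n = 2" | "n = 3" | "n = 4" using n by auto
    then show ?thesis
    proof cases
      case 1
      have D: "DIM(real^'m) = 1" using d 1 by simp
      have g: "?g = \<epsilon>" using 1 by (simp add: prefactor_def)
      have M: "?M = \<epsilon> powr (- 2 / 3)" using 1 by (simp add: freq_cutoff_def)
      \<comment> \<open>The exponent of the cutoff is chosen for this identity.\<close>
      have MM: "\<epsilon> * ?M\<^sup>2 * (\<epsilon> * ?M) = 1"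
      proof -
        have "\<epsilon> * ?M\<^sup>2 * (\<epsilon> * ?M) = \<epsilon> powr 1 * \<epsilon> powr 1 * (?M * ?M * ?M)" using \<epsilon> by (simp add: power2_eq_square)
        also have "\<dots> = 1" unfolding M powr_add[symmetric] using \<epsilon> by simp
        finally show ?thesis .
      qed
      show ?thesis
      proof (rule reduce[of "\<epsilon> * ?M"])
        show "\<epsilon> * ?M > 0" using \<epsilon> M1 by simp
        show "0 \<le> ?g" using g \<epsilon> by simp
        have "?g * (K1 * ?M\<^sup>2 * (\<epsilon> * ?M) ^ DIM(real^'m)) = K1 * (\<epsilon> * ?M\<^sup>2 * (\<epsilon> * ?M))"
          unfolding g D by simp
        then show "?g * (K1 * ?M\<^sup>2 * (\<epsilon> * ?M) ^ DIM(real^'m)) \<le> K1" by (simp only: MM mult_1_right order_refl)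
        fix \<xi> assume x: "\<bar>\<xi>\<bar> \<le> ?M"
        have "ennreal (freq_weight n \<xi>) \<le> ennreal (28 * \<bar>\<xi>\<bar>)" using 1 by (intro ennreal_leI) (simp add: freq_weight_def)
        also have "\<dots> = ennreal (28 * ?g) * ennreal (\<bar>\<xi>\<bar> / \<epsilon>)"
          unfolding g using \<epsilon> by (subst ennreal_mult[symmetric]) auto
        also have "\<dots> \<le> ennreal (28 * ?g) * kernel_integral (ball (0::real^'m) (\<epsilon> * ?M)) \<epsilon> \<xi>"
          using x \<epsilon> by (intro mult_left_mono kernel_integral_dim1 D) auto
        finally show "ennreal (freq_weight n \<xi>) \<le> ennreal (28 * ?g) * kernel_integral (ball (0::real^'m) (\<epsilon> * ?M)) \<epsilon> \<xi>" .
      qed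
    next
      case 2
      have D: "DIM(real^'m) = 2" using d 2 by simp
      have M: "?M = \<epsilon> powr (- 1 / 4)" using 2 by (simp add: freq_cutoff_def)
      note P3 = prefactor_dim3[OF \<epsilon>]
      have g1: "?g \<le> 1" "?g > 0" "1 / (7 * - ln \<epsilon>) \<le> ?g"
        using P3 2 by (auto intro: less_le_trans[of 0 "1 / (7 * - ln \<epsilon>)"])
      let ?r = "\<epsilon> powr (1/2)"
      have Mr: "?M\<^sup>2 * ?r\<^sup>2 = \<epsilon> powr (1/2)"
        unfolding M power2_eq_square powr_add[symmetric] using \<epsilon> by simp
      have r1: "?r \<le> 1" using \<epsilon> e1 by (simp add: powr_le1)
      show ?thesis
      \<comment> \<open>With \<open>r = \<epsilon>\<^bsup>1/2\<^esup>\<close> the quotient \<open>r / (\<epsilon> |\<xi>|)\<close> is at least \<open>\<epsilon>\<^bsup>-1/4\<^esup>\<close>, and its logarithm compensates the prefactor.\<close>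
      proof (rule reduce[of ?r])
        show "?r > 0" using \<epsilon> by simp
        show "0 \<le> ?g" using g1 by simp
        have "?g * (K1 * ?M\<^sup>2 * ?r ^ DIM(real^'m)) = ?g * (K1 * (?M\<^sup>2 * ?r\<^sup>2))" unfolding D by simp
        also have "\<dots> \<le> 1 * (K1 * 1)" unfolding Mr using g1 K1 r1 by (intro mult_mono) auto
        finally show "?g * (K1 * ?M\<^sup>2 * ?r ^ DIM(real^'m)) \<le> K1" by simp
        fix \<xi> assume x: "\<bar>\<xi>\<bar> \<le> ?M" and x0: "\<xi> \<noteq> (0::real)"
        have ex: "\<epsilon> * \<bar>\<xi>\<bar> \<le> \<epsilon> powr (3/4)"
        proof -
          have "\<epsilon> * \<bar>\<xi>\<bar> \<le> \<epsilon> powr 1 * ?M" using x \<epsilon> by simp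
          also have "\<dots> = \<epsilon> powr (3/4)" unfolding M powr_add[symmetric] by simp
          finally show ?thesis .
        qed
        have ex0: "\<epsilon> * \<bar>\<xi>\<bar> > 0" using \<epsilon> x0 by simp
        have le: "\<epsilon> powr (3/4) \<le> ?r" using \<epsilon> e1 by (intro powr_mono') auto
        have "ln (\<epsilon> * \<bar>\<xi>\<bar>) \<le> 3/4 * ln \<epsilon>"
          proof -
          have "ln (\<epsilon> * \<bar>\<xi>\<bar>) \<le> ln (\<epsilon> powr (3/4))" by (subst ln_le_cancel_iff) (use ex ex0 \<epsilon> in auto)
          then show ?thesis using \<epsilon> by (simp add: ln_powr)
        qed
        then have l0: "- ln \<epsilon> / 4 \<le> ln (?r / (\<epsilon> * \<bar>\<xi>\<bar>))"
          using ex0 \<epsilon> x0 by (simp add: ln_div ln_powr)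
        then have l1: "pi * (- ln \<epsilon> / 4) \<le> pi * ln (?r / (\<epsilon> * \<bar>\<xi>\<bar>))" by (intro mult_left_mono) auto
        have l2: "- ln \<epsilon> / 4 \<le> pi * (- ln \<epsilon> / 4)" using P3(3) pi_gt3 by (simp add: mult_le_cancel_right1)
        have "1 \<le> 28 * ?g * (- ln \<epsilon> / 4)"
        proof -
          have "1 = 28 * (1 / (7 * - ln \<epsilon>)) * (- ln \<epsilon> / 4)" using P3(3) by simp
          also have "\<dots> \<le> 28 * ?g * (- ln \<epsilon> / 4)" using g1 P3(3) by (intro mult_right_mono mult_left_mono) auto
          finally show ?thesis .
        qed
        also have "\<dots> \<le> 28 * ?g * (pi * ln (?r / (\<epsilon> * \<bar>\<xi>\<bar>)))"
          using l1 l2 g1 by (intro mult_left_mono) auto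
        finally have "1 * \<xi>\<^sup>2 \<le> 28 * ?g * (pi * ln (?r / (\<epsilon> * \<bar>\<xi>\<bar>))) * \<xi>\<^sup>2" by (rule mult_right_mono) simp
        then have "ennreal (freq_weight n \<xi>) \<le> ennreal (28 * ?g * (pi * ln (?r / (\<epsilon> * \<bar>\<xi>\<bar>)) * \<xi>\<^sup>2))"
          using 2 by (intro ennreal_leI) (simp add: freq_weight_def mult_ac)
        also have "\<dots> = ennreal (28 * ?g) * ennreal (pi * ln (?r / (\<epsilon> * \<bar>\<xi>\<bar>)) * \<xi>\<^sup>2)"
          proof (intro ennreal_mult mult_nonneg_nonneg)
          show "0 \<le> ln (?r / (\<epsilon> * \<bar>\<xi>\<bar>))" using l0 P3(3) by linarith
        qed (use g1 in auto)
        also have "\<dots> \<le> ennreal (28 * ?g) * kernel_integral (ball (0::real^'m) ?r) \<epsilon> \<xi>"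
          using ex le \<epsilon> x0 by (intro mult_left_mono kernel_integral_dim2 D) auto
        finally show "ennreal (freq_weight n \<xi>) \<le> ennreal (28 * ?g) * kernel_integral (ball (0::real^'m) ?r) \<epsilon> \<xi>" .
      qed
    next
      case 3
      have g: "?g = 1" using 3 by (simp add: prefactor_def)
      have M: "?M = 1 / \<epsilon>" using 3 by (simp add: freq_cutoff_def)
      have "(\<integral>\<^sup>+\<xi>. ennreal (indicator {-?M..?M} \<xi> * freq_weight n \<xi> * ?F \<xi>) \<partial>lborel) \<le> (\<integral>\<^sup>+\<xi>. ennreal (min (\<xi>\<^sup>2) (1 / \<epsilon>\<^sup>2) * ?F \<xi>) \<partial>lborel)"
      proof (intro nn_integral_mono ennreal_leI mult_right_mono)
        fix \<xi> :: real
        show "indicator {-?M..?M} \<xi> * freq_weight n \<xi> \<le> min (\<xi>\<^sup>2) (1 / \<epsilon>\<^sup>2)"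
        proof (cases "\<bar>\<xi>\<bar> \<le> 1 / \<epsilon>")
          case True
          then have "\<xi>\<^sup>2 \<le> (1 / \<epsilon>)\<^sup>2" using \<epsilon> by (simp add: abs_le_square_iff[symmetric])
          then show ?thesis using 3 by (simp add: freq_weight_def power_divide indicator_def)
        next
          case False
          then have "\<xi> \<notin> {-?M..?M}" unfolding M by auto
          then show ?thesis by simp
        qed
      qed auto
      also have "\<dots> \<le> ennreal K2 * nonlocal \<epsilon> v" by (rule high[OF \<epsilon>(1) v])
      also have "\<dots> \<le> ennreal K2 * ennreal C" using N unfolding g by (intro mult_left_mono) auto
      also have "\<dots> = ennreal (K2 * C)" using K2 C by (simp add: ennreal_mult)
      also have "\<dots> \<le> ennreal (K * (C + 1))"
      proof (intro ennreal_leI mult_mono)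
        show "K2 \<le> K" using K1 K2 by (simp add: K_def)
      qed (use C K0 in auto)
      finally show ?thesis .
    qed
  qed
  from that[OF K0 main] show ?thesis .
qed

lemma ennreal_combination:
  assumes "0 \<le> a" "0 \<le> b" "0 \<le> g" "0 \<le> c" "0 \<le> e" "0 \<le> d"
  shows "ennreal (2 * (2 * a + b + 28 * (g * c) + e * d)) =
    2 * (2 * ennreal a + ennreal b + 28 * (ennreal g * ennreal c) + ennreal e * ennreal d)"
  using assms by (simp only: ennreal_plus ennreal_mult add_nonneg_nonneg mult_nonneg_nonneg zero_le_numeral ennreal_numeral)

lemma nn_integral_combination:
  assumes [measurable]: "a \<in> borel_measurable M" "b \<in> borel_measurable M" "c \<in> borel_measurable M" "d \<in> borel_measurable M"
  shows "(\<integral>\<^sup>+x. 2 * (2 * a x + b x + 28 * (g * c x) + e * d x) \<partial>M) =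
    2 * (2 * (\<integral>\<^sup>+x. a x \<partial>M) + (\<integral>\<^sup>+x. b x \<partial>M) + 28 * (g * (\<integral>\<^sup>+x. c x \<partial>M)) + e * (\<integral>\<^sup>+x. d x \<partial>M))"
  by (subst nn_integral_cmult, measurable, subst nn_integral_add, measurable, subst nn_integral_add, measurable,
      subst nn_integral_add, measurable, subst nn_integral_cmult, measurable, subst nn_integral_cmult, measurable,
      subst nn_integral_cmult, measurable, subst nn_integral_cmult, measurable)

lemma double_sum_bound:
  fixes x y a b c d :: real
  assumes "x \<le> 2 * (a + y)" "y \<le> a + b + c + d"
  shows "x \<le> 2 * (2 * a + b + c + d)"
proof -
  have "2 * (a + y) \<le> 2 * (a + (a + b + c + d))" using assms(2) by simp
  also have "\<dots> = 2 * (2 * a + b + c + d)" by simp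
  finally show ?thesis using assms(1) by (rule order_trans[rotated])
qed

text \<open>
  Up to \<open>1 / \<epsilon>\<^sup>4\<close> use \<open>frequency_interpolation\<close>. Beyond, the decay caused by the perimeter bounds the
  squared transform by a multiple of \<open>1 / (\<epsilon>\<^sup>2 \<xi>\<^sup>2)\<close>, where \<open>1 / \<epsilon>\<^sup>2 \<le> |\<xi>|\<^bsup>1/2\<^esup>\<close>; after multiplication by
  \<open>|\<xi>|\<^bsup>1/4\<^esup>\<close> the integrable tail \<open>|\<xi>|\<^bsup>-5/4\<^esup>\<close> remains.
\<close>

lemma uniform_sobolev_bound:
  fixes \<rho> :: real assumes \<rho>: "\<rho> > 0" and d: "CARD('m::finite) + 1 = n" and n: "n \<in> {2, 3, 4}" and C: "C \<ge> 0"
  obtains K where "K \<ge> 0" "\<And>\<epsilon> (v :: real \<times> (real^'m) \<Rightarrow> real). 0 < \<epsilon> \<Longrightarrow> \<epsilon> \<le> exp (-1) \<Longrightarrow> cs_indicator \<rho> v \<Longrightarrow>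
    ennreal (prefactor n \<epsilon>) * nonlocal \<epsilon> v \<le> ennreal C \<Longrightarrow>
    (\<forall>\<xi>. \<epsilon> * \<bar>\<xi>\<bar> * cmod (FT (cfun (section_area v)) \<xi>) \<le> 2 * C) \<Longrightarrow>
    (\<integral>\<^sup>+\<xi>. ennreal ((1 + \<xi>\<^sup>2) powr (1/8) * (cmod (FT (cfun (section_area v)) \<xi>))\<^sup>2) \<partial>lborel) \<le> ennreal K"
proof -
  obtain K1 where K1: "K1 \<ge> 0" and low: "\<And>\<epsilon> C (v :: real \<times> (real^'m) \<Rightarrow> real). 0 < \<epsilon> \<Longrightarrow> \<epsilon> \<le> exp (-1) \<Longrightarrow> cs_indicator \<rho> v \<Longrightarrow> C \<ge> 0 \<Longrightarrow>
    ennreal (prefactor n \<epsilon>) * nonlocal \<epsilon> v \<le> ennreal C \<Longrightarrow>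
    (\<integral>\<^sup>+\<xi>. ennreal (indicator {- freq_cutoff n \<epsilon>..freq_cutoff n \<epsilon>} \<xi> * freq_weight n \<xi> *
       (cmod (FT (cfun (section_area v)) \<xi>))\<^sup>2) \<partial>lborel) \<le> ennreal (K1 * (C + 1))"
    using low_frequency_weighted_bound[OF \<rho> d n] by blast
  obtain K2 where K2: "K2 \<ge> 0" and high: "\<And>\<epsilon> (v :: real \<times> (real^'m) \<Rightarrow> real). \<epsilon> > 0 \<Longrightarrow> cs_indicator \<rho> v \<Longrightarrow>
    (\<integral>\<^sup>+\<xi>. ennreal (min (\<xi>\<^sup>2) (1 / \<epsilon>\<^sup>2) * (cmod (FT (cfun (section_area v)) \<xi>))\<^sup>2) \<partial>lborel) \<le> ennreal K2 * nonlocal \<epsilon> v"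
    using high_frequency_bound[OF \<rho>, where 'b = "real^'m"] by blast
  define B where "B = measure lborel (ball (0::real^'m) \<rho>)"
  define K0 where "K0 = 2 * pi * (LINT x|lborel. B\<^sup>2 * indicat_real (ball (0::real) \<rho>) x)"
  have K0: "K0 \<ge> 0" unfolding K0_def by (intro mult_nonneg_nonneg Bochner_Integration.integral_nonneg) auto
  define G where "G = enn2real (\<integral>\<^sup>+\<xi>. ennreal (indicator {\<xi>. 1 \<le> \<bar>\<xi>\<bar>} \<xi> * \<bar>\<xi>\<bar> powr (- 5 / 4)) \<partial>(lborel :: real measure))"
  have G: "(\<integral>\<^sup>+\<xi>. ennreal (indicator {\<xi>. 1 \<le> \<bar>\<xi>\<bar>} \<xi> * \<bar>\<xi>\<bar> powr (- 5 / 4)) \<partial>(lborel :: real measure)) = ennreal G" "G \<ge> 0"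
    unfolding G_def using tail_integral_finite by simp_all
  define K where "K = 2 * (2 * K0 + K1 * (C + 1) + 28 * (K2 * C) + 4 * C\<^sup>2 * G)"
  have K: "K \<ge> 0" unfolding K_def using K0 K1 K2 C G by simp
  have main: "(\<integral>\<^sup>+\<xi>. ennreal ((1 + \<xi>\<^sup>2) powr (1/8) * (cmod (FT (cfun (section_area v)) \<xi>))\<^sup>2) \<partial>lborel) \<le> ennreal K"
    if \<epsilon>: "0 < \<epsilon>" "\<epsilon> \<le> exp (-1)" and v: "cs_indicator \<rho> v"
      and N: "ennreal (prefactor n \<epsilon>) * nonlocal \<epsilon> v \<le> ennreal C"
      and decay: "\<forall>\<xi>. \<epsilon> * \<bar>\<xi>\<bar> * cmod (FT (cfun (section_area v)) \<xi>) \<le> 2 * C"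
    for \<epsilon> and v :: "real \<times> (real^'m) \<Rightarrow> real"
  proof -
    let ?M = "freq_cutoff n \<epsilon>" and ?g = "prefactor n \<epsilon>"
    let ?f = "\<lambda>\<xi>. cmod (FT (cfun (section_area v)) \<xi>)"
    let ?F = "\<lambda>\<xi>. (?f \<xi>)\<^sup>2"
    have e1: "\<epsilon> < 1" using \<epsilon> exp_minus_one_less by linarith
    have acs: "bounded_cs (cfun (section_area v))" by (rule section_area_bounded_cs[OF v])
    have [measurable]: "section_area v \<in> borel_measurable borel" by (rule section_area_bounds(1)[OF v])
    have g0: "?g \<ge> 0"
    proof -
      have "0 \<le> 1 / (7 * - ln \<epsilon>)" using prefactor_dim3(3)[OF \<epsilon>] by simp
      then have "0 \<le> prefactor 3 \<epsilon>" using prefactor_dim3(1)[OF \<epsilon>] by (rule order_trans)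
      moreover have "0 \<le> prefactor 2 \<epsilon>" "0 \<le> prefactor 4 \<epsilon>" using \<epsilon> by (simp_all add: prefactor_def)
      ultimately show ?thesis using n by auto
    qed
    let ?T1 = "\<lambda>\<xi>. indicator {-?M..?M} \<xi> * freq_weight n \<xi> * ?F \<xi>"
    let ?T2 = "\<lambda>\<xi>. min (\<xi>\<^sup>2) (1 / \<epsilon>\<^sup>2) * ?F \<xi>"
    let ?T3 = "\<lambda>\<xi>::real. indicat_real {\<xi>. 1 \<le> \<bar>\<xi>\<bar>} \<xi> * \<bar>\<xi>\<bar> powr (- 5 / 4)"
    have T0: "0 \<le> ?T1 \<xi>" "0 \<le> ?T2 \<xi>" "0 \<le> ?T3 \<xi>" for \<xi>
      by (simp_all add: freq_weight_def)
    have quarter: "\<bar>\<xi>\<bar> powr (1/4) * ?F \<xi> \<le> ?F \<xi> + ?T1 \<xi> + 28 * (?g * ?T2 \<xi>) + 4 * C\<^sup>2 * ?T3 \<xi>" for \<xi>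
    proof (cases "\<bar>\<xi>\<bar> \<le> \<epsilon> powr (- 4)")
      case True
      have "\<bar>\<xi>\<bar> powr (1/4) * ?F \<xi> \<le> (1 + indicator {-?M..?M} \<xi> * freq_weight n \<xi> + 28 * (?g * min (\<xi>\<^sup>2) (1 / \<epsilon>\<^sup>2))) * ?F \<xi>"
        by (intro mult_right_mono frequency_interpolation n \<epsilon> True) simp
      also have "\<dots> = ?F \<xi> + ?T1 \<xi> + 28 * (?g * ?T2 \<xi>)" by (simp add: algebra_simps)
      moreover have "0 \<le> 4 * C\<^sup>2 * ?T3 \<xi>" by (intro mult_nonneg_nonneg T0) auto
      ultimately show ?thesis by linarith
    next
      case False
      have one: "1 \<le> \<epsilon> powr (- 4)" using powr_mono'[of "-4" 0 \<epsilon>] \<epsilon> e1 by simp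
      then have x1: "\<bar>\<xi>\<bar> > 1" using False by linarith
      have p2: "\<bar>\<xi>\<bar> powr 2 = \<xi>\<^sup>2" using x1 by (simp add: powr_numeral)
      have "\<bar>\<xi>\<bar> powr (- 1 / 2) \<le> (\<epsilon> powr (- 4)) powr (- 1 / 2)"
        using False \<epsilon> by (intro powr_mono2') auto
      also have "\<dots> = \<epsilon>\<^sup>2" using \<epsilon> by (simp add: powr_powr powr_numeral)
      finally have e2: "\<bar>\<xi>\<bar> powr (- 1 / 2) \<le> \<epsilon>\<^sup>2" .
      have "\<bar>\<xi>\<bar> powr (3 / 2) * ?F \<xi> = \<bar>\<xi>\<bar> powr (- 1 / 2) * (\<xi>\<^sup>2 * ?F \<xi>)"
        unfolding p2[symmetric] mult.assoc[symmetric] powr_add[symmetric] by simp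
      also have "\<dots> \<le> \<epsilon>\<^sup>2 * (\<xi>\<^sup>2 * ?F \<xi>)" by (intro mult_right_mono e2) simp
      also have "\<dots> = (\<epsilon> * \<bar>\<xi>\<bar> * ?f \<xi>)\<^sup>2" by (simp add: power_mult_distrib)
      also have "\<dots> \<le> (2 * C)\<^sup>2" using \<epsilon> by (intro power_mono decay[rule_format]) auto
      finally have "\<bar>\<xi>\<bar> powr (- 5 / 4) * (\<bar>\<xi>\<bar> powr (3 / 2) * ?F \<xi>) \<le> \<bar>\<xi>\<bar> powr (- 5 / 4) * (4 * C\<^sup>2)"
        by (intro mult_left_mono) (auto simp: power_mult_distrib)
      moreover have "\<bar>\<xi>\<bar> powr (- 5 / 4) * (\<bar>\<xi>\<bar> powr (3 / 2) * ?F \<xi>) = \<bar>\<xi>\<bar> powr (1/4) * ?F \<xi>"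
        unfolding mult.assoc[symmetric] powr_add[symmetric] by simp
      moreover have "4 * C\<^sup>2 * ?T3 \<xi> = \<bar>\<xi>\<bar> powr (- 5 / 4) * (4 * C\<^sup>2)" using x1 by (simp add: indicator_def)
      moreover have "0 \<le> 28 * (?g * ?T2 \<xi>)" by (intro mult_nonneg_nonneg g0 T0) simp
      ultimately show ?thesis using T0(1)[of \<xi>] zero_le_power2[of "?f \<xi>"] by linarith
    qed
    have pt: "(1 + \<xi>\<^sup>2) powr (1/8) * ?F \<xi> \<le> 2 * (2 * ?F \<xi> + ?T1 \<xi> + 28 * (?g * ?T2 \<xi>) + 4 * C\<^sup>2 * ?T3 \<xi>)" for \<xi>
    proof -
      have "(1 + \<xi>\<^sup>2) powr (1/8) \<le> 2 * (1 + \<bar>\<xi>\<bar> powr (1/4))"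
      proof (cases "\<bar>\<xi>\<bar> \<le> 1")
        case True
        then have "\<xi>\<^sup>2 \<le> 1" by (simp add: abs_square_le_1)
        then have "(1 + \<xi>\<^sup>2) powr (1/8) \<le> (1 + \<xi>\<^sup>2) powr 1" by (intro powr_mono) auto
        also have "\<dots> \<le> 2 * 1" using \<open>\<xi>\<^sup>2 \<le> 1\<close> by simp
        also have "\<dots> \<le> 2 * (1 + \<bar>\<xi>\<bar> powr (1/4))" by (intro mult_left_mono) auto
        finally show ?thesis .
      next
        case False
        then have "1 \<le> \<xi>\<^sup>2" using one_le_power[of "\<bar>\<xi>\<bar>" 2] by simp
        then have "(1 + \<xi>\<^sup>2) powr (1/8) \<le> (2 * \<xi>\<^sup>2) powr (1/8)" by (intro powr_mono2) auto
        also have "\<dots> = 2 powr (1/8) * (\<xi>\<^sup>2) powr (1/8)" by (simp add: powr_mult)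
        also have "(\<xi>\<^sup>2) powr (1/8) = \<bar>\<xi>\<bar> powr (1/4)"
        proof -
          have "\<xi>\<^sup>2 = \<bar>\<xi>\<bar> powr 2" using False by (simp add: powr_numeral)
          then have "(\<xi>\<^sup>2) powr (1/8) = (\<bar>\<xi>\<bar> powr 2) powr (1/8)" by (rule arg_cong)
          also have "\<dots> = \<bar>\<xi>\<bar> powr (2 * (1/8))" by (rule powr_powr)
          finally show ?thesis by simp
        qed
        also have "2 powr (1/8) * \<bar>\<xi>\<bar> powr (1/4) \<le> 2 powr 1 * \<bar>\<xi>\<bar> powr (1/4)"
          by (intro mult_right_mono powr_mono) auto
        finally show ?thesis by simp
      qed
      then have "(1 + \<xi>\<^sup>2) powr (1/8) * ?F \<xi> \<le> 2 * (1 + \<bar>\<xi>\<bar> powr (1/4)) * ?F \<xi>" by (rule mult_right_mono) simp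
      also have "\<dots> = 2 * (?F \<xi> + \<bar>\<xi>\<bar> powr (1/4) * ?F \<xi>)" by (simp add: algebra_simps)
      finally have st: "(1 + \<xi>\<^sup>2) powr (1/8) * ?F \<xi> \<le> 2 * (?F \<xi> + \<bar>\<xi>\<bar> powr (1/4) * ?F \<xi>)" .
      show ?thesis by (rule double_sum_bound[OF st quarter])
    qed
    have I0: "(\<integral>\<^sup>+\<xi>. ennreal (?F \<xi>) \<partial>lborel) \<le> ennreal K0"
    proof -
      have "(\<integral>\<^sup>+\<xi>. ennreal (?F \<xi>) \<partial>lborel) = ennreal (2 * pi * (LINT x|lborel. (cmod (complex_of_real (section_area v x)))\<^sup>2))"
        using plancherel_FT[OF acs] by simp
      also have "\<dots> \<le> ennreal K0" unfolding K0_def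
      proof (intro ennreal_leI mult_left_mono integral_mono_AE' integrable_indicator_ball)
        show "AE x in lborel. (cmod (complex_of_real (section_area v x)))\<^sup>2 \<le> B\<^sup>2 * indicat_real (ball 0 \<rho>) x"
        proof (rule AE_I2)
          fix x show "(cmod (complex_of_real (section_area v x)))\<^sup>2 \<le> B\<^sup>2 * indicat_real (ball 0 \<rho>) x"
            using power_mono[OF section_area_bounds(3)[OF v, of x] section_area_bounds(2)[OF v, of x], of 2]
            by (cases "\<bar>x\<bar> < \<rho>") (simp_all add: B_def)
        qed
      qed auto
      finally show ?thesis .
    qed
    have I1: "(\<integral>\<^sup>+\<xi>. ennreal (?T1 \<xi>) \<partial>lborel) \<le> ennreal (K1 * (C + 1))"
      by (rule low[OF \<epsilon> v C N])
    have I2: "ennreal ?g * (\<integral>\<^sup>+\<xi>. ennreal (?T2 \<xi>) \<partial>lborel) \<le> ennreal (K2 * C)"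
    proof -
      have "ennreal ?g * (\<integral>\<^sup>+\<xi>. ennreal (?T2 \<xi>) \<partial>lborel) \<le> ennreal ?g * (ennreal K2 * nonlocal \<epsilon> v)"
        by (intro mult_left_mono high \<epsilon> v) simp
      also have "\<dots> = ennreal K2 * (ennreal ?g * nonlocal \<epsilon> v)" by (simp only: mult_ac)
      also have "\<dots> \<le> ennreal K2 * ennreal C" by (intro mult_left_mono N) simp
      finally show ?thesis using K2 C by (simp add: ennreal_mult)
    qed
    have fw [measurable]: "freq_weight n \<in> borel_measurable borel" unfolding freq_weight_def[abs_def] by measurable
    have T1m: "?T1 \<in> borel_measurable borel" and T2m: "?T2 \<in> borel_measurable borel" and T3m: "?T3 \<in> borel_measurable borel" and Fm: "?F \<in> borel_measurable borel"
      by measurable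
    have "(\<integral>\<^sup>+\<xi>. ennreal ((1 + \<xi>\<^sup>2) powr (1/8) * ?F \<xi>) \<partial>lborel)
       \<le> (\<integral>\<^sup>+\<xi>. 2 * (2 * ennreal (?F \<xi>) + ennreal (?T1 \<xi>) + 28 * (ennreal ?g * ennreal (?T2 \<xi>)) + ennreal (4 * C\<^sup>2) * ennreal (?T3 \<xi>)) \<partial>lborel)"
    proof (rule nn_integral_mono)
      fix \<xi> :: real
      have "ennreal ((1 + \<xi>\<^sup>2) powr (1/8) * ?F \<xi>) \<le> ennreal (2 * (2 * ?F \<xi> + ?T1 \<xi> + 28 * (?g * ?T2 \<xi>) + 4 * C\<^sup>2 * ?T3 \<xi>))"
        by (rule ennreal_leI[OF pt])
      also have "\<dots> = 2 * (2 * ennreal (?F \<xi>) + ennreal (?T1 \<xi>) + 28 * (ennreal ?g * ennreal (?T2 \<xi>)) + ennreal (4 * C\<^sup>2) * ennreal (?T3 \<xi>))"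
        by (rule ennreal_combination) (use g0 T0[of \<xi>] in auto)
      finally show "ennreal ((1 + \<xi>\<^sup>2) powr (1/8) * ?F \<xi>) \<le> 2 * (2 * ennreal (?F \<xi>) + ennreal (?T1 \<xi>) + 28 * (ennreal ?g * ennreal (?T2 \<xi>)) + ennreal (4 * C\<^sup>2) * ennreal (?T3 \<xi>))" .
    qed
    also have "\<dots> = 2 * (2 * (\<integral>\<^sup>+\<xi>. ennreal (?F \<xi>) \<partial>lborel) + (\<integral>\<^sup>+\<xi>. ennreal (?T1 \<xi>) \<partial>lborel) + 28 * (ennreal ?g * (\<integral>\<^sup>+\<xi>. ennreal (?T2 \<xi>) \<partial>lborel)) + ennreal (4 * C\<^sup>2) * (\<integral>\<^sup>+\<xi>. ennreal (?T3 \<xi>) \<partial>lborel))"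
      by (rule nn_integral_combination; intro measurable_compose[OF _ measurable_ennreal] T1m T2m T3m Fm; simp)
    also have "\<dots> \<le> 2 * (2 * ennreal K0 + ennreal (K1 * (C + 1)) + 28 * ennreal (K2 * C) + ennreal (4 * C\<^sup>2) * ennreal G)"
      unfolding G(1) by (intro mult_left_mono add_mono I0 I1 I2) auto
    also have "\<dots> = ennreal K"
      using ennreal_combination[of K0 "K1 * (C + 1)" 1 "K2 * C" "4 * C\<^sup>2" G] K0 K1 K2 C G(2)
      unfolding K_def by simp
    finally show ?thesis .
  qed
  from that[OF K main] show ?thesis .
qed

section \<open>Compactness of the cross-sectional areas\<close>

text \<open>
  The properties of the cross-sectional areas that survive in the limit. For these, \<open>B\<close> is the
  volume of the ball of radius \<open>\<rho>\<close> in the transverse directions.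
\<close>

definition mass_profile :: "real \<Rightarrow> real \<Rightarrow> (real \<Rightarrow> real) \<Rightarrow> bool" where
  "mass_profile B \<rho> a \<longleftrightarrow> a \<in> borel_measurable borel \<and>
     (\<forall>x. 0 \<le> a x \<and> a x \<le> B * indicat_real (ball 0 \<rho>) x) \<and> (LINT x|lborel. a x) = 1"

lemma mass_profileD:
  assumes "mass_profile B \<rho> a"
  shows "a \<in> borel_measurable borel" "0 \<le> a x" "a x \<le> B * indicat_real (ball 0 \<rho>) x" "(LINT x|lborel. a x) = 1"
  using assms by (simp_all add: mass_profile_def)

lemma mass_profile_bounded_cs:
  assumes a: "mass_profile B \<rho> a"
  shows "bounded_cs (cfun a)"
proof (rule bounded_csI[where B = B and R = \<rho>])
  show "cfun a \<in> borel_measurable borel" using mass_profileD(1)[OF a] by measurable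
  show "cmod (cfun a x) \<le> B * indicat_real (ball 0 \<rho>) x" for x
    using mass_profileD(2,3)[OF a, of x] by simp
qed

lemma mass_profile_FT_bound:
  assumes a: "mass_profile B \<rho> a" shows "cmod (FT (cfun a) \<xi>) \<le> 1"
proof -
  have "cmod (FT (cfun a) \<xi>) \<le> (LINT x|lborel. cmod (cfun a x))"
    by (rule cmod_FT_le[OF mass_profile_bounded_cs[OF a]])
  also have "\<dots> = 1" using mass_profileD(2,4)[OF a] by simp
  finally show ?thesis .
qed

lemma mass_profile_FT_lipschitz:
  assumes a: "mass_profile B \<rho> a" and \<rho>: "\<rho> > 0"
  shows "cmod (FT (cfun a) \<xi> - FT (cfun a) \<zeta>) \<le> \<rho> * \<bar>\<xi> - \<zeta>\<bar>"
proof -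
  have acs: "bounded_cs (cfun a)" by (rule mass_profile_bounded_cs[OF a])
  let ?e = "\<lambda>x \<xi>. exp (- \<i> * complex_of_real (x \<bullet> \<xi>)) :: complex"
  have i: "integrable lborel (\<lambda>x. \<rho> * \<bar>\<xi> - \<zeta>\<bar> * a x)"
    using integrable_Re[OF bounded_cs_integrable[OF acs]] by (intro integrable_mult_right) simp
  have "FT (cfun a) \<xi> - FT (cfun a) \<zeta> = (LINT x|lborel. cfun a x * ?e x \<xi> - cfun a x * ?e x \<zeta>)"
    unfolding FT_def by (rule Bochner_Integration.integral_diff[symmetric]; intro bounded_cs_integrable bounded_cs_modulate acs)
  also have "cmod \<dots> \<le> (LINT x|lborel. cmod (cfun a x * ?e x \<xi> - cfun a x * ?e x \<zeta>))"
    by (rule integral_norm_bound)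
  also have "\<dots> \<le> (LINT x|lborel. \<rho> * \<bar>\<xi> - \<zeta>\<bar> * a x)"
  proof (rule integral_mono_AE'[OF i])
    show "AE x in lborel. cmod (cfun a x * ?e x \<xi> - cfun a x * ?e x \<zeta>) \<le> \<rho> * \<bar>\<xi> - \<zeta>\<bar> * a x"
    proof (rule AE_I2)
      fix x :: real
      show "cmod (cfun a x * ?e x \<xi> - cfun a x * ?e x \<zeta>) \<le> \<rho> * \<bar>\<xi> - \<zeta>\<bar> * a x"
      proof (cases "\<bar>x\<bar> < \<rho>")
        case True
        have "?e x \<xi> = exp (- (\<i> * complex_of_real (x * (\<xi> - \<zeta>)))) * ?e x \<zeta>"
          by (simp add: exp_add[symmetric] algebra_simps)
        then have "cfun a x * ?e x \<xi> - cfun a x * ?e x \<zeta> = cfun a x * ((exp (- (\<i> * complex_of_real (x * (\<xi> - \<zeta>)))) - 1) * ?e x \<zeta>)"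
          by (simp add: algebra_simps)
        then have "cmod (cfun a x * ?e x \<xi> - cfun a x * ?e x \<zeta>) = a x * cmod (exp (- (\<i> * complex_of_real (x * (\<xi> - \<zeta>)))) - 1)"
          using mass_profileD(2)[OF a, of x] by (simp add: norm_mult)
        also have "\<dots> \<le> a x * \<bar>x * (\<xi> - \<zeta>)\<bar>"
          using mass_profileD(2)[OF a, of x] by (intro mult_left_mono cmod_exp_minus_one_le)
        also have "\<dots> \<le> a x * (\<rho> * \<bar>\<xi> - \<zeta>\<bar>)"
          using mass_profileD(2)[OF a, of x] True unfolding abs_mult by (intro mult_left_mono mult_right_mono) auto
        finally show ?thesis by (simp add: mult_ac)
      next
        case False
        then have "a x = 0" using mass_profileD(2,3)[OF a, of x] by simp
        then show ?thesis by simp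
      qed
    qed
    show "AE x in lborel. 0 \<le> \<rho> * \<bar>\<xi> - \<zeta>\<bar> * a x"
      using \<rho> mass_profileD(2)[OF a] by (intro AE_I2 mult_nonneg_nonneg) auto
  qed
  also have "\<dots> = \<rho> * \<bar>\<xi> - \<zeta>\<bar>" using mass_profileD(4)[OF a] by simp
  finally show ?thesis .
qed

text \<open>
  A diagonal argument gives convergence at the rational frequencies, and the common Lipschitz constant
  extends it to all of them.
\<close>

lemma mass_profile_pointwise_subsequence:
  fixes a :: "nat \<Rightarrow> real \<Rightarrow> real"
  assumes a: "\<And>k. mass_profile B \<rho> (a k)" and \<rho>: "\<rho> > 0"
  obtains r g where "strict_mono (r :: nat \<Rightarrow> nat)" "\<And>\<xi>. (\<lambda>k. FT (cfun (a (r k))) \<xi>) \<longlonglongrightarrow> g \<xi>"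
proof -
  obtain r :: "nat \<Rightarrow> nat" where r: "strict_mono r"
    and rat: "\<And>q. q \<in> \<rat> \<Longrightarrow> \<exists>l. (\<lambda>k. FT (cfun (a (r k))) q) \<longlonglongrightarrow> l"
    using function_convergent_subsequence[OF countable_rat, of "\<lambda>k. FT (cfun (a k))" 1] mass_profile_FT_bound[OF a] by blast
  have "convergent (\<lambda>k. FT (cfun (a (r k))) \<xi>)" for \<xi>
    unfolding Cauchy_convergent_iff[symmetric]
  proof (rule CauchyI)
    fix e :: real assume e: "e > 0"
    \<comment> \<open>The Lipschitz constant is \<open>\<rho>\<close>, since the profiles have mass \<open>1\<close>.\<close>
    define d where "d = e / (3 * \<rho>)"
    have d: "d > 0" "\<rho> * d = e / 3" using e \<rho> by (simp_all add: d_def)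
    obtain q where q: "q \<in> \<rat>" "\<xi> < q" "q < \<xi> + d" using Rats_dense_in_real[of \<xi> "\<xi> + d"] d by auto
    have cl: "cmod (FT (cfun (a (r k))) \<xi> - FT (cfun (a (r k))) q) < e / 3" for k
    proof -
      have "cmod (FT (cfun (a (r k))) \<xi> - FT (cfun (a (r k))) q) \<le> \<rho> * \<bar>\<xi> - q\<bar>"
        by (rule mass_profile_FT_lipschitz[OF a \<rho>])
      also have "\<dots> < \<rho> * d" using q \<rho> by (intro mult_strict_left_mono) auto
      finally show ?thesis using d by simp
    qed
    have "Cauchy (\<lambda>k. FT (cfun (a (r k))) q)" using rat[OF q(1)] LIMSEQ_imp_Cauchy by blast
    then obtain M where M: "\<And>m n. m \<ge> M \<Longrightarrow> n \<ge> M \<Longrightarrow> cmod (FT (cfun (a (r m))) q - FT (cfun (a (r n))) q) < e / 3"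
      using CauchyD[of _ "e/3"] e by (metis divide_pos_pos zero_less_numeral)
    have "cmod (FT (cfun (a (r m))) \<xi> - FT (cfun (a (r n))) \<xi>) < e" if "m \<ge> M" "n \<ge> M" for m n
    proof -
      have "cmod (FT (cfun (a (r m))) \<xi> - FT (cfun (a (r n))) \<xi>) \<le> cmod (FT (cfun (a (r m))) \<xi> - FT (cfun (a (r m))) q)
         + cmod (FT (cfun (a (r m))) q - FT (cfun (a (r n))) q) + cmod (FT (cfun (a (r n))) q - FT (cfun (a (r n))) \<xi>)"
        by (metis (no_types, lifting) add_mono diff_add_cancel add_diff_eq norm_triangle_ineq norm_triangle_mono order_refl)
      then show ?thesis using cl[of m] cl[of n] M[OF that] by (simp add: norm_minus_commute)
    qed
    then show "\<exists>M. \<forall>m\<ge>M. \<forall>n\<ge>M. cmod (FT (cfun (a (r m))) \<xi> - FT (cfun (a (r n))) \<xi>) < e" by blast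
  qed
  then have "\<And>\<xi>. (\<lambda>k. FT (cfun (a (r k))) \<xi>) \<longlonglongrightarrow> lim (\<lambda>k. FT (cfun (a (r k))) \<xi>)"
    by (simp add: convergent_LIMSEQ_iff)
  then show ?thesis by (rule that[OF r])
qed

text \<open>
  Split the integral at \<open>|\<xi>| = n\<close>. Inside, dominated convergence applies; outside, the stronger weight
  gains the factor \<open>(1 + n\<^sup>2)\<^bsup>s-t\<^esup>\<close>, which is small uniformly in \<open>k\<close>.
\<close>

lemma weighted_L2_convergence:
  fixes F :: "nat \<Rightarrow> real \<Rightarrow> complex"
  assumes Fm [measurable]: "\<And>k. F k \<in> borel_measurable borel" and lim: "\<And>\<xi>. (\<lambda>k. F k \<xi>) \<longlonglongrightarrow> g \<xi>"
    and b1: "\<And>k \<xi>. cmod (F k \<xi>) \<le> 1"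
    and bound: "\<And>k. (\<integral>\<^sup>+\<xi>. ennreal ((1 + \<xi>\<^sup>2) powr t * (cmod (F k \<xi>))\<^sup>2) \<partial>lborel) \<le> ennreal K"
    and s: "0 \<le> s" "s < t" and K: "K \<ge> 0"
  shows "(\<lambda>k. \<integral>\<^sup>+\<xi>. ennreal ((1 + \<xi>\<^sup>2) powr s * (cmod (F k \<xi> - g \<xi>))\<^sup>2) \<partial>lborel) \<longlonglongrightarrow> 0"
proof -
  let ?p = "\<lambda>k \<xi>. (1 + \<xi>\<^sup>2) powr s * (cmod (F k \<xi> - g \<xi>))\<^sup>2"
  let ?q = "\<lambda>f \<xi>. (1 + \<xi>\<^sup>2) powr t * (cmod (f \<xi>))\<^sup>2"
  have gm [measurable]: "g \<in> borel_measurable borel"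
    by (rule borel_measurable_LIMSEQ_metric[OF Fm lim])
  have g1: "cmod (g \<xi>) \<le> 1" for \<xi>
    by (rule tendsto_upperbound[OF tendsto_norm[OF lim]]) (use b1 in auto)
  have gb: "(\<integral>\<^sup>+\<xi>. ennreal (?q g \<xi>) \<partial>lborel) \<le> ennreal K"
  proof -
    have "(\<integral>\<^sup>+\<xi>. ennreal (?q g \<xi>) \<partial>lborel) = (\<integral>\<^sup>+\<xi>. liminf (\<lambda>k. ennreal (?q (F k) \<xi>)) \<partial>lborel)"
      by (intro nn_integral_cong lim_imp_Liminf[symmetric] tendsto_ennrealI tendsto_intros lim) simp
    also have "\<dots> \<le> liminf (\<lambda>k. \<integral>\<^sup>+\<xi>. ennreal (?q (F k) \<xi>) \<partial>lborel)"
      by (rule nn_integral_liminf) measurable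
    also have "\<dots> \<le> ennreal K" using bound by (intro Liminf_le) (auto intro!: always_eventually)
    finally show ?thesis .
  qed
  define \<delta> where "\<delta> = t - s"
  have \<delta>: "\<delta> > 0" using s by (simp add: \<delta>_def)
  let ?X = "\<lambda>k. \<integral>\<^sup>+\<xi>. ennreal (?p k \<xi>) \<partial>lborel"
  have ev: "\<forall>\<^sub>F k in sequentially. ?X k \<le> ennreal e" if e: "e > 0" for e
  proof -
    have "(\<lambda>n. (1 + (real n)\<^sup>2) powr (- \<delta>)) \<longlonglongrightarrow> 0"
    proof (rule tendsto_neg_powr)
      show "- \<delta> < 0" using \<delta> by simp
      show "filterlim (\<lambda>n. 1 + (real n)\<^sup>2) at_top sequentially"
      proof (rule filterlim_at_top_mono[OF filterlim_real_sequentially])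
        show "\<forall>\<^sub>F n in sequentially. real n \<le> 1 + (real n)\<^sup>2"
        proof (intro always_eventually allI)
          fix n show "real n \<le> 1 + (real n)\<^sup>2" using sum_squares_bound[of "real n" 1] of_nat_0_le_iff[of n, where 'a = real] by (simp add: add.commute)
        qed
      qed
    qed
    then have "(\<lambda>n. (1 + (real n)\<^sup>2) powr (- \<delta>) * (4 * K)) \<longlonglongrightarrow> 0 * (4 * K)" by (intro tendsto_intros)
    then have "\<forall>\<^sub>F n in sequentially. (1 + (real n)\<^sup>2) powr (- \<delta>) * (4 * K) < e / 2"
      by (rule order_tendstoD) (use e in simp)
    then obtain n where n: "(1 + (real n)\<^sup>2) powr (- \<delta>) * (4 * K) < e / 2" by (auto simp: eventually_sequentially)
    define c where "c = (1 + (real n)\<^sup>2) powr (- \<delta>)"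
    have c0: "c \<ge> 0" by (simp add: c_def)
    define I where "I = {- real n..real n}"
    let ?Y = "\<lambda>k. \<integral>\<^sup>+\<xi>. ennreal (indicat_real I \<xi> * (?p k \<xi>)) \<partial>lborel"
    have Im [measurable]: "I \<in> sets borel" unfolding I_def by simp
    have "?Y \<longlonglongrightarrow> (\<integral>\<^sup>+\<xi>. 0 \<partial>(lborel :: real measure))"
    proof (rule nn_integral_dominated_convergence[where w = "\<lambda>\<xi>. ennreal ((1 + (real n)\<^sup>2) powr s * 4) * indicator I \<xi>"])
      show "AE \<xi> in lborel. ennreal (indicat_real I \<xi> * (?p k \<xi>)) \<le> ennreal ((1 + (real n)\<^sup>2) powr s * 4) * indicator I \<xi>" for k
      proof (rule AE_I2)
        fix \<xi> :: real
        show "ennreal (indicat_real I \<xi> * (?p k \<xi>)) \<le> ennreal ((1 + (real n)\<^sup>2) powr s * 4) * indicator I \<xi>"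
        proof (cases "\<xi> \<in> I")
          case True
          then have "\<bar>\<xi>\<bar> \<le> real n" by (auto simp: I_def)
          then have "\<xi>\<^sup>2 \<le> (real n)\<^sup>2" by (simp add: abs_le_square_iff[symmetric])
          then have w: "(1 + \<xi>\<^sup>2) powr s \<le> (1 + (real n)\<^sup>2) powr s" using s by (intro powr_mono2) auto
          have "cmod (F k \<xi> - g \<xi>) \<le> 2" using norm_triangle_ineq4[of "F k \<xi>" "g \<xi>"] b1[of k \<xi>] g1[of \<xi>] by linarith
          then have "(cmod (F k \<xi> - g \<xi>))\<^sup>2 \<le> 2\<^sup>2" by (intro power_mono) auto
          then have "?p k \<xi> \<le> (1 + (real n)\<^sup>2) powr s * 4"
            using w by (intro mult_mono) auto
          then show ?thesis using True by (simp add: ennreal_leI)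
        qed simp
      qed
      show "(\<integral>\<^sup>+\<xi>. ennreal ((1 + (real n)\<^sup>2) powr s * 4) * indicator I \<xi> \<partial>lborel) < \<infinity>"
        by (subst nn_integral_cmult_indicator) (auto simp: I_def ennreal_mult_less_top)
      show "AE \<xi> in lborel. (\<lambda>k. ennreal (indicat_real I \<xi> * (?p k \<xi>))) \<longlonglongrightarrow> 0"
      proof (rule AE_I2)
        fix \<xi> :: real
        have "(\<lambda>k. indicat_real I \<xi> * (?p k \<xi>)) \<longlonglongrightarrow> indicat_real I \<xi> * ((1 + \<xi>\<^sup>2) powr s * (cmod (g \<xi> - g \<xi>))\<^sup>2)"
          by (intro tendsto_intros lim)
        then show "(\<lambda>k. ennreal (indicat_real I \<xi> * (?p k \<xi>))) \<longlonglongrightarrow> 0"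
          using tendsto_ennrealI by fastforce
      qed
    qed measurable
    then have "?Y \<longlonglongrightarrow> 0" by simp
    then have evY: "\<forall>\<^sub>F k in sequentially. ?Y k < ennreal (e / 2)" by (rule order_tendstoD) (use e in simp)
    have XY: "?X k \<le> ?Y k + ennreal (c * (4 * K))" for k
    proof -
      have pt: "?p k \<xi> \<le> indicat_real I \<xi> * (?p k \<xi>)
          + c * (2 * (?q (F k) \<xi>) + 2 * (?q g \<xi>))" for \<xi>
      proof (cases "\<xi> \<in> I")
        case True
        have "0 \<le> c * (2 * (?q (F k) \<xi>) + 2 * (?q g \<xi>))"
          using c0 by simp
        then show ?thesis using True by simp
      next
        case False
        then have "real n \<le> \<bar>\<xi>\<bar>" by (auto simp: I_def)
        then have "(real n)\<^sup>2 \<le> \<xi>\<^sup>2" by (simp add: abs_le_square_iff[symmetric])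
        then have "(1 + \<xi>\<^sup>2) powr (- \<delta>) \<le> c" unfolding c_def using \<delta> by (intro powr_mono2') (auto simp: add_pos_nonneg)
        then have "(1 + \<xi>\<^sup>2) powr (- \<delta>) * (1 + \<xi>\<^sup>2) powr t \<le> c * (1 + \<xi>\<^sup>2) powr t" by (rule mult_right_mono) simp
        then have w: "(1 + \<xi>\<^sup>2) powr s \<le> c * (1 + \<xi>\<^sup>2) powr t"
          unfolding powr_add[symmetric] by (simp add: \<delta>_def)
        have "(cmod (F k \<xi> - g \<xi>))\<^sup>2 \<le> (cmod (F k \<xi>) + cmod (g \<xi>))\<^sup>2"
          by (intro power_mono norm_triangle_ineq4) simp
        also have "\<dots> \<le> 2 * (cmod (F k \<xi>))\<^sup>2 + 2 * (cmod (g \<xi>))\<^sup>2"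
          using sum_squares_bound[of "cmod (F k \<xi>)" "cmod (g \<xi>)"] by (simp add: power2_sum)
        finally have "?p k \<xi> \<le> (c * (1 + \<xi>\<^sup>2) powr t) * (2 * (cmod (F k \<xi>))\<^sup>2 + 2 * (cmod (g \<xi>))\<^sup>2)"
          using w c0 by (intro mult_mono) auto
        then show ?thesis using False by (simp add: algebra_simps)
      qed
      have "?X k \<le> (\<integral>\<^sup>+\<xi>. ennreal (indicat_real I \<xi> * (?p k \<xi>))
          + ennreal c * (2 * ennreal (?q (F k) \<xi>) + 2 * ennreal (?q g \<xi>)) \<partial>lborel)"
      proof (rule nn_integral_mono)
        fix \<xi> :: real
        have "ennreal (?p k \<xi>) \<le> ennreal (indicat_real I \<xi> * (?p k \<xi>)
          + c * (2 * (?q (F k) \<xi>) + 2 * (?q g \<xi>)))"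
          by (rule ennreal_leI[OF pt])
        also have "\<dots> = ennreal (indicat_real I \<xi> * (?p k \<xi>))
          + ennreal (c * (2 * (?q (F k) \<xi>) + 2 * (?q g \<xi>)))"
          using c0 by (intro ennreal_plus) auto
        also have "ennreal (c * (2 * (?q (F k) \<xi>) + 2 * (?q g \<xi>)))
          = ennreal c * (2 * ennreal (?q (F k) \<xi>) + 2 * ennreal (?q g \<xi>))"
          using c0 by (subst ennreal_mult, simp, simp, subst ennreal_plus, simp, simp, subst ennreal_mult, simp, simp, subst (2) ennreal_mult, simp, simp, simp)
        finally show "ennreal (?p k \<xi>) \<le> ennreal (indicat_real I \<xi> * (?p k \<xi>))
          + ennreal c * (2 * ennreal (?q (F k) \<xi>) + 2 * ennreal (?q g \<xi>))" .
      qed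
      also have "\<dots> = ?Y k + ennreal c * (2 * (\<integral>\<^sup>+\<xi>. ennreal (?q (F k) \<xi>) \<partial>lborel) + 2 * (\<integral>\<^sup>+\<xi>. ennreal (?q g \<xi>) \<partial>lborel))"
        by (subst nn_integral_add, measurable, subst nn_integral_cmult, measurable, subst nn_integral_add, measurable, subst nn_integral_cmult, measurable, subst nn_integral_cmult, measurable)
      also have "\<dots> \<le> ?Y k + ennreal c * (2 * ennreal K + 2 * ennreal K)"
        by (intro add_left_mono mult_left_mono add_mono bound gb) auto
      also have "ennreal c * (2 * ennreal K + 2 * ennreal K) = ennreal (c * (4 * K))"
      proof -
        have "2 * ennreal K + 2 * ennreal K = ennreal (4 * K)" using K by (simp add: ennreal_mult distrib_right[symmetric])
        then show ?thesis using c0 K by (simp add: ennreal_mult)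
      qed
      finally show ?thesis .
    qed
    show ?thesis
      using evY
    proof eventually_elim
      case (elim k)
      have "?X k \<le> ?Y k + ennreal (c * (4 * K))" by (rule XY)
      also have "\<dots> \<le> ?Y k + ennreal (e / 2)" using n by (intro add_left_mono ennreal_leI) (simp add: c_def)
      also have "\<dots> \<le> ennreal (e / 2) + ennreal (e / 2)" using elim by (intro add_right_mono less_imp_le)
      also have "\<dots> = ennreal e" using e by (simp flip: ennreal_plus)
      finally show ?case .
    qed
  qed
  show ?thesis
  proof (rule order_tendstoI)
    fix a :: ennreal assume "0 < a"
    then obtain b where b: "0 < b" "b < a" using dense by blast
    then obtain e where e: "b = ennreal e" "0 \<le> e" by (cases b) auto
    then have "e > 0" using b by (simp add: ennreal_less_zero_iff)
    from ev[OF this] show "\<forall>\<^sub>F k in sequentially. ?X k < a"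
      by eventually_elim (use b e in \<open>auto intro: le_less_trans\<close>)
  qed simp
qed

lemma ennreal_le_twice_add:
  assumes "a \<le> 2 * b + 2 * c" "0 \<le> b" "0 \<le> c"
  shows "ennreal a \<le> 2 * ennreal b + 2 * ennreal c"
proof -
  have "ennreal a \<le> ennreal (2 * b + 2 * c)" by (rule ennreal_leI) (rule assms)
  also have "\<dots> = ennreal (2 * b) + ennreal (2 * c)" using assms by (intro ennreal_plus) auto
  finally show ?thesis using assms by (simp add: ennreal_mult)
qed

lemma fast_subsequence:
  fixes X :: "nat \<Rightarrow> ennreal"
  assumes X: "X \<longlonglongrightarrow> 0" and e: "\<And>k. e k > (0::real)"
  obtains r where "strict_mono (r :: nat \<Rightarrow> nat)" "\<And>k. X (r k) \<le> ennreal (e k)"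
proof -
  have "\<exists>N. \<forall>n\<ge>N. X n < ennreal (e k)" for k
    using order_tendstoD(2)[OF X, of "ennreal (e k)"] e[of k] by (simp add: eventually_sequentially)
  then obtain N where N: "\<And>k n. n \<ge> N k \<Longrightarrow> X n < ennreal (e k)" by metis
  define r where "r = rec_nat (N 0) (\<lambda>k m. max (N (Suc k)) (Suc m))"
  have r0: "r 0 = N 0" and rS: "r (Suc k) = max (N (Suc k)) (Suc (r k))" for k
    by (simp_all add: r_def)
  have "strict_mono r" by (rule strict_monoI_Suc) (simp add: rS)
  moreover have "r k \<ge> N k" for k by (cases k) (simp_all add: r0 rS)
  ultimately show ?thesis using that[of r] N by (meson less_imp_le)
qed

text \<open>
  The profiles form a Cauchy sequence in \<open>L\<^sup>2\<close> by Plancherel's theorem, so that a rapidly converging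
  subsequence converges almost everywhere. Its pointwise upper limit inherits the bounds, and dominated
  convergence identifies its transform and its mass.
\<close>

lemma mass_profile_limit:
  fixes a :: "nat \<Rightarrow> real \<Rightarrow> real"
  assumes a: "\<And>k. mass_profile B \<rho> (a k)" and lim: "\<And>\<xi>. (\<lambda>k. FT (cfun (a k)) \<xi>) \<longlonglongrightarrow> g \<xi>"
    and L2: "(\<lambda>k. \<integral>\<^sup>+\<xi>. ennreal ((cmod (FT (cfun (a k)) \<xi> - g \<xi>))\<^sup>2) \<partial>lborel) \<longlonglongrightarrow> 0"
  obtains A where "mass_profile B \<rho> A" "\<And>\<xi>. g \<xi> = FT (cfun A) \<xi>"
proof -
  have am [measurable]: "a k \<in> borel_measurable borel" for k by (rule mass_profileD(1)[OF a])
  have gm [measurable]: "g \<in> borel_measurable borel"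
    by (rule borel_measurable_LIMSEQ_metric[OF _ lim]) measurable
  let ?X = "\<lambda>k. \<integral>\<^sup>+\<xi>. ennreal ((cmod (FT (cfun (a k)) \<xi> - g \<xi>))\<^sup>2) \<partial>lborel"
  obtain r where r: "strict_mono (r :: nat \<Rightarrow> nat)" and rX: "\<And>k. ?X (r k) \<le> ennreal ((1/8) ^ k)"
    using fast_subsequence[OF L2, of "\<lambda>k. (1/8) ^ k"] by auto
  define b where "b = (\<lambda>k. a (r k))"
  have b: "mass_profile B \<rho> (b k)" for k unfolding b_def by (rule a)
  have bm [measurable]: "b k \<in> borel_measurable borel" for k by (rule mass_profileD(1)[OF b])
  have bcs: "bounded_cs (cfun (b k))" for k by (rule mass_profile_bounded_cs[OF b])
  let ?d = "\<lambda>k x. b (Suc k) x - b k x"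
  have d2: "(\<integral>\<^sup>+x. ennreal ((?d k x)\<^sup>2) \<partial>lborel) \<le> ennreal (4 * (1/8) ^ k)" for k
  proof -
    let ?F = "\<lambda>k. FT (cfun (b k))"
    have dcs: "bounded_cs (\<lambda>x. cfun (b (Suc k)) x - cfun (b k) x)" by (intro bounded_cs_diff bcs)
    have i: "integrable lborel (\<lambda>x. (cmod (cfun (b (Suc k)) x - cfun (b k) x))\<^sup>2)"
      by (rule bounded_cs_square_integrable[OF dcs])
    let ?I = "LINT x|lborel. (cmod (cfun (b (Suc k)) x - cfun (b k) x))\<^sup>2"
    have "(\<integral>\<^sup>+x. ennreal ((?d k x)\<^sup>2) \<partial>lborel) = (\<integral>\<^sup>+x. ennreal ((cmod (cfun (b (Suc k)) x - cfun (b k) x))\<^sup>2) \<partial>lborel)"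
      by (simp only: of_real_diff[symmetric] norm_of_real power2_abs)
    also have "\<dots> = ennreal ?I" by (rule nn_integral_eq_integral[OF i]) simp
    also have "\<dots> \<le> ennreal ((2 * pi) ^ DIM(real) * ?I)"
    proof (rule ennreal_leI)
      have "1 * ?I \<le> (2 * pi) * ?I" using pi_gt3 by (intro mult_right_mono) (auto intro!: Bochner_Integration.integral_nonneg)
      then show "?I \<le> (2 * pi) ^ DIM(real) * ?I" by simp
    qed
    also have "\<dots> = (\<integral>\<^sup>+\<xi>. ennreal ((cmod (?F (Suc k) \<xi> - ?F k \<xi>))\<^sup>2) \<partial>lborel)"
      unfolding plancherel_FT[OF dcs, symmetric] FT_diff[OF bcs bcs] ..
    also have "\<dots> \<le> (\<integral>\<^sup>+\<xi>. 2 * ennreal ((cmod (?F (Suc k) \<xi> - g \<xi>))\<^sup>2) + 2 * ennreal ((cmod (?F k \<xi> - g \<xi>))\<^sup>2) \<partial>lborel)"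
    proof (rule nn_integral_mono)
      fix \<xi> :: real
      have "(cmod (?F (Suc k) \<xi> - ?F k \<xi>))\<^sup>2 \<le> (cmod (?F (Suc k) \<xi> - g \<xi>) + cmod (?F k \<xi> - g \<xi>))\<^sup>2"
        using norm_triangle_ineq4[of "?F (Suc k) \<xi> - g \<xi>" "?F k \<xi> - g \<xi>"] by (intro power_mono) auto
      also have "\<dots> \<le> 2 * (cmod (?F (Suc k) \<xi> - g \<xi>))\<^sup>2 + 2 * (cmod (?F k \<xi> - g \<xi>))\<^sup>2"
        using sum_squares_bound[of "cmod (?F (Suc k) \<xi> - g \<xi>)" "cmod (?F k \<xi> - g \<xi>)"] by (simp add: power2_sum)
      finally show "ennreal ((cmod (?F (Suc k) \<xi> - ?F k \<xi>))\<^sup>2) \<le> 2 * ennreal ((cmod (?F (Suc k) \<xi> - g \<xi>))\<^sup>2) + 2 * ennreal ((cmod (?F k \<xi> - g \<xi>))\<^sup>2)"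
        by (rule ennreal_le_twice_add) auto
    qed
    also have "\<dots> = 2 * ?X (r (Suc k)) + 2 * ?X (r k)"
      unfolding b_def by (subst nn_integral_add, measurable, subst nn_integral_cmult, measurable, subst nn_integral_cmult, measurable)
    also have "\<dots> \<le> 2 * ennreal ((1/8) ^ Suc k) + 2 * ennreal ((1/8) ^ k)"
      by (intro add_mono mult_left_mono rX) auto
    also have "\<dots> = ennreal (2 * (1/8) ^ Suc k + 2 * (1/8) ^ k)"
      by (subst ennreal_plus, simp, simp, subst ennreal_mult, simp, simp, subst ennreal_mult, simp, simp, simp)
    also have "\<dots> \<le> ennreal (4 * (1/8) ^ k)" by (intro ennreal_leI) simp
    finally show ?thesis .
  qed
  have "(\<integral>\<^sup>+x. (\<Sum>k. ennreal (2 ^ k * (?d k x)\<^sup>2)) \<partial>lborel) = (\<Sum>k. \<integral>\<^sup>+x. ennreal (2 ^ k * (?d k x)\<^sup>2) \<partial>lborel)"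
    by (rule nn_integral_suminf) measurable
  also have "\<dots> \<le> (\<Sum>k. ennreal (4 * (1/4) ^ k))"
  proof (rule suminf_le)
    fix k
    have "(\<integral>\<^sup>+x. ennreal (2 ^ k * (?d k x)\<^sup>2) \<partial>lborel) = ennreal (2 ^ k) * (\<integral>\<^sup>+x. ennreal ((?d k x)\<^sup>2) \<partial>lborel)"
      by (subst nn_integral_cmult[symmetric]) (auto simp: ennreal_mult)
    also have "\<dots> \<le> ennreal (2 ^ k) * ennreal (4 * (1/8) ^ k)" by (intro mult_left_mono d2) auto
    also have "\<dots> = ennreal (4 * (1/4) ^ k)"
      by (subst ennreal_mult[symmetric]) (auto simp: power_divide power_mult_distrib[symmetric] field_simps)
    finally show "(\<integral>\<^sup>+x. ennreal (2 ^ k * (?d k x)\<^sup>2) \<partial>lborel) \<le> ennreal (4 * (1/4) ^ k)" .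
  qed auto
  also have "\<dots> < \<infinity>"
  proof -
    have "summable (\<lambda>k. 4 * (1/4 :: real) ^ k)" by (intro summable_mult summable_geometric) simp
    then have "(\<Sum>k. ennreal (4 * (1/4) ^ k)) \<noteq> top" by (rule ennreal_suminf_neq_top) simp
    then show ?thesis by (simp add: less_top)
  qed
  finally have "AE x in lborel. (\<Sum>k. ennreal (2 ^ k * (?d k x)\<^sup>2)) \<noteq> \<infinity>"
    by (intro nn_integral_PInf_AE) auto
  then have AEc: "AE x in lborel. convergent (\<lambda>k. b k x)"
  proof eventually_elim
    case (elim x)
    have s1: "summable (\<lambda>k. 2 ^ k * (?d k x)\<^sup>2)"
      by (rule summable_suminf_not_top) (use elim in auto)
    have s2: "summable (\<lambda>k. (1/2 :: real) ^ k + 2 ^ k * (?d k x)\<^sup>2)"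
      by (intro summable_add s1 summable_geometric) simp
    have "summable (\<lambda>k. ?d k x)"
    proof (rule summable_comparison_test[OF _ s2], intro exI allI impI)
      fix k
      \<comment> \<open>Either \<open>1 / t\<close> or \<open>t\<close> times the square dominates, and both are summable for \<open>t = 2\<^sup>k\<close>.\<close>
      define t where "t = (2::real) ^ k"
      have t: "t > 0" by (simp add: t_def)
      have "2 * (t * \<bar>?d k x\<bar>) * 1 \<le> (t * \<bar>?d k x\<bar>)\<^sup>2 + 1\<^sup>2" by (rule sum_squares_bound)
      moreover have "0 \<le> t * \<bar>?d k x\<bar>" using t by simp
      moreover have "(t * \<bar>?d k x\<bar>)\<^sup>2 = t * (t * (?d k x)\<^sup>2)"
        by (simp add: power_mult_distrib power2_eq_square[of t])
      ultimately have "t * \<bar>?d k x\<bar> \<le> t * (t * (?d k x)\<^sup>2) + 1" by simp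
      also have "\<dots> = t * (1 / t + t * (?d k x)\<^sup>2)" using t by (simp add: distrib_left)
      finally have "\<bar>?d k x\<bar> \<le> 1 / t + t * (?d k x)\<^sup>2" using t by simp
      then show "norm (?d k x) \<le> (1/2) ^ k + 2 ^ k * (?d k x)\<^sup>2"
        by (simp add: t_def power_divide)
    qed
    then have "convergent (\<lambda>n. \<Sum>k<n. ?d k x)" by (simp add: summable_iff_convergent)
    then have "convergent (\<lambda>n. b n x - b 0 x)" unfolding sum_lessThan_telescope[of "\<lambda>k. b k x"] .
    then have "convergent (\<lambda>n. (b n x - b 0 x) + b 0 x)" by (rule convergent_add[OF _ convergent_const])
    then show ?case by simp
  qed
  define A where "A = (\<lambda>x. enn2real (limsup (\<lambda>k. ennreal (b k x))))"
  have Am [measurable]: "A \<in> borel_measurable borel" unfolding A_def by measurable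
  have AE_lim: "AE x in lborel. (\<lambda>k. b k x) \<longlonglongrightarrow> A x"
    using AEc
  proof eventually_elim
    case (elim x)
    then obtain l where l: "(\<lambda>k. b k x) \<longlonglongrightarrow> l" by (auto simp: convergent_def)
    have "l \<ge> 0" by (rule LIMSEQ_le_const[OF l]) (use mass_profileD(2)[OF b] in auto)
    moreover have "limsup (\<lambda>k. ennreal (b k x)) = ennreal l"
      by (rule lim_imp_Limsup) (use tendsto_ennrealI[OF l] in auto)
    ultimately have "A x = l" by (simp add: A_def)
    then show ?case using l by simp
  qed
  have B0: "0 \<le> B * indicat_real (ball 0 \<rho>) x" for x :: real
    using mass_profileD(2,3)[OF b, of 0 x] by linarith
  have A_le: "A x \<le> B * indicat_real (ball 0 \<rho>) x" for x
  proof -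
    have "limsup (\<lambda>k. ennreal (b k x)) \<le> ennreal (B * indicat_real (ball 0 \<rho>) x)"
      by (rule Limsup_bounded) (auto intro!: always_eventually ennreal_leI mass_profileD(3)[OF b])
    then have "A x \<le> enn2real (ennreal (B * indicat_real (ball 0 \<rho>) x))"
      unfolding A_def by (intro enn2real_mono) auto
    then show ?thesis using B0 by simp
  qed
  have dom: "(\<lambda>k. FT (cfun (b k)) \<xi>) \<longlonglongrightarrow> FT (cfun A) \<xi>" for \<xi>
    unfolding FT_def
  proof (rule integral_dominated_convergence[where w = "\<lambda>x. B * indicat_real (ball 0 \<rho>) x"])
    show "integrable lborel (\<lambda>x. B * indicat_real (ball (0::real) \<rho>) x)" by (rule integrable_indicator_ball)
    show "AE x in lborel. (\<lambda>k. cfun (b k) x * exp (- \<i> * complex_of_real (x \<bullet> \<xi>))) \<longlonglongrightarrow> cfun A x * exp (- \<i> * complex_of_real (x \<bullet> \<xi>))"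
      using AE_lim by eventually_elim (intro tendsto_intros)
    show "AE x in lborel. norm (cfun (b k) x * exp (- \<i> * complex_of_real (x \<bullet> \<xi>))) \<le> B * indicat_real (ball 0 \<rho>) x" for k
      by (rule AE_I2) (use mass_profileD(2,3)[OF b] in \<open>simp add: norm_mult\<close>)
  qed measurable
  have gA: "g \<xi> = FT (cfun A) \<xi>" for \<xi>
  proof (rule LIMSEQ_unique[OF _ dom])
    show "(\<lambda>k. FT (cfun (b k)) \<xi>) \<longlonglongrightarrow> g \<xi>"
      unfolding b_def using LIMSEQ_subseq_LIMSEQ[OF lim r, of \<xi>] by (simp add: o_def)
  qed
  have F0: "FT (cfun c) 0 = complex_of_real (LINT x|lborel. c x)" for c
    unfolding FT_def by simp
  have "FT (cfun A) 0 = 1"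
    using dom[of 0] mass_profileD(4)[OF b] unfolding F0 by (simp add: LIMSEQ_const_iff)
  then have "(LINT x|lborel. A x) = 1" unfolding F0 by (metis of_real_eq_1_iff)
  then have "mass_profile B \<rho> A"
    unfolding mass_profile_def using A_le by (auto simp: A_def)
  then show ?thesis using gA by (rule that)
qed

lemma fourier_norm_le_FT: "f \<in> borel_measurable borel \<Longrightarrow> cmod (fourier f \<xi>) \<le> cmod (FT f \<xi>)" for f :: "real \<Rightarrow> complex"
proof -
  assume f: "f \<in> borel_measurable borel"
  have "(2 * pi) powr (- 1 / 2) \<le> 1"
    using pi_gt3 powr_mono[of "- 1 / 2" 0 "2 * pi"] by simp
  then have "(2 * pi) powr (- 1 / 2) * cmod (FT f \<xi>) \<le> 1 * cmod (FT f \<xi>)" by (intro mult_right_mono) auto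
  then show ?thesis by (simp add: fourier_eq_FT[OF f] norm_mult)
qed

lemma sobolev_FT:
  fixes f g :: "real \<Rightarrow> real"
  assumes fm: "f \<in> borel_measurable lebesgue" and g: "bounded_cs (cfun g)"
    and eq: "AE x in lborel. f x = g x"
    and fin: "(\<integral>\<^sup>+\<xi>. ennreal ((1 + \<xi>\<^sup>2) powr s * (cmod (FT (cfun g) \<xi>))\<^sup>2) \<partial>lborel) < \<infinity>"
  shows "f \<in> sobolev s" "ennreal ((sobolev_norm s f)\<^sup>2) \<le> (\<integral>\<^sup>+\<xi>. ennreal ((1 + \<xi>\<^sup>2) powr s * (cmod (FT (cfun g) \<xi>))\<^sup>2) \<partial>lborel)"
proof -
  have gm: "cfun g \<in> borel_measurable borel" using g by (simp add: bounded_cs_def)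
  have eq': "AE x in lborel. cfun f x = cfun g x" using eq by eventually_elim simp
  have le: "(\<integral>\<^sup>+\<xi>. ennreal ((1 + \<xi>\<^sup>2) powr s * (cmod (fourier (cfun g) \<xi>))\<^sup>2) \<partial>lborel) \<le> (\<integral>\<^sup>+\<xi>. ennreal ((1 + \<xi>\<^sup>2) powr s * (cmod (FT (cfun g) \<xi>))\<^sup>2) \<partial>lborel)"
    by (intro nn_integral_mono ennreal_leI mult_left_mono power_mono fourier_norm_le_FT gm) auto
  show "f \<in> sobolev s"
    unfolding sobolev_weight_integral(1)[OF fm g eq'] using le fin by (rule le_less_trans)
  show "ennreal ((sobolev_norm s f)\<^sup>2) \<le> (\<integral>\<^sup>+\<xi>. ennreal ((1 + \<xi>\<^sup>2) powr s * (cmod (FT (cfun g) \<xi>))\<^sup>2) \<partial>lborel)"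
    using sobolev_weight_integral(2)[OF fm g eq', of s] le by (rule order_trans)
qed

section \<open>Weak convergence\<close>

lemma freq_cutoff_eventually_ge:
  assumes \<epsilon>: "\<epsilon> \<longlonglongrightarrow> (0::real)" "\<And>k. 0 < \<epsilon> k" "\<And>k. \<epsilon> k < 1" and K: "K > 0"
  shows "\<forall>\<^sub>F k in sequentially. K \<le> freq_cutoff n (\<epsilon> k)"
proof -
  have "\<forall>\<^sub>F k in sequentially. \<epsilon> k < K powr (- 4)"
    by (rule order_tendstoD(2)[OF \<epsilon>(1)]) (use K in simp)
  then show ?thesis
  proof eventually_elim
    case (elim k)
    have "K = (K powr (- 4)) powr (- 1 / 4)" using K by (simp add: powr_powr)
    also have "\<dots> \<le> \<epsilon> k powr (- 1 / 4)" using elim \<epsilon>(2)[of k] by (intro powr_mono2') auto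
    also have "\<dots> \<le> freq_cutoff n (\<epsilon> k)"
    proof -
      have "\<epsilon> k powr (- 1 / 4) \<le> \<epsilon> k powr (- 2 / 3)" "\<epsilon> k powr (- 1 / 4) \<le> \<epsilon> k powr (- 1)"
        using \<epsilon>(2,3)[of k] by (intro powr_mono'; simp)+
      moreover have "\<epsilon> k powr (- 1) = 1 / \<epsilon> k" using powr_minus_divide[of "\<epsilon> k" 1] \<epsilon>(2)[of k] by simp
      ultimately show ?thesis by (simp add: freq_cutoff_def)
    qed
    finally show ?case .
  qed
qed

lemma sobolev_weight_le:
  assumes "n = 2 \<Longrightarrow> s \<le> 1 / 2" "s \<le> 1"
  shows "(1 + \<xi>\<^sup>2) powr s \<le> 1 + freq_weight n \<xi>"
proof (cases "n = 2")
  case True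
  have "(1 + \<xi>\<^sup>2) powr s \<le> (1 + \<xi>\<^sup>2) powr (1 / 2)" using assms(1)[OF True] by (intro powr_mono) auto
  also have "\<dots> = sqrt (1 + \<xi>\<^sup>2)" by (rule powr_half_sqrt) simp
  also have "\<dots> \<le> 1 + \<bar>\<xi>\<bar>" by (rule real_le_lsqrt) (auto simp: power2_eq_square algebra_simps)
  finally show ?thesis using True by (simp add: freq_weight_def)
next
  case False
  have "(1 + \<xi>\<^sup>2) powr s \<le> (1 + \<xi>\<^sup>2) powr 1" using assms(2) by (intro powr_mono) auto
  then show ?thesis using False by (simp add: freq_weight_def)
qed

text \<open>
  The factor in front of the energy bound accounts for the unnormalised transform \<open>FT\<close>.
\<close>

lemma finite_energy_representative:
  fixes u :: "real \<times> (real^'m) \<Rightarrow> real"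
  assumes \<rho>: "\<rho> > 0" and \<epsilon>: "\<epsilon> > 0" and adm: "u \<in> admissible" and C: "C \<ge> 0"
    and energy: "energy \<epsilon> u \<le> ennreal C" and supp: "ess_support u \<subseteq> ball 0 \<rho>"
  obtains v where "cs_indicator \<rho> v" "AE x in lborel. u x = v x"
    "ennreal (prefactor (CARD('m) + 1) \<epsilon>) * nonlocal \<epsilon> v \<le> ennreal ((2 * pi) ^ (CARD('m) + 1) * C)"
    "\<And>\<xi>. \<epsilon> * \<bar>\<xi>\<bar> * cmod (FT (cfun (section_area v)) \<xi>) \<le> 2 * C"
    "mass_profile (measure lborel (ball (0::real^'m) \<rho>)) \<rho> (section_area v)"
proof -
  let ?n = "CARD('m) + 1"
  have um: "u \<in> borel_measurable lebesgue" and u01: "AE x in lebesgue. u x \<in> {0, 1}" and u1: "(LINT x|lebesgue. u x) = 1"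
    using adm borel_measurable_integrable unfolding admissible_def BV_def by auto
  obtain v where v: "cs_indicator \<rho> v" and eq: "AE x in lborel. u x = v x"
    using borel_representative[OF um u01 supp] by blast
  have E: "aniso_variation \<epsilon> u + nonlocal_energy \<epsilon> u \<le> ennreal C"
    using energy adm unfolding energy_def by simp
  have "aniso_variation \<epsilon> u \<le> aniso_variation \<epsilon> u + nonlocal_energy \<epsilon> u" by simp
  from order_trans[OF this E] have TV: "aniso_variation \<epsilon> u \<le> ennreal C" .
  have "nonlocal_energy \<epsilon> u \<le> aniso_variation \<epsilon> u + nonlocal_energy \<epsilon> u" by simp
  from order_trans[OF this E] have NL: "nonlocal_energy \<epsilon> u \<le> ennreal C" .
  have "ennreal (prefactor ?n \<epsilon>) * nonlocal \<epsilon> v = ennreal ((2 * pi) ^ ?n) * nonlocal_energy \<epsilon> u"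
    by (rule nonlocal_energy_eq[OF v um eq])
  also have "\<dots> \<le> ennreal ((2 * pi) ^ ?n) * ennreal C" by (intro mult_left_mono NL) simp
  also have "\<dots> = ennreal ((2 * pi) ^ ?n * C)" using C by (intro ennreal_mult[symmetric]) auto
  finally have N: "ennreal (prefactor ?n \<epsilon>) * nonlocal \<epsilon> v \<le> ennreal ((2 * pi) ^ ?n * C)" .
  have decay: "\<epsilon> * \<bar>\<xi>\<bar> * cmod (FT (cfun (section_area v)) \<xi>) \<le> 2 * C" for \<xi>
    by (rule FT_section_area_decay[OF \<rho> v eq TV C \<epsilon>])
  have vm: "v \<in> borel_measurable borel" by (rule cs_indicatorD(1)[OF v])
  have "(LINT x|lebesgue. u x) = (LINT x|lebesgue. v x)"
    by (rule integral_cong_AE[OF um _ AE_completion[OF eq]]) (use vm in \<open>auto intro: measurable_completion\<close>)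
  also have "\<dots> = (LINT x|lborel. v x)" using vm by (intro integral_completion) simp
  finally have v1: "(LINT x|lborel. v x) = 1" using u1 by simp
  have "complex_of_real (LINT x|lborel. section_area v x) = FT (cfun (section_area v)) 0" by (simp add: FT_def)
  also have "\<dots> = FT (cfun v) (0, 0)" by (rule FT_section_area[OF v])
  also have "\<dots> = complex_of_real (LINT x|lborel. v x)" by (simp add: FT_def zero_prod_def[symmetric])
  finally have "(LINT x|lborel. section_area v x) = 1" unfolding v1 of_real_eq_iff .
  then have "mass_profile (measure lborel (ball (0::real^'m) \<rho>)) \<rho> (section_area v)"
    unfolding mass_profile_def by (intro conjI allI section_area_bounds[OF v])
  from that[OF v eq N decay this] show ?thesis .
qed

text \<open>
  Weak convergence from convergence in the norm, where \<open>X\<close> bounds the squared distances and may be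
  infinite at the beginning.
\<close>

lemma sobolev_weakly_convergesI:
  assumes f: "\<And>k. f k \<in> sobolev s" and A: "A \<in> sobolev s" and X: "X \<longlonglongrightarrow> (0::ennreal)"
    and D: "\<And>k. X k < \<infinity> \<Longrightarrow> (\<lambda>x. f k x - A x) \<in> sobolev s \<and>
      ennreal ((sobolev_norm s (\<lambda>x. f k x - A x))\<^sup>2) \<le> X k"
  shows "sobolev_weakly_converges s f A"
  unfolding sobolev_weakly_converges_def
proof (intro conjI allI ballI f A)
  let ?D = "\<lambda>k x. f k x - A x"
  fix L assume L: "L \<in> sobolev_dual s"
  obtain b where b: "\<And>f. f \<in> sobolev s \<Longrightarrow> \<bar>L f\<bar> \<le> b * sobolev_norm s f"
    using L unfolding sobolev_dual_def by blast
  have add: "L (\<lambda>x. f x + h x) = L f + L h" if "f \<in> sobolev s" "h \<in> sobolev s" for f h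
    using L that unfolding sobolev_dual_def by blast
  have ev: "\<forall>\<^sub>F k in sequentially. X k < \<infinity>" by (rule order_tendstoD(2)[OF X]) simp
  have "(\<lambda>k. enn2real (X k)) \<longlonglongrightarrow> 0" by (rule tendsto_enn2real) (use X in auto)
  then have sq: "(\<lambda>k. \<bar>b\<bar> * sqrt (enn2real (X k))) \<longlonglongrightarrow> \<bar>b\<bar> * sqrt 0" by (intro tendsto_mult tendsto_const tendsto_real_sqrt)
  have "(\<lambda>k. L (f k) - L A) \<longlonglongrightarrow> 0"
  proof (rule Lim_null_comparison)
    show "\<forall>\<^sub>F k in sequentially. norm (L (f k) - L A) \<le> \<bar>b\<bar> * sqrt (enn2real (X k))"
      using ev
    proof eventually_elim
      case (elim k)
      note Dk = D[OF elim]
      have "L (f k) = L (\<lambda>x. ?D k x + A x)" by simp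
      also have "\<dots> = L (?D k) + L A" using Dk A by (intro add) auto
      finally have "norm (L (f k) - L A) = \<bar>L (?D k)\<bar>" by simp
      also have "\<dots> \<le> b * sobolev_norm s (?D k)" using Dk by (intro b) auto
      also have "\<dots> \<le> \<bar>b\<bar> * sqrt (enn2real (X k))"
      proof (intro mult_mono)
        have "0 \<le> sobolev_norm s (?D k)" unfolding sobolev_norm_def
          by (intro real_sqrt_ge_zero Bochner_Integration.integral_nonneg) simp
        moreover have "(sobolev_norm s (?D k))\<^sup>2 \<le> enn2real (X k)"
          using enn2real_mono[OF conjunct2[OF Dk]] elim by simp
        ultimately show "sobolev_norm s (?D k) \<le> sqrt (enn2real (X k))" "0 \<le> sobolev_norm s (?D k)"
          by (auto intro: real_le_rsqrt)
      qed auto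
      finally show ?case .
    qed
    show "(\<lambda>k. \<bar>b\<bar> * sqrt (enn2real (X k))) \<longlonglongrightarrow> 0" using sq by simp
  qed
  then show "(\<lambda>k. L (f k)) \<longlonglongrightarrow> L A" by (rule LIM_zero_cancel)
qed

theorem theorem2p2:
  fixes n :: nat and \<rho> s C :: real
    and \<epsilon> :: "nat \<Rightarrow> real"
    and u :: "nat \<Rightarrow> real \<times> (real^'m) \<Rightarrow> real"
  assumes "n = CARD('m) + 1"
    and "n \<in> {2, 3, 4}"
    and "\<rho> > 0"
    and "s \<ge> 0"
    and "n = 2 \<Longrightarrow> s \<le> 1 / 14"
    and "n = 3 \<Longrightarrow> s < 1 / 10"
    and "n = 4 \<Longrightarrow> s < 1 / 22"
    and "\<And>k. 0 < \<epsilon> k \<and> \<epsilon> k < 1"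
    and "\<epsilon> \<longlonglongrightarrow> 0"
    and "\<And>k. u k \<in> admissible"
    and "\<And>k. energy (\<epsilon> k) (u k) \<le> ennreal C"
    and "\<And>k. ess_support (u k) \<subseteq> ball 0 \<rho>"
  shows "\<exists>r A. strict_mono r \<and> A \<in> limit_class n \<and>
           sobolev_weakly_converges s (\<lambda>k. cross_area (u (r k))) A"
proof -
  let ?sq = "\<lambda>a \<xi>. (cmod (FT (cfun a) \<xi>))\<^sup>2"
  note d = assms(1)[symmetric] and n = assms(2) and \<rho> = assms(3)
  have s8: "s < 1 / 8" using n assms(5-7) by auto
  have s0: "0 \<le> s" by (rule assms(4))
  define C1 where "C1 = (2 * pi) ^ n * max C 0"
  have p1: "1 \<le> (2 * pi) ^ n" using pi_gt3 by (intro one_le_power) auto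
  have C1: "max C 0 \<le> C1" "0 \<le> C1"
    using mult_right_mono[OF p1, of "max C 0"] p1 by (auto simp: C1_def)
  define B where "B = measure lborel (ball (0::real^'m) \<rho>)"
  define Q where "Q = (\<lambda>k v. cs_indicator \<rho> v \<and> (AE x in lborel. u k x = v x)
     \<and> ennreal (prefactor n (\<epsilon> k)) * nonlocal (\<epsilon> k) v \<le> ennreal C1
     \<and> (\<forall>\<xi>. \<epsilon> k * \<bar>\<xi>\<bar> * cmod (FT (cfun (section_area v)) \<xi>) \<le> 2 * C1)
     \<and> mass_profile B \<rho> (section_area v))"
  have "\<exists>v. Q k v" for k
  proof -
    have E: "energy (\<epsilon> k) (u k) \<le> ennreal (max C 0)"
      by (rule order_trans[OF assms(11)]) (simp add: ennreal_leI)
    have e: "0 < \<epsilon> k" and C0: "0 \<le> max C 0" using assms(8) by auto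
    obtain v where v: "cs_indicator \<rho> v" "AE x in lborel. u k x = v x"
      "ennreal (prefactor (CARD('m) + 1) (\<epsilon> k)) * nonlocal (\<epsilon> k) v \<le> ennreal ((2 * pi) ^ (CARD('m) + 1) * max C 0)"
      "mass_profile (measure lborel (ball (0::real^'m) \<rho>)) \<rho> (section_area v)"
      and decay: "\<And>\<xi>. \<epsilon> k * \<bar>\<xi>\<bar> * cmod (FT (cfun (section_area v)) \<xi>) \<le> 2 * max C 0"
      using finite_energy_representative[OF \<rho> e assms(10) C0 E assms(12)] by blast
    have "\<epsilon> k * \<bar>\<xi>\<bar> * cmod (FT (cfun (section_area v)) \<xi>) \<le> 2 * C1" for \<xi>
      by (rule order_trans[OF decay]) (use C1(1) in simp)
    then have "Q k v" unfolding Q_def C1_def B_def assms(1) by (intro conjI allI v)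
    then show ?thesis by (rule exI[of "Q k"])
  qed
  then obtain v where Q: "\<And>k. Q k (v k)" by metis
  then have v: "\<And>k. cs_indicator \<rho> (v k)" and eq: "\<And>k. AE x in lborel. u k x = v k x"
     and N: "\<And>k. ennreal (prefactor n (\<epsilon> k)) * nonlocal (\<epsilon> k) (v k) \<le> ennreal C1"
     and decay: "\<And>k \<xi>. \<epsilon> k * \<bar>\<xi>\<bar> * cmod (FT (cfun (section_area (v k))) \<xi>) \<le> 2 * C1"
     and prof: "\<And>k. mass_profile B \<rho> (section_area (v k))"
    unfolding Q_def by simp_all
  have "\<forall>\<^sub>F k in sequentially. \<epsilon> k < exp (-1)" by (rule order_tendstoD(2)[OF assms(9)]) simp
  then obtain k0 where k0: "\<And>k. k \<ge> k0 \<Longrightarrow> \<epsilon> k \<le> exp (-1)" by (auto simp: eventually_sequentially intro: less_imp_le)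
  define a where "a = (\<lambda>k. section_area (v (k + k0)))"
  have a: "mass_profile B \<rho> (a k)" for k unfolding a_def by (rule prof)
  obtain K where K: "K \<ge> 0" and bound: "\<And>\<epsilon> (v :: real \<times> (real^'m) \<Rightarrow> real). 0 < \<epsilon> \<Longrightarrow> \<epsilon> \<le> exp (-1) \<Longrightarrow> cs_indicator \<rho> v \<Longrightarrow>
    ennreal (prefactor n \<epsilon>) * nonlocal \<epsilon> v \<le> ennreal C1 \<Longrightarrow>
    (\<forall>\<xi>. \<epsilon> * \<bar>\<xi>\<bar> * cmod (FT (cfun (section_area v)) \<xi>) \<le> 2 * C1) \<Longrightarrow>
    (\<integral>\<^sup>+\<xi>. ennreal ((1 + \<xi>\<^sup>2) powr (1/8) * ?sq (section_area v) \<xi>) \<partial>lborel) \<le> ennreal K"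
      using uniform_sobolev_bound[OF \<rho> d n C1(2)] by blast
  obtain K' where K': "K' \<ge> 0" and low: "\<And>\<epsilon> C (v :: real \<times> (real^'m) \<Rightarrow> real). 0 < \<epsilon> \<Longrightarrow> \<epsilon> \<le> exp (-1) \<Longrightarrow> cs_indicator \<rho> v \<Longrightarrow> C \<ge> 0 \<Longrightarrow>
    ennreal (prefactor n \<epsilon>) * nonlocal \<epsilon> v \<le> ennreal C \<Longrightarrow>
    (\<integral>\<^sup>+\<xi>. ennreal (indicator {- freq_cutoff n \<epsilon>..freq_cutoff n \<epsilon>} \<xi> * freq_weight n \<xi> *
       ?sq (section_area v) \<xi>) \<partial>lborel) \<le> ennreal (K' * (C + 1))"
      using low_frequency_weighted_bound[OF \<rho> d n] by blast
  obtain r g where r: "strict_mono r" and g: "\<And>\<xi>. (\<lambda>k. FT (cfun (a (r k))) \<xi>) \<longlonglongrightarrow> g \<xi>"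
    using mass_profile_pointwise_subsequence[of B \<rho> a, OF a \<rho>] by blast
  \<comment> \<open>The shift by \<open>k0\<close> makes \<open>\<epsilon> (R k)\<close> small enough for the estimates.\<close>
  define R where "R = (\<lambda>k. r k + k0)"
  have R: "strict_mono R" using r by (simp add: R_def strict_mono_def)
  have Rk0: "R k \<ge> k0" for k by (simp add: R_def)
  have aR: "a (r k) = section_area (v (R k))" for k by (simp add: a_def R_def)
  let ?F = "\<lambda>k. FT (cfun (a (r k)))"
  have am [measurable]: "a k \<in> borel_measurable borel" for k by (rule mass_profileD(1)[OF a])
  have acs: "bounded_cs (cfun (a k))" for k by (rule mass_profile_bounded_cs[OF a])
  have H8: "(\<integral>\<^sup>+\<xi>. ennreal ((1 + \<xi>\<^sup>2) powr (1/8) * (cmod (?F k \<xi>))\<^sup>2) \<partial>lborel) \<le> ennreal K" for k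
    unfolding aR by (rule bound[OF _ k0[OF Rk0] v N allI[OF decay]]) (use assms(8) in simp)
  have Fm: "?F k \<in> borel_measurable borel" for k by measurable
  \<comment> \<open>Exponent \<open>s\<close> is used for the convergence below, exponent \<open>0\<close> to identify the limit.\<close>
  have conv: "(\<lambda>k. \<integral>\<^sup>+\<xi>. ennreal ((1 + \<xi>\<^sup>2) powr s' * (cmod (?F k \<xi> - g \<xi>))\<^sup>2) \<partial>lborel) \<longlonglongrightarrow> 0"
    if "0 \<le> s'" "s' < 1 / 8" for s'
    by (rule weighted_L2_convergence[OF Fm g mass_profile_FT_bound[OF a] H8 that K])
  have one: "(1 + \<xi>\<^sup>2) powr 0 = 1" for \<xi> :: real using add_pos_nonneg[of 1 "\<xi>\<^sup>2"] by simp
  obtain A where A: "mass_profile B \<rho> A" and gA: "\<And>\<xi>. g \<xi> = FT (cfun A) \<xi>"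
    using mass_profile_limit[of B \<rho> "\<lambda>k. a (r k)", OF a g] conv[of 0] unfolding one mult_1_left by auto
  have Acs: "bounded_cs (cfun A)" by (rule mass_profile_bounded_cs[OF A])
  have Am [measurable]: "A \<in> borel_measurable borel" by (rule mass_profileD(1)[OF A])
  have AL: "A \<in> borel_measurable lebesgue" using Am by (intro measurable_completion) simp
  let ?m = "freq_weight n"
  have mm [measurable]: "?m \<in> borel_measurable borel" unfolding freq_weight_def[abs_def] by measurable
  have m0: "0 \<le> ?m \<xi>" for \<xi> by (simp add: freq_weight_def)
  \<comment> \<open>The cutoffs tend to infinity, so Fatou's lemma removes them from the low frequency bound.\<close>
  have weighted: "(\<integral>\<^sup>+\<xi>. ennreal (?m \<xi> * ?sq A \<xi>) \<partial>lborel) \<le> ennreal (K' * (C1 + 1))"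
  proof -
    let ?I = "\<lambda>k. {- freq_cutoff n (\<epsilon> (R k))..freq_cutoff n (\<epsilon> (R k))}"
    have lim: "(\<lambda>k. indicat_real (?I k) \<xi> * ?m \<xi> * (cmod (?F k \<xi>))\<^sup>2) \<longlonglongrightarrow> ?m \<xi> * ?sq A \<xi>" for \<xi>
    proof -
      have eR: "(\<lambda>k. \<epsilon> (R k)) \<longlonglongrightarrow> 0" using LIMSEQ_subseq_LIMSEQ[OF assms(9) R] by (simp add: o_def)
      have "\<forall>\<^sub>F k in sequentially. \<bar>\<xi>\<bar> + 1 \<le> freq_cutoff n (\<epsilon> (R k))"
        by (rule freq_cutoff_eventually_ge[OF eR]) (use assms(8) in auto)
      then have ev: "\<forall>\<^sub>F k in sequentially. ?m \<xi> * (cmod (?F k \<xi>))\<^sup>2 = indicat_real (?I k) \<xi> * ?m \<xi> * (cmod (?F k \<xi>))\<^sup>2"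
      proof eventually_elim
        case (elim k)
        then have "\<xi> \<in> ?I k" by auto
        then show ?case by simp
      qed
      have "(\<lambda>k. ?m \<xi> * (cmod (?F k \<xi>))\<^sup>2) \<longlonglongrightarrow> ?m \<xi> * (cmod (g \<xi>))\<^sup>2" by (intro tendsto_intros g)
      then show ?thesis unfolding gA[symmetric] by (rule Lim_transform_eventually[OF _ ev])
    qed
    have "(\<integral>\<^sup>+\<xi>. ennreal (?m \<xi> * ?sq A \<xi>) \<partial>lborel) = (\<integral>\<^sup>+\<xi>. liminf (\<lambda>k. ennreal (indicat_real (?I k) \<xi> * ?m \<xi> * (cmod (?F k \<xi>))\<^sup>2)) \<partial>lborel)"
      by (intro nn_integral_cong lim_imp_Liminf[symmetric] tendsto_ennrealI lim) simp
    also have "\<dots> \<le> liminf (\<lambda>k. \<integral>\<^sup>+\<xi>. ennreal (indicat_real (?I k) \<xi> * ?m \<xi> * (cmod (?F k \<xi>))\<^sup>2) \<partial>lborel)"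
      by (rule nn_integral_liminf) measurable
    also have "\<dots> \<le> ennreal (K' * (C1 + 1))"
    proof (rule Liminf_le)
      show "\<forall>\<^sub>F k in sequentially. (\<integral>\<^sup>+\<xi>. ennreal (indicat_real (?I k) \<xi> * ?m \<xi> * (cmod (?F k \<xi>))\<^sup>2) \<partial>lborel) \<le> ennreal (K' * (C1 + 1))"
        unfolding aR by (intro always_eventually allI low[OF _ k0[OF Rk0] v C1(2) N]) (use assms(8) in simp)
    qed simp
    finally show ?thesis .
  qed
  have fin: "(\<integral>\<^sup>+\<xi>. ennreal ((1 + \<xi>\<^sup>2) powr s' * ?sq A \<xi>) \<partial>lborel) < \<infinity>"
    if "n = 2 \<Longrightarrow> s' \<le> 1 / 2" "s' \<le> 1" for s'
  proof -
    have "(\<integral>\<^sup>+\<xi>. ennreal ((1 + \<xi>\<^sup>2) powr s' * ?sq A \<xi>) \<partial>lborel)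
      \<le> (\<integral>\<^sup>+\<xi>. ennreal (?sq A \<xi>) + ennreal (?m \<xi> * ?sq A \<xi>) \<partial>lborel)"
    proof (rule nn_integral_mono)
      fix \<xi> :: real
      have "(1 + \<xi>\<^sup>2) powr s' * ?sq A \<xi> \<le> (1 + ?m \<xi>) * ?sq A \<xi>"
        by (intro mult_right_mono sobolev_weight_le that) auto
      then have "ennreal ((1 + \<xi>\<^sup>2) powr s' * ?sq A \<xi>) \<le> ennreal (?sq A \<xi> + ?m \<xi> * ?sq A \<xi>)"
        by (intro ennreal_leI) (simp add: algebra_simps)
      also have "\<dots> = ennreal (?sq A \<xi>) + ennreal (?m \<xi> * ?sq A \<xi>)"
        using m0 by (intro ennreal_plus) auto
      finally show "ennreal ((1 + \<xi>\<^sup>2) powr s' * ?sq A \<xi>) \<le> ennreal (?sq A \<xi>) + ennreal (?m \<xi> * ?sq A \<xi>)" .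
    qed
    also have "\<dots> = (\<integral>\<^sup>+\<xi>. ennreal (?sq A \<xi>) \<partial>lborel) + (\<integral>\<^sup>+\<xi>. ennreal (?m \<xi> * ?sq A \<xi>) \<partial>lborel)"
      by (rule nn_integral_add) measurable
    also have "\<dots> < \<infinity>"
      unfolding plancherel_FT[OF Acs] using le_less_trans[OF weighted ennreal_less_top] by (simp add: ennreal_add_less_top)
    finally show ?thesis .
  qed
  have Asob: "A \<in> sobolev s'" if "n = 2 \<Longrightarrow> s' \<le> 1 / 2" "s' \<le> 1" for s'
    by (rule sobolev_FT(1)[OF AL Acs _ fin[OF that]]) auto
  have Alim: "A \<in> limit_class n"
  proof -
    have "A \<in> limit_space n" unfolding limit_space_def using Asob n by auto
    moreover have "integrable lborel A" using integrable_Re[OF bounded_cs_integrable[OF Acs]] by simp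
    then have "integrable lebesgue A" by (subst integrable_completion) auto
    moreover have "(LINT x|lebesgue. A x) = 1"
      using mass_profileD(4)[OF A] by (subst integral_completion) auto
    ultimately show ?thesis by (simp add: limit_class_def)
  qed
  let ?f = "\<lambda>k. cross_area (u (R k))"
  have feq: "AE x in lborel. ?f k x = a (r k) x" for k
    unfolding aR by (rule cross_area_eq_section_area[OF v eq])
  have fm: "?f k \<in> borel_measurable lebesgue" for k by (rule borel_measurable_lebesgue_AE[OF am feq])
  have fsob: "?f k \<in> sobolev s" for k
  proof (rule sobolev_FT(1)[OF fm acs feq])
    have "(\<integral>\<^sup>+\<xi>. ennreal ((1 + \<xi>\<^sup>2) powr s * (cmod (?F k \<xi>))\<^sup>2) \<partial>lborel) \<le> (\<integral>\<^sup>+\<xi>. ennreal ((1 + \<xi>\<^sup>2) powr (1/8) * (cmod (?F k \<xi>))\<^sup>2) \<partial>lborel)"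
      using s8 by (intro nn_integral_mono ennreal_leI mult_right_mono powr_mono) auto
    also have "\<dots> < \<infinity>" using le_less_trans[OF H8 ennreal_less_top] by simp
    finally show "(\<integral>\<^sup>+\<xi>. ennreal ((1 + \<xi>\<^sup>2) powr s * (cmod (?F k \<xi>))\<^sup>2) \<partial>lborel) < \<infinity>" .
  qed
  have As: "A \<in> sobolev s" using s8 by (intro Asob) auto
  let ?X = "\<lambda>k. \<integral>\<^sup>+\<xi>. ennreal ((1 + \<xi>\<^sup>2) powr s * (cmod (?F k \<xi> - g \<xi>))\<^sup>2) \<partial>lborel"
  let ?D = "\<lambda>k x. ?f k x - A x"
  have Xlim: "?X \<longlonglongrightarrow> 0" by (rule conv[OF s0 s8])
  have D: "?D k \<in> sobolev s \<and> ennreal ((sobolev_norm s (?D k))\<^sup>2) \<le> ?X k" if "?X k < \<infinity>" for k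
  proof -
    let ?h = "\<lambda>x. a (r k) x - A x"
    have hF: "FT (cfun ?h) \<xi> = ?F k \<xi> - g \<xi>" for \<xi>
      unfolding gA of_real_diff by (rule FT_diff[OF acs Acs])
    have hcs: "bounded_cs (cfun ?h)" unfolding of_real_diff by (intro bounded_cs_diff acs Acs)
    have heq: "AE x in lborel. ?D k x = ?h x" using feq by eventually_elim simp
    have hm: "?D k \<in> borel_measurable lebesgue" by (rule borel_measurable_lebesgue_AE[OF _ heq]) measurable
    show ?thesis using sobolev_FT[OF hm hcs heq, of s] that unfolding hF by blast
  qed
  have "sobolev_weakly_converges s ?f A"
    by (rule sobolev_weakly_convergesI[OF fsob As Xlim D])
  then show ?thesis using R Alim by blast
qed

end
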